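(* Let $W:A^{\mathbb{Z}}\times\mathcal{B}^{\mathbb{Z}}\to\mathbb{C}$ be a stationary cq-channel. Then the following are equivalent: (1) $W$ is an extreme point of the convex set of stationary cq-channels; (2) $W$ is ergodic.
   Context: $A$ is a finite set, $\mathcal{B}=\mathcal{L}(\mathcal{H})$ with $\mathcal{H}$ finite-dimensional, $\mathcal{B}^{\mathbb{Z}}$ the quasi-local $C^*$-algebra built from $\mathcal{B}$ (norm completion of the union of $\mathcal{B}^{\Lambda}=\bigotimes_{n\in\Lambda}\mathcal{B}$, $\Lambda\subset\mathbb{Z}$ finite). $\Sigma_c$ is the Borel (= cylinder) $\sigma$-field on $A^{\mathbb{Z}}$ and $B(A^{\mathbb{Z}},\Sigma_c)$ the $C^*$-algebra of bounded Borel functions. A cq-channel is a map $W:A^{\mathbb{Z}}\times\mathcal{B}^{\mathbb{Z}}\to\mathbb{C}$ with $x\mapsto W(x,b)$ Borel measurable and $b\mapsto W(x,b)$ a state. $T_{in}$ is the left shift on $A^{\mathbb{Z}}$ (also acting on functions by $f\mapsto f\circ T_{in}$) and $T_{out}$ is the shift $*$-automorphism of $\mathcal{B}^{\mathbb{Z}}$ mapping $\mathcal{B}^{\Lambda}$ onto $\mathcal{B}^{\Lambda+1}$. $W$ is stationary if $W(T_{in}x,b)=W(x,T_{out}b)$ for all $x,b$. For a probability measure $p$ on $(A^{\mathbb{Z}},\Sigma_c)$, the joint input-output state $\psi_{p,W}$ on $B(A^{\mathbb{Z}},\Sigma_c)\otimes\mathcal{B}^{\mathbb{Z}}$ is the linear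 extension of $\psi_{p,W}(f\otimes b)=\int f(x)W(x,b)p(dx)$. A state is stationary if it is invariant under $T_{in}\otimes T_{out}$ and ergodic if it is an extreme point of the convex set of stationary states. $W$ is ergodic if it is stationary and $\psi_{p,W}$ is ergodic for every stationary ergodic probability measure $p$. Two stationary cq-channels $W_1,W_2$ are regarded as equal if $\psi_{p,W_1}=\psi_{p,W_2}$ for every stationary ($T_{in}$-invariant) probability measure $p$ on $(A^{\mathbb{Z}},\Sigma_c)$ (equivalently, for every $b$ and stationary $p$, $W_1(\cdot,b)=W_2(\cdot,b)$ $p$-a.s.); extremality refers to this notion of equality. *)

theory Defs
  imports "HOL-Probability.Probability" "HOL-Library.FuncSet"
begin

text \<open>Quasi-local algebra over B = L(H), H = complex functions on the finite type 'h.
  A local observable in B^Lambda (Lambda a finite subset of int) is a matrix kernel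
  indexed by the configurations in conf Lambda.\<close>

type_synonym 'h kern = "(int \<Rightarrow> 'h) \<Rightarrow> (int \<Rightarrow> 'h) \<Rightarrow> complex"

definition qconf :: "int set \<Rightarrow> (int \<Rightarrow> 'h) set" where
  "qconf L = PiE L (\<lambda>_. UNIV)"

definition kid :: "int set \<Rightarrow> 'h kern" where
  "kid L = (\<lambda>s t. if s = t then 1 else 0)"

definition kmult :: "int set \<Rightarrow> 'h kern \<Rightarrow> 'h kern \<Rightarrow> 'h kern" where
  "kmult L M N = (\<lambda>s t. \<Sum>r\<in>qconf L. M s r * N r t)"

definition kadj :: "'h kern \<Rightarrow> 'h kern" where
  "kadj M = (\<lambda>s t. cnj (M t s))"

text \<open>Embedding B^L into B^L' (L a subset of L'): M is mapped to M tensor identity.\<close>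
definition kembed :: "int set \<Rightarrow> int set \<Rightarrow> 'h kern \<Rightarrow> 'h kern" where
  "kembed L L' M = (\<lambda>s t. M (restrict s L) (restrict t L) *
      (if restrict s (L' - L) = restrict t (L' - L) then 1 else 0))"

definition shiftset :: "int set \<Rightarrow> int set" where
  "shiftset L = (\<lambda>n. n + 1) ` L"

definition kshift :: "int set \<Rightarrow> 'h kern \<Rightarrow> 'h kern" where
  "kshift L M = (\<lambda>s t. M (restrict (\<lambda>n. s (n + 1)) L) (restrict (\<lambda>n. t (n + 1)) L))"

definition cnonneg :: "complex \<Rightarrow> bool" where
  "cnonneg z \<longleftrightarrow> Im z = 0 \<and> Re z \<ge> 0"

text \<open>A state on the quasi-local algebra, given on its dense local part
  (the union of the local algebras B^L), where it determines the state uniquely.\<close>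
definition qstate :: "(int set \<Rightarrow> 'h kern \<Rightarrow> complex) \<Rightarrow> bool" where
  "qstate w \<longleftrightarrow>
     (\<forall>L M N. finite L \<longrightarrow> (\<forall>s\<in>qconf L. \<forall>t\<in>qconf L. M s t = N s t) \<longrightarrow> w L M = w L N) \<and>
     (\<forall>L M N c. finite L \<longrightarrow> w L (\<lambda>s t. M s t + c * N s t) = w L M + c * w L N) \<and>
     (\<forall>L M. finite L \<longrightarrow> cnonneg (w L (kmult L (kadj M) M))) \<and>
     (\<forall>L. finite L \<longrightarrow> w L (kid L) = 1) \<and>
     (\<forall>L L' M. finite L' \<longrightarrow> L \<subseteq> L' \<longrightarrow> w L' (kembed L L' M) = w L M)"

definition Min :: "(int \<Rightarrow> 'a) measure" where
  "Min = PiM (UNIV :: int set) (\<lambda>_. count_space (UNIV :: 'a set))"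

definition Tin :: "(int \<Rightarrow> 'a) \<Rightarrow> (int \<Rightarrow> 'a)" where
  "Tin x = (\<lambda>n. x (n + 1))"

definition stat_prob :: "(int \<Rightarrow> 'a) measure \<Rightarrow> bool" where
  "stat_prob p \<longleftrightarrow> prob_space p \<and> sets p = sets Min \<and>
     (\<forall>S\<in>sets Min. emeasure p (Tin -` S) = emeasure p S)"

definition ergodic_prob :: "(int \<Rightarrow> 'a) measure \<Rightarrow> bool" where
  "ergodic_prob p \<longleftrightarrow> stat_prob p \<and>
     (\<forall>S\<in>sets Min. Tin -` S = S \<longrightarrow> emeasure p S = 0 \<or> emeasure p S = 1)"

definition cqchannel :: "((int \<Rightarrow> 'a) \<Rightarrow> int set \<Rightarrow> 'h kern \<Rightarrow> complex) \<Rightarrow> bool" where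
  "cqchannel W \<longleftrightarrow> (\<forall>x. qstate (W x)) \<and>
     (\<forall>L M. finite L \<longrightarrow> (\<lambda>x. W x L M) \<in> borel_measurable Min)"

definition stationary_channel :: "((int \<Rightarrow> 'a) \<Rightarrow> int set \<Rightarrow> 'h kern \<Rightarrow> complex) \<Rightarrow> bool" where
  "stationary_channel W \<longleftrightarrow> cqchannel W \<and>
     (\<forall>x L M. finite L \<longrightarrow> W (Tin x) L M = W x (shiftset L) (kshift L M))"

definition chan_eq :: "((int \<Rightarrow> 'a) \<Rightarrow> int set \<Rightarrow> 'h kern \<Rightarrow> complex) \<Rightarrow>
     ((int \<Rightarrow> 'a) \<Rightarrow> int set \<Rightarrow> 'h kern \<Rightarrow> complex) \<Rightarrow> bool" where
  "chan_eq W1 W2 \<longleftrightarrow> (\<forall>p. stat_prob p \<longrightarrow>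
     (\<forall>L M. finite L \<longrightarrow> (AE x in p. W1 x L M = W2 x L M)))"

definition extreme_channel :: "((int \<Rightarrow> 'a) \<Rightarrow> int set \<Rightarrow> 'h kern \<Rightarrow> complex) \<Rightarrow> bool" where
  "extreme_channel W \<longleftrightarrow> stationary_channel W \<and>
     (\<forall>W1 W2 (t::real). stationary_channel W1 \<and> stationary_channel W2 \<and> 0 < t \<and> t < 1 \<and>
        chan_eq W (\<lambda>x L M. complex_of_real t * W1 x L M + complex_of_real (1 - t) * W2 x L M)
        \<longrightarrow> chan_eq W1 W)"

text \<open>The joint algebra B(A^Z) tensor B^Z: its local part B(A^Z) tensor B^L consists
  of bounded Borel matrix-valued functions F on A^Z.\<close>
definition jadm :: "int set \<Rightarrow> ((int \<Rightarrow> 'a) \<Rightarrow> 'h kern) \<Rightarrow> bool" where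
  "jadm L F \<longleftrightarrow> finite L \<and> (\<forall>s\<in>qconf L. \<forall>t\<in>qconf L.
      (\<lambda>x. F x s t) \<in> borel_measurable Min \<and> bounded (range (\<lambda>x. F x s t)))"

definition jstate :: "(int set \<Rightarrow> ((int \<Rightarrow> 'a) \<Rightarrow> 'h kern) \<Rightarrow> complex) \<Rightarrow> bool" where
  "jstate phi \<longleftrightarrow>
     (\<forall>L F G. jadm L F \<longrightarrow> jadm L G \<longrightarrow> (\<forall>x. \<forall>s\<in>qconf L. \<forall>t\<in>qconf L. F x s t = G x s t)
         \<longrightarrow> phi L F = phi L G) \<and>
     (\<forall>L F G c. jadm L F \<longrightarrow> jadm L G \<longrightarrow>
         phi L (\<lambda>x s t. F x s t + c * G x s t) = phi L F + c * phi L G) \<and>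
     (\<forall>L F. jadm L F \<longrightarrow> cnonneg (phi L (\<lambda>x. kmult L (kadj (F x)) (F x)))) \<and>
     (\<forall>L. finite L \<longrightarrow> phi L (\<lambda>x. kid L) = 1) \<and>
     (\<forall>L L' F. jadm L F \<longrightarrow> finite L' \<longrightarrow> L \<subseteq> L' \<longrightarrow>
         phi L' (\<lambda>x. kembed L L' (F x)) = phi L F)"

definition jstationary :: "(int set \<Rightarrow> ((int \<Rightarrow> 'a) \<Rightarrow> 'h kern) \<Rightarrow> complex) \<Rightarrow> bool" where
  "jstationary phi \<longleftrightarrow> (\<forall>L F. jadm L F \<longrightarrow>
      phi (shiftset L) (\<lambda>x. kshift L (F (Tin x))) = phi L F)"

definition jergodic :: "(int set \<Rightarrow> ((int \<Rightarrow> 'a) \<Rightarrow> 'h kern) \<Rightarrow> complex) \<Rightarrow> bool" where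
  "jergodic phi \<longleftrightarrow> jstate phi \<and> jstationary phi \<and>
     (\<forall>phi1 phi2 (t::real). jstate phi1 \<and> jstationary phi1 \<and> jstate phi2 \<and> jstationary phi2 \<and>
        0 < t \<and> t < 1 \<and>
        (\<forall>L F. jadm L F \<longrightarrow> phi L F = complex_of_real t * phi1 L F + complex_of_real (1 - t) * phi2 L F)
        \<longrightarrow> (\<forall>L F. jadm L F \<longrightarrow> phi1 L F = phi L F))"

text \<open>The joint input-output state psi_{p,W}: linear extension of
  f tensor b to the integral of f(x) W(x,b) over p.\<close>
definition psi :: "(int \<Rightarrow> 'a) measure \<Rightarrow> ((int \<Rightarrow> 'a) \<Rightarrow> int set \<Rightarrow> 'h kern \<Rightarrow> complex) \<Rightarrow>
     int set \<Rightarrow> ((int \<Rightarrow> 'a) \<Rightarrow> 'h kern) \<Rightarrow> complex" where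
  "psi p W L F = (\<integral>x. W x L (F x) \<partial>p)"

definition ergodic_channel :: "((int \<Rightarrow> 'a) \<Rightarrow> int set \<Rightarrow> 'h kern \<Rightarrow> complex) \<Rightarrow> bool" where
  "ergodic_channel W \<longleftrightarrow> stationary_channel W \<and>
     (\<forall>p. ergodic_prob p \<longrightarrow> jergodic (psi p W))"

end

theory Submission
  imports Defs
begin

text \<open>
  If \<open>W\<close> is extreme and \<open>p\<close> ergodic, split the joint state of \<open>p\<close> and \<open>W\<close> into stationary joint
  states. Their input marginals are stationary and dominated by a multiple of \<open>p\<close>, so by Birkhoff's
  theorem they equal \<open>p\<close>; Radon-Nikodym densities on matrix units then turn each summand into a
  stationary channel, on a \<open>p\<close>-full set that is exactly shift invariant. Off a further such set both
  channels are replaced by \<open>W\<close>, which gives a convex decomposition of \<open>W\<close> itself.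

  Conversely, a convex decomposition of an ergodic \<open>W\<close> is trivial almost surely for every ergodic
  input. A set of positive measure for some stationary measure has positive measure for some ergodic
  one, namely a limit of empirical measures along a typical orbit, so it is trivial for every
  stationary input.
\<close>

subsection \<open>Birkhoff's ergodic theorem\<close>

text \<open>The obstacle is the gap between pointwise and almost sure statements. A channel has to
  be a state and to intertwine the shifts at every input, and equality of channels refers to all
  stationary inputs at once, whereas densities give identities for one \<open>p\<close> only, each
  with its own null set. So every requirement is reduced to countably many instances: the linear
  ones to matrix units, positivity, which is not linear, to kernels with rational entries. Exact
  invariance of the good set is what makes pasting compatible with stationarity. The multiple by
  which \<open>p\<close> dominates the marginal of a summand of weight \<open>t\<close> is
  \<open>1/t\<close>, because the other summand is positive. Matrix units are in turn controlled by
  the input marginal, because a positive functional bounds its entries by its value at the identity.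
  The finite alphabet enters through cylinders: they are countably many, and they are closed in a
  compact space, so limiting frequencies along a single orbit already extend to a measure.\<close>

locale measure_preserving = prob_space M for M :: "'b measure" +
  fixes T :: "'b \<Rightarrow> 'b"
  assumes space_UNIV: "space M = UNIV"
    and T_meas [measurable]: "T \<in> measurable M M"
    and T_inv: "distr M M T = M"
begin

definition birk :: "('b \<Rightarrow> real) \<Rightarrow> nat \<Rightarrow> 'b \<Rightarrow> real" where
  "birk f n x = (\<Sum>k<n. f ((T ^^ k) x))"

lemma Tpow_meas [measurable]: "(T ^^ k) \<in> measurable M M"
  by (induction k) auto

lemma birk_meas [measurable]:
  assumes [measurable]: "f \<in> borel_measurable M"
  shows "birk f n \<in> borel_measurable M"
  unfolding birk_def by measurable

lemma birk_0 [simp]: "birk f 0 x = 0"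
  by (simp add: birk_def)

lemma birk_Suc: "birk f (Suc n) x = f x + birk f n (T x)"
  unfolding birk_def by (simp add: sum.lessThan_Suc_shift funpow_swap1 del: sum.lessThan_Suc)

lemma birk_bound:
  assumes "\<And>x. \<bar>f x\<bar> \<le> B"
  shows "\<bar>birk f n x\<bar> \<le> real n * B"
proof -
  have "\<bar>birk f n x\<bar> \<le> (\<Sum>k<n. \<bar>f ((T ^^ k) x)\<bar>)"
    unfolding birk_def by (rule sum_abs)
  also have "\<dots> \<le> (\<Sum>k<n. B)"
    by (intro sum_mono assms)
  finally show ?thesis by simp
qed

lemma integral_T:
  fixes f :: "'b \<Rightarrow> 'c::{banach, second_countable_topology}"
  assumes [measurable]: "f \<in> borel_measurable M"
  shows "(\<integral>x. f (T x) \<partial>M) = (\<integral>x. f x \<partial>M)"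
  by (metis integral_distr[OF T_meas assms] T_inv)

lemma integral_Tpow:
  fixes f :: "'b \<Rightarrow> 'c::{banach, second_countable_topology}"
  assumes [measurable]: "f \<in> borel_measurable M"
  shows "(\<integral>x. f ((T ^^ k) x) \<partial>M) = (\<integral>x. f x \<partial>M)"
proof (induction k)
  case (Suc k)
  have "(\<integral>x. f ((T ^^ Suc k) x) \<partial>M) = (\<integral>x. f ((T ^^ k) (T x)) \<partial>M)"
    by (simp add: funpow_swap1)
  also have "\<dots> = (\<integral>x. f ((T ^^ k) x) \<partial>M)"
    by (rule integral_T) measurable
  finally show ?case using Suc by simp
qed simp

lemma bounded_integrable:
  fixes f :: "'b \<Rightarrow> 'c::{banach, second_countable_topology}"
  assumes "f \<in> borel_measurable M" "\<And>x. norm (f x) \<le> B"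
  shows "integrable M f"
  using assms by (intro integrable_const_bound[where B=B]) auto

text \<open>This is the maximum of \<open>birk f k x\<close> over 0 \<le> k \<le> n, where k = 0
  contributes 0. The recursion along the orbit builds in the identity on which Garsia's proof of the
  maximal inequality rests.\<close>

primrec birk_max :: "('b \<Rightarrow> real) \<Rightarrow> nat \<Rightarrow> 'b \<Rightarrow> real" where
  "birk_max f 0 x = 0"
| "birk_max f (Suc n) x = max 0 (f x + birk_max f n (T x))"

lemma birk_max_meas [measurable]:
  assumes [measurable]: "f \<in> borel_measurable M"
  shows "birk_max f n \<in> borel_measurable M"
proof (induction n)
  case (Suc n)
  note [measurable] = Suc
  show ?case by (simp add: birk_max.simps[abs_def])
qed (simp add: birk_max.simps[abs_def])

lemma birk_max_nonneg: "0 \<le> birk_max f n x"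
  by (cases n) auto

lemma birk_max_mono: "birk_max f n x \<le> birk_max f (Suc n) x"
proof (induction n arbitrary: x)
  case (Suc n)
  show ?case using Suc[of "T x"] by (simp add: max_def)
qed (simp add: birk_max_nonneg)

lemma birk_max_bound:
  assumes "\<And>x. \<bar>f x\<bar> \<le> B"
  shows "\<bar>birk_max f n x\<bar> \<le> real n * B"
proof (induction n arbitrary: x)
  case (Suc n)
  have "0 \<le> B" using assms[of x] by linarith
  then show ?case using Suc[of "T x"] assms[of x] by (simp add: max_def algebra_simps abs_le_iff)
qed simp

text \<open>The running maximum dominates every partial sum and is itself always one of
  them.\<close>

lemma birk_max_pos_iff: "(\<exists>n. 0 < birk_max f n x) \<longleftrightarrow> (\<exists>n. 0 < birk f n x)"
proof -
  have le: "birk f n x \<le> birk_max f n x" for n x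
  proof (induction n arbitrary: x)
    case (Suc n)
    show ?case using Suc[of "T x"] by (simp add: birk_Suc)
  qed simp
  have ex: "\<exists>k. birk_max f n x = birk f k x" for n x
  proof (induction n arbitrary: x)
    case (Suc n)
    obtain k where "birk_max f n (T x) = birk f k (T x)" using Suc by blast
    then show ?case by (cases "f x + birk_max f n (T x) \<le> 0")
      (auto simp: max_def birk_Suc[symmetric] intro: exI[of _ 0])
  qed (auto intro: exI[of _ 0])
  show ?thesis using le ex by (metis less_le_trans)
qed

text \<open>Garsia's argument: where \<open>birk_max f n\<close> is positive it equals f plus the
  previous maximum at \<open>T x\<close>, hence is at most f plus \<open>birk_max f n (T x)\<close>;
  elsewhere it is 0 and the maximum at \<open>T x\<close> is nonnegative. On integration the two
  maxima cancel by invariance of the measure, and then n is sent to infinity.\<close>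

lemma maximal_ergodic:
  assumes f [measurable]: "f \<in> borel_measurable M" and B: "\<And>x. \<bar>f x\<bar> \<le> B"
  shows "0 \<le> (\<integral>x. f x * indicator {x. \<exists>n. 0 < birk f n x} x \<partial>M)"
proof -
  let ?P = "\<lambda>n. {x. 0 < birk_max f n x}"
  have Pm [measurable]: "?P n \<in> sets M" for n
  proof -
    have "{x\<in>space M. 0 < birk_max f n x} \<in> sets M" by measurable
    then show ?thesis by (simp add: space_UNIV)
  qed
  have nonneg: "0 \<le> (\<integral>x. f x * indicator (?P n) x \<partial>M)" for n
  proof (cases n)
    case (Suc m)
    have int: "integrable M (birk_max f n)"
      using birk_max_bound[OF B] by (intro bounded_integrable[where B="real n * B"]) auto
    have intT: "integrable M (\<lambda>x. birk_max f n (T x))"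
      using birk_max_bound[OF B] by (intro bounded_integrable[where B="real n * B"]) auto
    have "0 = (\<integral>x. birk_max f n x - birk_max f n (T x) \<partial>M)"
      using int intT by (simp add: integral_T)
    also have "\<dots> \<le> (\<integral>x. f x * indicator (?P n) x \<partial>M)"
    proof (rule integral_mono)
      show "integrable M (\<lambda>x. f x * indicator (?P n) x)"
        using B by (intro bounded_integrable[where B=B])
          (auto simp: indicator_def intro: order_trans[OF abs_ge_zero])
      fix x
      show "birk_max f n x - birk_max f n (T x) \<le> f x * indicator (?P n) x"
      proof (cases "0 < birk_max f n x")
        case True
        then have "birk_max f n x = f x + birk_max f m (T x)" by (simp add: Suc max_def split: if_splits)
        also have "\<dots> \<le> f x + birk_max f n (T x)"
          unfolding Suc using birk_max_mono by simp
        finally show ?thesis using True by simp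
      next
        case False
        then show ?thesis using birk_max_nonneg[of f n x] birk_max_nonneg[of f n "T x"] by simp
      qed
    qed (use int intT in auto)
    finally show ?thesis .
  qed simp
  have "(\<lambda>n. \<integral>x. f x * indicator (?P n) x \<partial>M) \<longlonglongrightarrow>
      (\<integral>x. f x * indicator (\<Union>n. ?P n) x \<partial>M)"
  proof (rule integral_dominated_convergence[where w="\<lambda>_. B"])
    have "incseq ?P"
      by (intro incseq_SucI) (use birk_max_mono in \<open>auto intro: less_le_trans\<close>)
    then show "AE x in M. (\<lambda>n. f x * indicator (?P n) x) \<longlonglongrightarrow> f x * indicator (\<Union>n. ?P n) x"
      by (intro AE_I2 tendsto_mult tendsto_const LIMSEQ_indicator_incseq)
    show "AE x in M. norm (f x * indicator (?P n) x) \<le> B" for n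
      using B by (auto simp: indicator_def intro: order_trans[OF abs_ge_zero])
  qed auto
  then have "0 \<le> (\<integral>x. f x * indicator (\<Union>n. ?P n) x \<partial>M)"
    by (rule LIMSEQ_le_const) (use nonneg in auto)
  moreover have "(\<Union>n. ?P n) = {x. \<exists>n. 0 < birk f n x}"
    using birk_max_pos_iff by auto
  ultimately show ?thesis by simp
qed

lemma birk_invariant_mult:
  assumes "T -` J = J"
  shows "birk (\<lambda>x. (f x - b) * indicator J x) n x = (birk f n x - real n * b) * indicator J x"
proof (induction n arbitrary: x)
  case (Suc n)
  have "indicator J (T x) = (indicator J x :: real)"
    using assms by (auto simp: indicator_def)
  then show ?case using Suc[of "T x"] by (simp add: birk_Suc algebra_simps)
qed simp

text \<open>The maximal inequality is applied to f - b times the indicator of J. As J is invariant,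
  the partial sums of this function are those of f minus n b on J and 0 off J, so the set where one
  of them is positive is exactly J.\<close>

lemma maximal_on_invariant:
  assumes f [measurable]: "f \<in> borel_measurable M" and B: "\<And>x. \<bar>f x\<bar> \<le> B"
    and J [measurable]: "J \<in> sets M" and inv: "T -` J = J"
    and ex: "\<And>x. x \<in> J \<Longrightarrow> \<exists>n. real n * b < birk f n x"
  shows "b * prob J \<le> (\<integral>x. f x * indicator J x \<partial>M)"
proof -
  let ?g = "\<lambda>x. (f x - b) * indicator J x"
  have "0 \<le> (\<integral>x. ?g x * indicator {x. \<exists>n. 0 < birk ?g n x} x \<partial>M)"
  proof (rule maximal_ergodic)
    show "\<bar>?g x\<bar> \<le> B + \<bar>b\<bar>" for x
      using B[of x] by (auto simp: indicator_def)
  qed measurable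
  also have "{x. \<exists>n. 0 < birk ?g n x} = J"
    unfolding birk_invariant_mult[OF inv]
    using ex by (auto simp: zero_less_mult_iff split: split_indicator split_indicator_asm)
  also have "(\<integral>x. ?g x * indicator J x \<partial>M) = (\<integral>x. f x * indicator J x - b * indicator J x \<partial>M)"
    by (intro Bochner_Integration.integral_cong) (auto simp: indicator_def)
  also have "\<dots> = (\<integral>x. f x * indicator J x \<partial>M) - b * prob J"
  proof (subst Bochner_Integration.integral_diff)
    show "integrable M (\<lambda>x. f x * indicator J x)"
      using B by (intro bounded_integrable[where B=B])
          (auto simp: indicator_def intro: order_trans[OF abs_ge_zero])
    show "integrable M (\<lambda>x. b * indicator J x)"
      by (intro bounded_integrable[where B="\<bar>b\<bar>"]) (auto simp: indicator_def)
  qed (auto simp: space_UNIV)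
  finally show ?thesis by simp
qed

text \<open>The two sums differ only by \<open>f ((T ^^ n) x) - f x\<close>, which is at most 2 B in
  absolute value whatever n is.\<close>

lemma avg_shift:
  assumes B: "\<And>x. \<bar>f x\<bar> \<le> B"
  shows "(\<lambda>n. birk f n (T x) / real n - birk f n x / real n) \<longlonglongrightarrow> 0"
proof (rule Lim_null_comparison)
  have "birk f n (T x) - birk f n x = f ((T ^^ n) x) - f x" for n
    using birk_Suc[of f n x] by (simp add: birk_def)
  then have "norm (birk f n (T x) - birk f n x) \<le> 2 * B" for n
    using B[of x] B[of "(T ^^ n) x"] by (simp add: abs_le_iff)
  then have "norm (birk f n (T x) / real n - birk f n x / real n) \<le> 2 * B * inverse (real n)" for n
    unfolding diff_divide_distrib[symmetric] norm_divide
    using divide_right_mono[of "norm (birk f n (T x) - birk f n x)" "2 * B" "real n"]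
    by (simp add: divide_inverse)
  then show "\<forall>\<^sub>F n in sequentially. norm (birk f n (T x) / real n - birk f n x / real n) \<le> 2 * B * inverse (real n)"
    by simp
  show "(\<lambda>n. 2 * B * inverse (real n)) \<longlonglongrightarrow> 0"
    by (rule tendsto_mult_right_zero[OF lim_inverse_n])
qed

lemma avg_lim_shift_iff:
  assumes B: "\<And>x. \<bar>f x\<bar> \<le> B"
  shows "(\<lambda>n. birk f n (T x) / real n) \<longlonglongrightarrow> l \<longleftrightarrow> (\<lambda>n. birk f n x / real n) \<longlonglongrightarrow> l"
proof -
  note * = avg_shift[where f=f and B=B and x=x, OF B]
  show ?thesis
  proof
    assume "(\<lambda>n. birk f n (T x) / real n) \<longlonglongrightarrow> l"
    from tendsto_diff[OF this *] show "(\<lambda>n. birk f n x / real n) \<longlonglongrightarrow> l" by simp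
  next
    assume "(\<lambda>n. birk f n x / real n) \<longlonglongrightarrow> l"
    from tendsto_add[OF this *] show "(\<lambda>n. birk f n (T x) / real n) \<longlonglongrightarrow> l" by simp
  qed
qed

text \<open>On the invariant set J where the averages oscillate across a < b, the maximal inequality
  for f and for its negative shows that the integral of f over J is at least b times and at most a
  times the probability of J, so J is null. Rational pairs exhaust all possible
  oscillations.\<close>

theorem birkhoff:
  assumes f [measurable]: "f \<in> borel_measurable M" and B: "\<And>x. \<bar>f x\<bar> \<le> B"
  shows "AE x in M. convergent (\<lambda>n. birk f n x / real n)"
proof -
  \<comment> \<open>Upper and lower limits are taken in the extended reals, where they always exist;
    the bound B makes them finite at the end.\<close>
  let ?a = "\<lambda>n x. ereal (birk f n x / real n)"
  let ?u = "\<lambda>x. limsup (\<lambda>n. ?a n x)" and ?l = "\<lambda>x. liminf (\<lambda>n. ?a n x)"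
  have lim0: "(\<lambda>n. ereal (birk f n (T x) / real n - birk f n x / real n)) \<longlonglongrightarrow> 0" for x
    using avg_shift[where f=f and B=B and x=x, OF B] by (simp add: zero_ereal_def)
  have uT: "?u (T x) = ?u x" for x
    using ereal_limsup_lim_add[OF lim0[of x], of "\<lambda>n. ?a n x"] by simp
  have lT: "?l (T x) = ?l x" for x
    using ereal_liminf_lim_add[OF lim0[of x], of "\<lambda>n. ?a n x"] by simp
  have null: "AE x in M. \<not> (?l x < ereal a \<and> ereal b < ?u x)" if ab: "a < b" for a b
  proof -
    define J where "J = {x. ?l x < ereal a \<and> ereal b < ?u x}"
    have "{x\<in>space M. ?l x < ereal a \<and> ereal b < ?u x} \<in> sets M" by measurable
    then have J [measurable]: "J \<in> sets M" by (simp add: J_def space_UNIV)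
    have inv: "T -` J = J" by (auto simp: J_def uT lT)
    have "b * prob J \<le> (\<integral>x. f x * indicator J x \<partial>M)"
    proof (rule maximal_on_invariant[OF f B J inv])
      fix x assume "x \<in> J"
      then have "ereal b < ?u x" by (simp add: J_def)
      then have "\<exists>\<^sub>F n in sequentially. ereal b < ?a n x"
        using Limsup_bounded[of "\<lambda>n. ?a n x" "ereal b" sequentially]
        by (auto simp: frequently_def not_less intro: ccontr)
      \<comment> \<open>At n = 0 the average is 0 by the convention for division by zero and carries
        no information, so a positive index is extracted.\<close>
      then have "\<exists>\<^sub>F n in sequentially. ereal b < ?a n x \<and> 0 < n"
        by (rule frequently_eventually_frequently) (rule eventually_gt_at_top)
      then obtain n where "b < birk f n x / real n" "0 < n"
        by (auto dest: frequently_ex)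
      then show "\<exists>n. real n * b < birk f n x" by (auto simp: field_simps intro!: exI[of _ n])
    qed
    moreover have "(- a) * prob J \<le> (\<integral>x. (- f x) * indicator J x \<partial>M)"
    proof (rule maximal_on_invariant[OF _ _ J inv])
      fix x assume "x \<in> J"
      then have "?l x < ereal a" by (simp add: J_def)
      then have "\<exists>\<^sub>F n in sequentially. ?a n x < ereal a"
        using Liminf_bounded[of "ereal a" "\<lambda>n. ?a n x" sequentially]
        by (auto simp: frequently_def not_less intro: ccontr)
      then have "\<exists>\<^sub>F n in sequentially. ?a n x < ereal a \<and> 0 < n"
        by (rule frequently_eventually_frequently) (rule eventually_gt_at_top)
      then obtain n where n: "birk f n x / real n < a" "0 < n"
        by (auto dest: frequently_ex)
      have "birk (\<lambda>x. - f x) n x = - birk f n x" by (simp add: birk_def sum_negf)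
      with n show "\<exists>n. real n * (- a) < birk (\<lambda>x. - f x) n x"
        by (auto simp: field_simps intro!: exI[of _ n])
    qed (use B in auto)
    ultimately have "b * prob J \<le> a * prob J" by simp
    then have "prob J = 0"
      using ab measure_nonneg[of M J] by (metis mult_le_cancel_right not_le order_le_less)
    then have "J \<in> null_sets M" by (simp add: emeasure_eq_measure null_sets_def)
    then show ?thesis by (rule AE_I') (auto simp: J_def)
  qed
  have "AE x in M. \<forall>a\<in>\<rat>. \<forall>b\<in>\<rat>. a < b \<longrightarrow> \<not> (?l x < ereal a \<and> ereal b < ?u x)"
    using null by (auto simp: AE_ball_countable countable_rat)
  then show ?thesis
  proof (rule AE_mp, intro AE_I2 impI)
    fix x assume H: "\<forall>a\<in>\<rat>. \<forall>b\<in>\<rat>. a < b \<longrightarrow> \<not> (?l x < ereal a \<and> ereal b < ?u x)"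
    have "0 \<le> B" using B[of x] by linarith
    have bd: "\<bar>birk f n x / real n\<bar> \<le> B" for n
      using birk_bound[where f=f and B=B and n=n and x=x, OF B] \<open>0 \<le> B\<close> by (cases "n = 0") (auto simp: field_simps)
    then have bd': "?a n x \<le> ereal B" "ereal (- B) \<le> ?a n x" for n
      by (auto simp only: ereal_less_eq abs_le_iff minus_le_iff)
    have uB: "?u x \<le> ereal B" by (intro Limsup_bounded always_eventually allI bd')
    have lB: "ereal (- B) \<le> ?l x" by (intro Liminf_bounded always_eventually allI bd')
    have lu: "?l x \<le> ?u x" by (rule Liminf_le_Limsup) simp
    obtain l u where l: "?l x = ereal l" and u: "?u x = ereal u"
      using uB lB lu by (cases "?l x"; cases "?u x") auto
    have "u \<le> l"
    proof (rule ccontr)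
      assume "\<not> u \<le> l"
      then obtain a where a: "a \<in> \<rat>" "l < a" "a < u" using Rats_dense_in_real[of l u] by auto
      then obtain b where b: "b \<in> \<rat>" "a < b" "b < u" using Rats_dense_in_real[of a u] by auto
      show False using H a b by (auto simp: l u)
    qed
    then have "?l x = ereal l" "?u x = ereal l" using lu l u by auto
    then have "(\<lambda>n. ?a n x) \<longlonglongrightarrow> ereal l" by (intro Liminf_eq_Limsup) auto
    then show "convergent (\<lambda>n. birk f n x / real n)" by (auto simp: convergent_def)
  qed
qed

lemma integral_avg:
  assumes f [measurable]: "f \<in> borel_measurable M" and B: "\<And>x. \<bar>f x\<bar> \<le> B"
    and J [measurable]: "J \<in> sets M" and inv: "T -` J = J" and n: "0 < n"
  shows "(\<integral>x. birk f n x / real n * indicator J x \<partial>M) = (\<integral>x. f x * indicator J x \<partial>M)"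
proof -
  have ind: "indicator J ((T ^^ k) x) = (indicator J x :: real)" for k x
  proof (induction k)
    case (Suc k)
    then show ?case using inv by (auto simp: indicator_def)
  qed simp
  have "(\<integral>x. birk f n x / real n * indicator J x \<partial>M)
      = (\<integral>x. (\<Sum>k<n. f ((T ^^ k) x) * indicator J ((T ^^ k) x)) / real n \<partial>M)"
    by (simp add: birk_def ind sum_distrib_right)
  also have "\<dots> = (\<Sum>k<n. (\<integral>x. f ((T ^^ k) x) * indicator J ((T ^^ k) x) \<partial>M)) / real n"
  proof (simp only: integral_divide_zero, subst Bochner_Integration.integral_sum)
    show "integrable M (\<lambda>x. f ((T ^^ k) x) * indicator J ((T ^^ k) x))" for k
      using B by (intro bounded_integrable[where B=B])
          (auto simp: indicator_def intro: order_trans[OF abs_ge_zero])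
  qed simp
  also have "\<dots> = (\<Sum>k<n. (\<integral>x. f x * indicator J x \<partial>M)) / real n"
    by (subst integral_Tpow[where f="\<lambda>x. f x * indicator J x"]) auto
  also have "\<dots> = (\<integral>x. f x * indicator J x \<partial>M)" using n by simp
  finally show ?thesis .
qed

text \<open>Each single average has the same integral over J as f, by invariance of J and of the
  measure, and dominated convergence passes this on to the limit. In effect g is the conditional
  expectation of f given the invariant sets.\<close>

lemma integral_lim_avg:
  assumes f [measurable]: "f \<in> borel_measurable M" and B: "\<And>x. \<bar>f x\<bar> \<le> B"
    and J [measurable]: "J \<in> sets M" and inv: "T -` J = J"
    and g [measurable]: "g \<in> borel_measurable M"
    and lim: "AE x in M. (\<lambda>n. birk f n x / real n) \<longlonglongrightarrow> g x"
  shows "(\<integral>x. g x * indicator J x \<partial>M) = (\<integral>x. f x * indicator J x \<partial>M)"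
proof -
  have "(\<lambda>n. \<integral>x. birk f n x / real n * indicator J x \<partial>M) \<longlonglongrightarrow> (\<integral>x. g x * indicator J x \<partial>M)"
  proof (rule integral_dominated_convergence[where w="\<lambda>_. B"])
    show "AE x in M. (\<lambda>n. birk f n x / real n * indicator J x) \<longlonglongrightarrow> g x * indicator J x"
      using lim by eventually_elim (intro tendsto_intros)
    show "AE x in M. norm (birk f n x / real n * indicator J x) \<le> B" for n
    proof (intro AE_I2)
      fix x
      have "0 \<le> B" using B[of x] by linarith
      then show "norm (birk f n x / real n * indicator J x) \<le> B"
        using birk_bound[where f=f and B=B and n=n and x=x, OF B] by (cases "n = 0") (auto simp: indicator_def field_simps)
    qed
  qed auto
  moreover have "(\<lambda>n. \<integral>x. birk f n x / real n * indicator J x \<partial>M) \<longlonglongrightarrow> (\<integral>x. f x * indicator J x \<partial>M)"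
    by (rule tendsto_eventually, rule eventually_mono[OF eventually_gt_at_top[of 0]])
       (rule integral_avg[OF f B J inv])
  ultimately show ?thesis by (rule LIMSEQ_unique)
qed

end

subsection \<open>Cylinder sets and measures on the sequence space\<close>

definition determined_on :: "int set \<Rightarrow> (int \<Rightarrow> 'a) set \<Rightarrow> bool" where
  "determined_on J C \<longleftrightarrow> (\<forall>x y. (\<forall>j\<in>J. x j = y j) \<longrightarrow> (x \<in> C \<longleftrightarrow> y \<in> C))"

definition cylinders :: "(int \<Rightarrow> 'a) set set" where
  "cylinders = {C. \<exists>J. finite J \<and> determined_on J C}"

lemma determined_onD: "determined_on J C \<Longrightarrow> (\<And>j. j \<in> J \<Longrightarrow> x j = y j) \<Longrightarrow> x \<in> C \<longleftrightarrow> y \<in> C"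
  unfolding determined_on_def by blast

lemma cylindersI:
  assumes "finite J" "\<And>x y. (\<And>j. j \<in> J \<Longrightarrow> x j = y j) \<Longrightarrow> x \<in> C \<longleftrightarrow> y \<in> C"
  shows "C \<in> cylinders"
  using assms unfolding cylinders_def determined_on_def by blast

lemma cylindersE:
  assumes "C \<in> cylinders"
  obtains J where "finite J" "determined_on J C"
  using assms unfolding cylinders_def by blast

lemma algebra_cylinders: "algebra UNIV cylinders"
proof (rule algebra_iff_Un[THEN iffD2], intro conjI ballI)
  show "{} \<in> cylinders" by (rule cylindersI[of "{}"]) auto
  fix C :: "(int \<Rightarrow> 'a) set" assume "C \<in> cylinders"
  then obtain J where J: "finite J" "determined_on J C"
    by (rule cylindersE)
  show "UNIV - C \<in> cylinders"
  proof (rule cylindersI[OF J(1)])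
    fix x y :: "int \<Rightarrow> 'a" assume "\<And>j. j \<in> J \<Longrightarrow> x j = y j"
    with J(2) have "x \<in> C \<longleftrightarrow> y \<in> C" by (rule determined_onD)
    then show "x \<in> UNIV - C \<longleftrightarrow> y \<in> UNIV - C" by simp
  qed
  fix D :: "(int \<Rightarrow> 'a) set" assume "D \<in> cylinders"
  then obtain K where K: "finite K" "determined_on K D"
    by (rule cylindersE)
  show "C \<union> D \<in> cylinders"
  proof (rule cylindersI[of "J \<union> K"])
    fix x y :: "int \<Rightarrow> 'a" assume eq: "\<And>j. j \<in> J \<union> K \<Longrightarrow> x j = y j"
    have "x \<in> C \<longleftrightarrow> y \<in> C" by (rule determined_onD[OF J(2)]) (simp add: eq)
    moreover have "x \<in> D \<longleftrightarrow> y \<in> D" by (rule determined_onD[OF K(2)]) (simp add: eq)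
    ultimately show "x \<in> C \<union> D \<longleftrightarrow> y \<in> C \<union> D" by simp
  qed (use J K in auto)
qed auto

interpretation cylinders: algebra UNIV cylinders
  by (rule algebra_cylinders)

lemma Int_stable_cylinders: "Int_stable cylinders"
  by (auto simp: Int_stable_def)

lemma Tin_vimage_cylinders:
  assumes "C \<in> cylinders"
  shows "Tin -` C \<in> cylinders"
proof -
  obtain J where J: "finite J" "determined_on J C"
    using assms by (rule cylindersE)
  show ?thesis
  proof (rule cylindersI[of "(\<lambda>j. j + 1) ` J"])
    fix x y :: "int \<Rightarrow> 'a" assume eq: "\<And>j. j \<in> (\<lambda>j. j + 1) ` J \<Longrightarrow> x j = y j"
    have "Tin x j = Tin y j" if "j \<in> J" for j
      unfolding Tin_def by (rule eq) (use that in blast)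
    then have "Tin x \<in> C \<longleftrightarrow> Tin y \<in> C" by (rule determined_onD[OF J(2)])
    then show "x \<in> Tin -` C \<longleftrightarrow> y \<in> Tin -` C" by simp
  qed (use J in auto)
qed

lemma finite_PiE_UNIV: "finite J \<Longrightarrow> finite (J \<rightarrow>\<^sub>E (UNIV :: 'a::finite set))"
  by (rule finite_PiE) auto

lemma cylinder_eq:
  assumes J: "determined_on J C"
  shows "C = {x. restrict x J \<in> (\<lambda>x. restrict x J) ` C}"
proof (intro set_eqI iffI CollectI)
  fix x assume "x \<in> {x. restrict x J \<in> (\<lambda>x. restrict x J) ` C}"
  then obtain y where y: "y \<in> C" "restrict x J = restrict y J" by auto
  then have "x j = y j" if "j \<in> J" for j using that by (metis restrict_apply')
  then show "x \<in> C" using determined_onD[OF J, of x y] y(1) by simp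
qed simp

text \<open>There are countably many finite windows, and over each one only finitely many patterns
  because the alphabet is finite. Countability lets statements about all cylinders hold off a single
  null set.\<close>

lemma countable_cylinders: "countable (cylinders :: (int \<Rightarrow> 'a::finite) set set)"
proof (rule countable_subset)
  let ?F = "\<lambda>J. (\<lambda>E. {x :: int \<Rightarrow> 'a. restrict x J \<in> E}) ` Pow (J \<rightarrow>\<^sub>E UNIV)"
  show "cylinders \<subseteq> (\<Union>J\<in>Collect finite. ?F J)"
  proof
    fix C :: "(int \<Rightarrow> 'a) set" assume "C \<in> cylinders"
    then obtain J where J: "finite J" "determined_on J C"
      by (rule cylindersE)
    have "C = {x. restrict x J \<in> (\<lambda>x. restrict x J) ` C}"
      using J(2) by (rule cylinder_eq)
    moreover have "(\<lambda>x. restrict x J) ` C \<in> Pow (J \<rightarrow>\<^sub>E UNIV)" by auto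
    ultimately have "C \<in> ?F J" by (rule image_eqI)
    then show "C \<in> (\<Union>J\<in>Collect finite. ?F J)" using J(1) by blast
  qed
  show "countable (\<Union>J\<in>Collect finite. ?F J)"
    by (intro countable_UN countable_Collect_finite countable_image countable_finite)
      (simp add: finite_PiE_UNIV)
qed

lemma space_Min: "space (Min :: (int \<Rightarrow> 'a) measure) = UNIV"
  by (simp add: Min_def space_PiM)

lemma Min_component [measurable]: "(\<lambda>x. x i) \<in> measurable Min (count_space UNIV)"
  unfolding Min_def by (rule measurable_component_singleton) simp

lemma cylinders_Min:
  fixes C :: "(int \<Rightarrow> 'a::finite) set"
  assumes "C \<in> cylinders"
  shows "C \<in> sets Min"
proof -
  obtain J where J: "finite J" "determined_on J C"
    using assms by (rule cylindersE)
  have C: "C = (\<Union>e\<in>(\<lambda>x. restrict x J) ` C. {x \<in> space Min. \<forall>j\<in>J. x j = e j})"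
  proof (intro set_eqI iffI)
    fix x assume "x \<in> (\<Union>e\<in>(\<lambda>x. restrict x J) ` C. {x \<in> space Min. \<forall>j\<in>J. x j = e j})"
    then obtain y where y: "y \<in> C" "\<forall>j\<in>J. x j = y j" by auto
    then show "x \<in> C" using determined_onD[OF J(2), of x y] by simp
  qed (auto simp: space_Min)
  have "finite ((\<lambda>x. restrict x J) ` C)"
    by (rule finite_subset[of _ "J \<rightarrow>\<^sub>E UNIV"]) (use J(1) in \<open>auto simp: finite_PiE_UNIV\<close>)
  moreover have "{x \<in> space Min. \<forall>j\<in>J. x j = e j} \<in> sets Min" for e :: "int \<Rightarrow> 'a"
    using J(1) by measurable
  ultimately show ?thesis by (subst C) (rule sets.finite_UN)
qed

lemma sets_Min_eq: "sets (Min :: (int \<Rightarrow> 'a::finite) measure) = sigma_sets UNIV cylinders"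
proof
  have "{x. x i \<in> A} \<in> cylinders" for i and A :: "'a set"
    by (rule cylindersI[of "{i}"]) auto
  then show "sets (Min :: (int \<Rightarrow> 'a) measure) \<subseteq> sigma_sets UNIV cylinders"
    unfolding Min_def sets_PiM_single PiE_UNIV_domain space_count_space Pi_UNIV
    by (intro sigma_sets_mono') auto
  show "sigma_sets UNIV cylinders \<subseteq> sets (Min :: (int \<Rightarrow> 'a) measure)"
    using sets.sigma_sets_subset[of cylinders "Min :: (int \<Rightarrow> 'a) measure"] cylinders_Min
    unfolding space_Min by blast
qed

lemma measurable_shift: "(\<lambda>x k. x (k + n)) \<in> measurable Min (Min :: (int \<Rightarrow> 'a) measure)"
proof -
  have "(\<lambda>x :: int \<Rightarrow> 'a. \<lambda>k\<in>UNIV. x (k + n)) \<in> measurable Min (PiM UNIV (\<lambda>_. count_space UNIV))"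
    by (rule measurable_restrict) (rule Min_component)
  then show ?thesis by (simp add: Min_def restrict_def)
qed

lemma measurable_Tin [measurable]: "Tin \<in> measurable Min Min"
  unfolding Tin_def[abs_def] by (rule measurable_shift)

text \<open>With a finite alphabet the sequence space is compact in the product topology and
  cylinders are closed in it, so a decreasing sequence of nonempty cylinders has a common
  point.\<close>

lemma cylinders_compact:
  fixes C :: "nat \<Rightarrow> (int \<Rightarrow> 'a::finite) set"
  assumes C: "\<And>n. C n \<in> cylinders" and "decseq C" and "(\<Inter>n. C n) = {}"
  shows "\<exists>n. C n = {}"
proof (rule ccontr)
  assume ne: "\<not> (\<exists>n. C n = {})"
  let ?X = "product_topology (\<lambda>_::int. discrete_topology (UNIV :: 'a set)) UNIV"
  have "compact_space ?X"
    by (simp add: compact_space_product_topology compact_space_discrete_topology)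
  moreover have "closedin ?X D" if D: "D \<in> cylinders" for D
  proof -
    obtain J where J: "finite J" "determined_on J D"
      using D by (rule cylindersE)
    have "openin ?X (- D)"
      unfolding openin_product_topology_alt
    proof
      fix x assume x: "x \<in> - D"
      \<comment> \<open>The basic neighbourhood freezes the coordinates in J, which decide
        membership in D, and leaves the others free.\<close>
      let ?U = "\<lambda>i. if i \<in> J then {x i} else UNIV"
      have "{i. ?U i \<noteq> UNIV} \<subseteq> J" by auto
      then have "finite {i. ?U i \<noteq> UNIV}" using J(1) finite_subset by blast
      moreover have "Pi\<^sub>E UNIV ?U \<subseteq> - D"
      proof
        fix y assume "y \<in> Pi\<^sub>E UNIV ?U"
        then have "y j \<in> ?U j" for j by (rule PiE_mem) simp
        then have "y j = x j" if "j \<in> J" for j using that by (metis singletonD)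
        then have "y \<in> D \<longleftrightarrow> x \<in> D" by (rule determined_onD[OF J(2)])
        then show "y \<in> - D" using x by simp
      qed
      ultimately show "\<exists>U. finite {i \<in> UNIV. U i \<noteq> topspace (discrete_topology UNIV)} \<and>
          (\<forall>i\<in>UNIV. openin (discrete_topology UNIV) (U i)) \<and> x \<in> Pi\<^sub>E UNIV U \<and> Pi\<^sub>E UNIV U \<subseteq> - D"
        by (intro exI[of _ ?U]) auto
    qed
    then show ?thesis by (simp add: closedin_def Compl_eq_Diff_UNIV)
  qed
  ultimately have "(\<Inter>n. C n) \<noteq> {}"
    using ne C \<open>decseq C\<close> by (intro compact_space_imp_nest[of ?X]) auto
  then show False using assms by simp
qed

text \<open>Caratheodory's extension asks for continuity at the empty set, and compactness supplies
  it: cylinders that decrease to the empty set are empty from some index on. Finite additivity of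
  \<nu> thus suffices, which suits limits of frequencies, where countable additivity cannot be read
  off.\<close>

theorem cylinder_extension:
  fixes \<nu> :: "(int \<Rightarrow> 'a::finite) set \<Rightarrow> real"
  assumes nonneg: "\<And>C. C \<in> cylinders \<Longrightarrow> 0 \<le> \<nu> C"
    and add: "\<And>C D. C \<in> cylinders \<Longrightarrow> D \<in> cylinders \<Longrightarrow> C \<inter> D = {} \<Longrightarrow> \<nu> (C \<union> D) = \<nu> C + \<nu> D"
    and one: "\<nu> UNIV = 1"
  shows "\<exists>q. prob_space q \<and> sets q = sets Min \<and> (\<forall>C\<in>cylinders. measure q C = \<nu> C)"
proof -
  have empty: "\<nu> {} = 0" using add[of "{}" "{}"] by simp
  have "\<exists>\<mu> :: _ \<Rightarrow> ennreal. (\<forall>s\<in>cylinders. \<mu> s = ennreal (\<nu> s)) \<and>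
      measure_space UNIV (sigma_sets UNIV cylinders) \<mu>"
  proof (rule cylinders.caratheodory_empty_continuous)
    show "positive cylinders (\<lambda>s. ennreal (\<nu> s))" by (simp add: positive_def empty)
    show "additive cylinders (\<lambda>s. ennreal (\<nu> s))" by (simp add: additive_def add nonneg)
    fix A :: "nat \<Rightarrow> (int \<Rightarrow> 'a) set"
    assume A: "range A \<subseteq> cylinders" "decseq A" "(\<Inter>i. A i) = {}"
    then obtain n where "A n = {}" using cylinders_compact[of A] by auto
    then have "A m = {}" if "n \<le> m" for m using decseqD[OF A(2) that] by auto
    then have "eventually (\<lambda>m. ennreal (\<nu> (A m)) = 0) sequentially"
      by (intro eventually_sequentiallyI[of n]) (simp add: empty)
    then show "(\<lambda>i. ennreal (\<nu> (A i))) \<longlonglongrightarrow> 0" by (rule tendsto_eventually)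
  qed simp
  then obtain \<mu> :: "_ \<Rightarrow> ennreal" where \<mu>: "\<And>s. s \<in> cylinders \<Longrightarrow> \<mu> s = ennreal (\<nu> s)"
    and ms: "measure_space UNIV (sigma_sets UNIV cylinders) \<mu>" by blast
  define q where "q = measure_of UNIV cylinders \<mu>"
  have sets: "sets q = sigma_sets UNIV cylinders" by (simp add: q_def)
  have em: "emeasure q s = ennreal (\<nu> s)" if "s \<in> cylinders" for s
    using ms that by (subst emeasure_measure_of[OF q_def]) (auto simp: measure_space_def \<mu> sets)
  have "space q = UNIV" by (simp add: q_def)
  then have "prob_space q" by (intro prob_spaceI) (simp add: em one)
  then show ?thesis using em nonneg sets by (auto simp: sets_Min_eq measure_def)
qed

lemma measure_eqI_cylinders:
  fixes q r :: "(int \<Rightarrow> 'a::finite) measure"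
  assumes "sets q = sets Min" "sets r = sets Min" "finite_measure q"
    and "\<And>C. C \<in> cylinders \<Longrightarrow> emeasure q C = emeasure r C"
  shows "q = r"
proof (rule measure_eqI_generator_eq[OF Int_stable_cylinders, of UNIV])
  show "range (\<lambda>_. UNIV) \<subseteq> cylinders" by auto
  show "emeasure q UNIV \<noteq> \<infinity>" using assms(3) by (simp add: finite_measure.emeasure_finite)
qed (use assms in \<open>auto simp: sets_Min_eq\<close>)

section \<open>Stationary measures as measure preserving systems\<close>

lemma stat_prob_measure_preserving:
  assumes "stat_prob p"
  shows "measure_preserving p Tin"
proof -
  from assms have p: "prob_space p" and s [measurable_cong]: "sets p = sets Min"
    and inv: "\<And>S. S \<in> sets Min \<Longrightarrow> emeasure p (Tin -` S) = emeasure p S"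
    by (auto simp: stat_prob_def)
  have sp: "space p = UNIV" using sets_eq_imp_space_eq[OF s] by (simp add: space_Min)
  have "distr p p Tin = p"
    by (rule measure_eqI) (auto simp: emeasure_distr sp s inv)
  then show ?thesis
    using p sp by (intro measure_preserving.intro measure_preserving_axioms.intro) auto
qed

lemma stat_probI:
  fixes q :: "(int \<Rightarrow> 'a::finite) measure"
  assumes q: "prob_space q" and s: "sets q = sets Min"
    and inv: "\<And>C. C \<in> cylinders \<Longrightarrow> measure q (Tin -` C) = measure q C"
  shows "stat_prob q"
proof -
  note [measurable_cong] = s
  interpret prob_space q by fact
  have sp: "space q = UNIV" using sets_eq_imp_space_eq[OF s] by (simp add: space_Min)
  have [measurable]: "Tin \<in> measurable q q" by measurable
  have "distr q q Tin = q"
    by (rule measure_eqI_cylinders)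
      (auto simp: s emeasure_distr cylinders_Min sp inv emeasure_eq_measure Tin_vimage_cylinders intro!: finite_measure_distr)
  then have "emeasure q (Tin -` S) = emeasure q S" if "S \<in> sets Min" for S
    using that emeasure_distr[of Tin q q S] by (simp add: s sp)
  then show ?thesis using q s by (simp add: stat_prob_def)
qed

subsection \<open>Ergodic components\<close>

text \<open>Birkhoff averages involve the transformation but no measure, so the frequencies computed
  for different stationary measures are literally the same functions. This allows a measure and its
  components to be compared orbit by orbit.\<close>

abbreviation freq :: "(int \<Rightarrow> 'a) set \<Rightarrow> nat \<Rightarrow> (int \<Rightarrow> 'a) \<Rightarrow> real" where
  "freq C n x \<equiv> measure_preserving.birk Tin (indicator C) n x / real n"

definition generic :: "(int \<Rightarrow> 'a) \<Rightarrow> bool" where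
  "generic x \<longleftrightarrow> (\<forall>C\<in>cylinders. convergent (\<lambda>n. freq C n x))"

definition limfreq :: "(int \<Rightarrow> 'a) set \<Rightarrow> (int \<Rightarrow> 'a) \<Rightarrow> real" where
  "limfreq C x = lim (\<lambda>n. freq C n x)"

locale stationary_measure =
  fixes p :: "(int \<Rightarrow> 'a::finite) measure"
  assumes stat: "stat_prob p"

sublocale stationary_measure \<subseteq> measure_preserving p Tin
  by (rule stat_prob_measure_preserving[OF stat])

context stationary_measure
begin

lemma sets_p [measurable_cong]: "sets p = sets Min"
  using stat by (simp add: stat_prob_def)

lemma cylinders_p [measurable]: "C \<in> cylinders \<Longrightarrow> C \<in> sets p"
  by (simp add: sets_p cylinders_Min)

lemma generic_limfreq:
  assumes "generic x" "C \<in> cylinders"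
  shows "(\<lambda>n. freq C n x) \<longlonglongrightarrow> limfreq C x"
  using assms by (simp add: generic_def limfreq_def convergent_LIMSEQ_iff)

lemma freq_Tin_lim_iff:
  fixes C :: "(int \<Rightarrow> 'a) set"
  shows "(\<lambda>n. freq C n (Tin x)) \<longlonglongrightarrow> l \<longleftrightarrow> (\<lambda>n. freq C n x) \<longlonglongrightarrow> l"
  by (rule avg_lim_shift_iff[where B=1]) simp

lemma generic_Tin:
  fixes x :: "int \<Rightarrow> 'a"
  shows "generic (Tin x) \<longleftrightarrow> generic x"
  by (simp add: generic_def convergent_def freq_Tin_lim_iff)

text \<open>This holds at every point, generic or not: \<open>lim\<close> is determined by which
  numbers are limits of the averages, and these are the same at x and at \<open>Tin x\<close>. Sets
  defined from \<open>limfreq\<close> are therefore exactly invariant.\<close>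

lemma limfreq_Tin:
  fixes C :: "(int \<Rightarrow> 'a) set"
  shows "limfreq C (Tin x) = limfreq C x"
  by (simp add: limfreq_def lim_def freq_Tin_lim_iff)

text \<open>Visits of the orbit of x to the preimage are visits of the orbit of \<open>Tin x\<close>
  to C. This is what makes the measure of limiting frequencies stationary.\<close>

lemma limfreq_vimage_Tin:
  fixes C :: "(int \<Rightarrow> 'a) set"
  shows "limfreq (Tin -` C) x = limfreq C x"
proof -
  have "birk (indicator (Tin -` C)) n x = birk (indicator C) n (Tin x)" for n
    unfolding birk_def
    by (rule sum.cong) (simp_all add: indicator_def funpow_swap1)
  then have "limfreq (Tin -` C) x = limfreq C (Tin x)"
    by (simp add: limfreq_def)
  then show ?thesis by (simp add: limfreq_Tin)
qed

text \<open>Limiting frequencies along one orbit are nonnegative, finitely additive and of total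
  mass 1 on cylinders, which is all that the extension theorem asks.\<close>

lemma limfreq_measure:
  fixes x :: "int \<Rightarrow> 'a"
  assumes x: "generic x"
  shows "\<exists>q. stat_prob q \<and> (\<forall>C\<in>cylinders. measure q C = limfreq C x)"
proof -
  have "\<exists>q. prob_space q \<and> sets q = sets Min \<and> (\<forall>C\<in>cylinders. measure q C = limfreq C x)"
  proof (rule cylinder_extension)
    fix C :: "(int \<Rightarrow> 'a) set" assume C: "C \<in> cylinders"
    have "0 \<le> freq C n x" for n
      by (auto simp: birk_def intro!: divide_nonneg_nonneg sum_nonneg)
    then show "0 \<le> limfreq C x"
      using generic_limfreq[OF x C] by (intro LIMSEQ_le_const) auto
    fix D :: "(int \<Rightarrow> 'a) set" assume D: "D \<in> cylinders" "C \<inter> D = {}"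
    have "freq (C \<union> D) n x = freq C n x + freq D n x" for n
      using D(2) by (simp add: birk_def indicator_add[symmetric] sum.distrib add_divide_distrib)
    then show "limfreq (C \<union> D) x = limfreq C x + limfreq D x"
      using tendsto_add[OF generic_limfreq[OF x C] generic_limfreq[OF x D(1)]]
        generic_limfreq[OF x, of "C \<union> D"] C D by (auto intro: LIMSEQ_unique)
  next
    have "eventually (\<lambda>n. freq UNIV n x = 1) sequentially"
      by (rule eventually_mono[OF eventually_gt_at_top[of 0]]) (simp add: birk_def)
    then have "(\<lambda>n. freq UNIV n x) \<longlonglongrightarrow> 1" by (rule tendsto_eventually)
    then show "limfreq UNIV x = 1"
      using generic_limfreq[OF x, of UNIV] by (auto intro: LIMSEQ_unique)
  qed
  then obtain q where q: "prob_space q" "sets q = sets Min" "\<forall>C\<in>cylinders. measure q C = limfreq C x"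
    by blast
  then have "stat_prob q"
    by (intro stat_probI) (auto simp: Tin_vimage_cylinders limfreq_vimage_Tin)
  with q show ?thesis by blast
qed

text \<open>At points without limiting frequencies the default is p itself, so that
  \<open>component x\<close> is a stationary probability measure for every x and its values on
  cylinders do not change along an orbit.\<close>

definition component :: "(int \<Rightarrow> 'a) \<Rightarrow> (int \<Rightarrow> 'a) measure" where
  "component x = (if generic x
     then SOME q. stat_prob q \<and> (\<forall>C\<in>cylinders. measure q C = limfreq C x) else p)"

lemma component_generic:
  assumes "generic x"
  shows "stat_prob (component x)" "C \<in> cylinders \<Longrightarrow> measure (component x) C = limfreq C x"
  using someI_ex[OF limfreq_measure[OF assms]] assms by (auto simp: component_def)

lemma stat_component: "stat_prob (component x)"
  using component_generic(1) stat by (cases "generic x") (auto simp: component_def)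

lemma sets_component: "sets (component x) = sets Min"
  using stat_component by (simp add: stat_prob_def)

lemma prob_space_component: "prob_space (component x)"
  using stat_component by (simp add: stat_prob_def)

lemma space_component: "space (component x) = UNIV"
  using sets_eq_imp_space_eq[OF sets_component] by (simp add: space_Min)

lemma freq_meas [measurable]: "C \<in> cylinders \<Longrightarrow> freq C n \<in> borel_measurable p"
  by measurable

lemma limfreq_meas [measurable]: "C \<in> cylinders \<Longrightarrow> limfreq C \<in> borel_measurable p"
  unfolding limfreq_def[abs_def] by measurable

lemma generic_sets: "{x. generic x} \<in> sets p"
proof -
  have "{x\<in>space p. Cauchy (\<lambda>n. freq C n x)} \<in> sets p" if "C \<in> cylinders" for C
    using that by (intro sets_Collect_Cauchy freq_meas)
  then have "(\<Inter>C\<in>cylinders. {x\<in>space p. Cauchy (\<lambda>n. freq C n x)}) \<in> sets p"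
    using cylinders.top by (intro sets.countable_INT' countable_cylinders) auto
  moreover have "(\<Inter>C\<in>cylinders. {x\<in>space p. Cauchy (\<lambda>n. freq C n x)}) = {x. generic x}"
    by (auto simp: generic_def space_UNIV Cauchy_convergent_iff)
  ultimately show ?thesis by simp
qed

lemma generic_pred [measurable]: "Measurable.pred p generic"
  using generic_sets by (simp add: pred_def space_UNIV)

lemma AE_generic: "AE x in p. generic x"
  unfolding generic_def
  by (intro AE_ball_countable[THEN iffD2] countable_cylinders ballI birkhoff[where B=1])
    (auto simp: indicator_def)

lemma component_measure_cylinder:
  assumes "C \<in> cylinders"
  shows "measure (component x) C = (if generic x then limfreq C x else measure p C)"
  using component_generic assms by (auto simp: component_def)

lemma component_invariant: "C \<in> cylinders \<Longrightarrow> measure (component (Tin x)) C = measure (component x) C"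
  by (simp add: component_measure_cylinder generic_Tin limfreq_Tin)

text \<open>Integrating over all invariant sets J, and not only over the whole space, is what later
  confines almost every component to an invariant set containing its base point. On cylinders the
  identity is the integrated Birkhoff limit. It passes to complements and disjoint unions, and
  measurability is carried along because both of these steps integrate.\<close>

lemma component_disintegration:
  assumes "B \<in> sets Min"
  shows "(\<lambda>x. measure (component x) B) \<in> borel_measurable p \<and>
    (\<forall>J\<in>sets p. Tin -` J = J \<longrightarrow>
      (\<integral>x. measure (component x) B * indicator J x \<partial>p) = measure p (B \<inter> J))"
  using Int_stable_cylinders subset_UNIV[of cylinders, folded Pow_UNIV] assms[unfolded sets_Min_eq]
proof (induction rule: sigma_sets_induct_disjoint)
  case (basic C)
  note [measurable] = basic
  have meas: "(\<lambda>x. measure (component x) C) \<in> borel_measurable p"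
    using basic by (simp add: component_measure_cylinder)
  have "(\<integral>x. measure (component x) C * indicator J x \<partial>p) = measure p (C \<inter> J)"
    if J [measurable]: "J \<in> sets p" and inv: "Tin -` J = J" for J
  proof -
    have "AE x in p. (\<lambda>n. freq C n x) \<longlonglongrightarrow> measure (component x) C"
      using AE_generic by eventually_elim (simp add: component_generic basic generic_limfreq)
    then have "(\<integral>x. measure (component x) C * indicator J x \<partial>p) = (\<integral>x. indicator C x * indicator J x \<partial>p)"
      by (intro integral_lim_avg[where B=1] meas J inv) (auto simp: cylinders_p basic)
    then show ?thesis using basic by (simp add: indicator_inter_arith[symmetric] space_UNIV cylinders_p)
  qed
  with meas show ?case by blast
next
  case empty
  show ?case by simp
next
  case (compl B)
  then have B: "B \<in> sets Min" by (simp add: sets_Min_eq)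
  have eq: "measure (component x) (UNIV - B) = 1 - measure (component x) B" for x
    using prob_space.prob_compl[OF prob_space_component, of B x] B
    by (simp add: space_component sets_component)
  have meas [measurable]: "(\<lambda>x. measure (component x) B) \<in> borel_measurable p"
    using compl by blast
  have le: "measure (component x) B \<le> 1" for x
    using prob_space.prob_le_1[OF prob_space_component] .
  have "(\<integral>x. measure (component x) (UNIV - B) * indicator J x \<partial>p) = measure p ((UNIV - B) \<inter> J)"
    if J [measurable]: "J \<in> sets p" and inv: "Tin -` J = J" for J
  proof -
    have "(\<integral>x. measure (component x) (UNIV - B) * indicator J x \<partial>p)
        = (\<integral>x. indicator J x - measure (component x) B * indicator J x \<partial>p)"
      by (simp add: eq left_diff_distrib)
    also have "\<dots> = measure p J - measure p (B \<inter> J)"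
    proof (subst Bochner_Integration.integral_diff)
      show "integrable p (\<lambda>x. measure (component x) B * indicator J x)"
        using le by (intro bounded_integrable[where B=1]) (auto simp: indicator_def)
      show "integrable p (indicator J :: _ \<Rightarrow> real)"
        by (intro bounded_integrable[where B=1]) (auto simp: indicator_def)
    qed (use compl J inv in \<open>simp add: space_UNIV\<close>)
    also have "\<dots> = measure p (J - B \<inter> J)"
      using B J by (subst finite_measure_Diff) (auto simp: sets_p)
    also have "J - B \<inter> J = (UNIV - B) \<inter> J" by auto
    finally show ?thesis .
  qed
  with meas show ?case by (simp add: eq)
next
  case (union A)
  have A: "A i \<in> sets Min" for i using union(2) by (auto simp: sets_Min_eq)
  have meas [measurable]: "(\<lambda>x. measure (component x) (A i)) \<in> borel_measurable p" for i
    using union by blast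
  have sums: "(\<lambda>i. measure (component x) (A i)) sums measure (component x) (\<Union>i. A i)" for x
    using prob_space.axioms(1)[OF prob_space_component] A union(1)
    by (intro finite_measure.finite_measure_UNION) (auto simp: sets_component)
  have meas': "(\<lambda>x. measure (component x) (\<Union>i. A i)) \<in> borel_measurable p"
    using sums by (subst sums_unique[OF sums]) measurable
  have le: "measure (component x) B \<le> 1" for x B
    using prob_space.prob_le_1[OF prob_space_component] .
  have "(\<integral>x. measure (component x) (\<Union>i. A i) * indicator J x \<partial>p) = measure p ((\<Union>i. A i) \<inter> J)"
    if J [measurable]: "J \<in> sets p" and inv: "Tin -` J = J" for J
  proof -
    have "(\<lambda>n. \<integral>x. (\<Sum>i<n. measure (component x) (A i)) * indicator J x \<partial>p)
        \<longlonglongrightarrow> (\<integral>x. measure (component x) (\<Union>i. A i) * indicator J x \<partial>p)"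
    proof (rule integral_dominated_convergence[where w="\<lambda>_. 1"])
      show "AE x in p. (\<lambda>n. (\<Sum>i<n. measure (component x) (A i)) * indicator J x)
          \<longlonglongrightarrow> measure (component x) (\<Union>i. A i) * indicator J x"
        using sums by (intro AE_I2 tendsto_mult tendsto_const) (simp add: sums_def)
      have "(\<Sum>i<n. measure (component x) (A i)) \<le> 1" for n x
        using sum_le_suminf[OF sums_summable[OF sums], of "{..<n}" x] le[of x "\<Union>i. A i"]
          sums_unique[OF sums, of x]
        by simp
      then show "AE x in p. norm ((\<Sum>i<n. measure (component x) (A i)) * indicator J x) \<le> 1" for n
        by (auto simp: indicator_def sum_nonneg)
    qed (use meas' in auto)
    moreover have "(\<integral>x. (\<Sum>i<n. measure (component x) (A i)) * indicator J x \<partial>p)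
        = (\<Sum>i<n. measure p (A i \<inter> J))" for n
    proof -
      have "(\<integral>x. (\<Sum>i<n. measure (component x) (A i)) * indicator J x \<partial>p)
        = (\<Sum>i<n. \<integral>x. measure (component x) (A i) * indicator J x \<partial>p)"
        unfolding sum_distrib_right
        by (intro Bochner_Integration.integral_sum bounded_integrable[where B=1])
          (use le in \<open>auto simp: indicator_def\<close>)
      then show ?thesis using union(3) J inv by simp
    qed
    ultimately have "(\<lambda>n. \<Sum>i<n. measure p (A i \<inter> J))
        \<longlonglongrightarrow> (\<integral>x. measure (component x) (\<Union>i. A i) * indicator J x \<partial>p)" by simp
    moreover have "(\<lambda>i. measure p (A i \<inter> J)) sums measure p (\<Union>i. A i \<inter> J)"
      using A J union(1)
      by (intro finite_measure_UNION) (auto simp: sets_p disjoint_family_on_def)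
    ultimately show ?thesis
      by (auto simp: sums_def Int_UN_distrib2 intro: LIMSEQ_unique)
  qed
  with meas' show ?case by blast
qed

lemma component_meas [measurable]: "B \<in> sets Min \<Longrightarrow> (\<lambda>x. measure (component x) B) \<in> borel_measurable p"
  using component_disintegration by blast

text \<open>The disintegration with J in both roles says that the integral of
  \<open>measure (component x) J\<close> over J is the measure of J itself. The integrand is at most
  1, so it equals 1 almost everywhere on J.\<close>

lemma component_full_on_invariant:
  assumes J [measurable]: "J \<in> sets Min" and inv: "Tin -` J = J"
  shows "AE x in p. x \<in> J \<longrightarrow> measure (component x) J = 1"
proof -
  have le: "measure (component x) J \<le> 1" for x
    using prob_space.prob_le_1[OF prob_space_component] .
  have J' [measurable]: "J \<in> sets p" using J by (simp add: sets_p)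
  let ?f = "\<lambda>x. indicator J x - measure (component x) J * indicator J x"
  have int: "integrable p (\<lambda>x. measure (component x) J * indicator J x)"
       "integrable p (indicator J :: _ \<Rightarrow> real)"
    using le by (intro bounded_integrable[where B=1]; auto simp: indicator_def)+
  then have "(\<integral>x. ?f x \<partial>p) = 0"
    using component_disintegration[OF J] J' inv by (simp add: space_UNIV)
  moreover have "integrable p ?f" using int by simp
  moreover have "AE x in p. 0 \<le> ?f x" using le by (auto simp: indicator_def)
  ultimately have "AE x in p. ?f x = 0"
    using integral_nonneg_eq_0_iff_AE by blast
  then show ?thesis by eventually_elim (auto simp: indicator_def)
qed

text \<open>For a cylinder C the sublevel sets of \<open>measure (component x) C\<close> in x are
  invariant, so almost every component q lies entirely on one side of each of them. Hence q-almost
  every y has the same component as x, which means that frequencies converge q-almost surely to the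
  constants \<open>measure q C\<close>. Integrating this limit over an invariant J makes J
  independent of every cylinder, hence of itself.\<close>

lemma AE_component_ergodic: "AE x in p. ergodic_prob (component x)"
proof -
  let ?g = "\<lambda>C x. measure (component x) C"
  let ?L = "\<lambda>C r. {x. ?g C x < r}"
  have Lm: "?L C r \<in> sets Min" "- ?L C r \<in> sets Min" if "C \<in> cylinders" for C r
  proof -
    have [measurable]: "?g C \<in> borel_measurable p" using that by (intro component_meas cylinders_Min)
    have "{x\<in>space p. ?g C x < r} \<in> sets p" by measurable
    then show "?L C r \<in> sets Min" by (simp add: space_UNIV sets_p)
    then show "- ?L C r \<in> sets Min"
      using sets.compl_sets[of "?L C r" Min] by (simp add: space_Min Compl_eq_Diff_UNIV)
  qed
  have "AE x in p. (x \<in> ?L C r \<longrightarrow> measure (component x) (?L C r) = 1) \<and>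
      (x \<in> - ?L C r \<longrightarrow> measure (component x) (- ?L C r) = 1)" if "C \<in> cylinders" for C r
  proof -
    have inv: "Tin -` ?L C r = ?L C r" "Tin -` (- ?L C r) = - ?L C r"
      using that by (auto simp: component_invariant)
    show ?thesis
      using component_full_on_invariant[OF Lm(1)[OF that] inv(1)]
        component_full_on_invariant[OF Lm(2)[OF that] inv(2)]
      by eventually_elim blast
  qed
  \<comment> \<open>Cylinders and rational levels are countable, so one exceptional set serves for
    all of them.\<close>
  then have "AE x in p. \<forall>C\<in>cylinders. \<forall>r\<in>\<rat>. (x \<in> ?L C r \<longrightarrow> measure (component x) (?L C r) = 1) \<and>
      (x \<in> - ?L C r \<longrightarrow> measure (component x) (- ?L C r) = 1)"
    by (simp add: AE_ball_countable countable_cylinders countable_rat del: Compl_iff mem_Collect_eq)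
  moreover have "AE x in p. generic x \<longrightarrow> measure (component x) {x. generic x} = 1"
    using component_full_on_invariant[of "{x. generic x}"] generic_sets
    by (simp add: sets_p generic_Tin vimage_def)
  ultimately show ?thesis using AE_generic
  proof eventually_elim
    case (elim x)
    define q where "q = component x"
    have q: "stat_prob q" "sets q = sets Min" by (simp_all add: q_def stat_component sets_component)
    interpret q: stationary_measure q by unfold_locales (rule q)
    have "AE y in q. y \<in> {x. generic x}"
      using elim generic_sets by (intro q.AE_prob_1) (simp add: q_def)
    moreover have "AE y in q. \<forall>C\<in>cylinders. \<forall>r\<in>\<rat>. ?g C y < r \<longleftrightarrow> ?g C x < r"
    proof (intro AE_ball_countable[THEN iffD2] countable_cylinders countable_rat ballI)
      fix C :: "(int \<Rightarrow> 'a) set" and r :: real assume C: "C \<in> cylinders" "r \<in> \<rat>"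
      show "AE y in q. ?g C y < r \<longleftrightarrow> ?g C x < r"
      proof (cases "?g C x < r")
        case True
        then have "q.prob (?L C r) = 1" using elim(1) C by (auto simp: q_def)
        then have "AE y in q. y \<in> ?L C r" by (rule q.AE_prob_1)
        then show ?thesis using True by simp
      next
        case False
        then have "q.prob (- ?L C r) = 1" using elim(1) C by (auto simp: q_def)
        then have "AE y in q. y \<in> - ?L C r" by (rule q.AE_prob_1)
        then show ?thesis using False by simp
      qed
    qed
    ultimately have lim: "AE y in q. \<forall>C\<in>cylinders. (\<lambda>n. freq C n y) \<longlonglongrightarrow> measure q C"
    proof eventually_elim
      case (elim y)
      \<comment> \<open>Two reals on the same side of every rational level coincide.\<close>
      have "?g C y = ?g C x" if "C \<in> cylinders" for C
        using elim(2) that Rats_dense_in_real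
        by (metis linorder_neqE_linordered_idom less_asym')
      moreover have "generic y" using elim(1) by simp
      ultimately show ?case
        using generic_limfreq[of y] by (auto simp: q_def component_generic(2))
    qed
    have "q.prob J = 0 \<or> q.prob J = 1" if J: "J \<in> sets Min" and inv: "Tin -` J = J" for J
    proof -
      note [measurable] = J
      have Jq [measurable]: "J \<in> sets q" using J by (simp add: q)
      have cyl: "q.prob (C \<inter> J) = q.prob C * q.prob J" if C: "C \<in> cylinders" for C
      proof -
        have "(\<integral>y. q.prob C * indicator J y \<partial>q) = (\<integral>y. indicator C y * indicator J y \<partial>q)"
          using lim C by (intro q.integral_lim_avg[where B=1] Jq inv) (auto simp: q.cylinders_p)
        then show ?thesis
          using C by (simp add: indicator_inter_arith[symmetric] q.space_UNIV q.cylinders_p)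
      qed
      \<comment> \<open>Independence of J from cylinders is an equality of two finite measures on a
        generating class; extended to all sets and evaluated at J it says that the probability of J
        equals its own square.\<close>
      have "density q (indicator J) = scale_measure (emeasure q J) q"
      proof (rule measure_eqI_cylinders)
        show "finite_measure (density q (indicator J))"
          by (rule finite_measureI) (simp add: emeasure_density q.space_UNIV)
        fix C :: "(int \<Rightarrow> 'a) set" assume C: "C \<in> cylinders"
        have "emeasure (density q (indicator J)) C = (\<integral>\<^sup>+y. indicator (C \<inter> J) y \<partial>q)"
          using q.cylinders_p[OF C] by (simp add: emeasure_density indicator_inter_arith mult.commute)
        also have "\<dots> = emeasure q (C \<inter> J)"
          using q.cylinders_p[OF C] by simp
        also have "\<dots> = emeasure q J * emeasure q C"
          by (simp add: q.emeasure_eq_measure cyl[OF C] ennreal_mult' mult.commute)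
        finally show "emeasure (density q (indicator J)) C = emeasure (scale_measure (emeasure q J) q) C"
          by simp
      qed (simp_all add: q)
      then have "emeasure (density q (indicator J)) J = emeasure (scale_measure (emeasure q J) q) J"
        by simp
      then have "emeasure q J = emeasure q J * emeasure q J"
        by (simp add: emeasure_density indicator_inter_arith[symmetric])
      then show ?thesis
        by (simp add: q.emeasure_eq_measure ennreal_mult'[symmetric])
    qed
    then show ?case using q by (auto simp: ergodic_prob_def q_def[symmetric] q.emeasure_eq_measure)
  qed
qed

text \<open>The measure of S under p is the mean of its measures under the components, almost all of
  which are ergodic. It serves to detect a set on which two channels differ.\<close>

theorem ex_ergodic:
  assumes S: "S \<in> sets Min" and pos: "emeasure p S \<noteq> 0"
  shows "\<exists>q. ergodic_prob q \<and> emeasure q S \<noteq> 0"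
proof (rule ccontr)
  assume none: "\<not> ?thesis"
  have "AE x in p. measure (component x) S = 0"
    by (rule AE_mp[OF AE_component_ergodic]) (use none in \<open>auto simp: measure_def\<close>)
  then have "(\<integral>x. measure (component x) S * indicator UNIV x \<partial>p) = 0"
    by (intro integral_eq_zero_AE) auto
  then have "measure p S = 0"
    using component_disintegration[OF S] sets.top[of p] by (auto simp: space_UNIV)
  then show False using pos by (simp add: emeasure_eq_measure)
qed

end

subsection \<open>Densities of functionals on bounded measurable functions\<close>

text \<open>Adding C times the measure turns \<nu> into a nonnegative set function that is at most 2
  C times the measure. This domination yields both countable additivity and absolute continuity, so
  Radon-Nikodym applies, and C is subtracted from the density afterwards.\<close>

lemma (in finite_measure) additive_density:
  fixes \<nu> :: "'a set \<Rightarrow> real"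
  assumes add: "\<And>A B. A \<in> sets M \<Longrightarrow> B \<in> sets M \<Longrightarrow> A \<inter> B = {} \<Longrightarrow> \<nu> (A \<union> B) = \<nu> A + \<nu> B"
    and bound: "\<And>A. A \<in> sets M \<Longrightarrow> \<bar>\<nu> A\<bar> \<le> C * measure M A"
  shows "\<exists>h. integrable M h \<and> (\<forall>A\<in>sets M. \<nu> A = (\<integral>x. h x * indicator A x \<partial>M))"
proof -
  define \<mu> where "\<mu> A = \<nu> A + C * measure M A" for A
  have \<mu>0: "0 \<le> \<mu> A" and \<mu>2: "\<mu> A \<le> 2 * C * measure M A" if "A \<in> sets M" for A
    using bound[OF that] by (auto simp: \<mu>_def abs_le_iff)
  have empty: "\<mu> {} = 0" using bound[of "{}"] by (simp add: \<mu>_def)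
  have pos: "positive (sets M) (\<lambda>A. ennreal (\<mu> A))"
    by (simp add: positive_def empty)
  have ca: "countably_additive (sets M) (\<lambda>A. ennreal (\<mu> A))"
  proof (rule sets.empty_continuous_imp_countably_additive[OF pos])
    show "additive (sets M) (\<lambda>A. ennreal (\<mu> A))"
      using \<mu>0 by (auto simp: additive_def \<mu>_def add finite_measure_Union algebra_simps
          simp flip: ennreal_plus)
    fix A :: "nat \<Rightarrow> 'a set"
    assume A: "range A \<subseteq> sets M" "decseq A" "(\<Inter>i. A i) = {}"
    have "(\<lambda>i. measure M (A i)) \<longlonglongrightarrow> 0"
      using finite_Lim_measure_decseq[OF A(1,2)] A(3) by simp
    from tendsto_mult_right_zero[OF this] have lim: "(\<lambda>i. 2 * C * measure M (A i)) \<longlonglongrightarrow> 0" .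
    have "(\<lambda>i. \<mu> (A i)) \<longlonglongrightarrow> 0"
      by (rule tendsto_sandwich[OF _ _ tendsto_const lim]) (use A(1) \<mu>0 \<mu>2 in auto)
    then show "(\<lambda>i. ennreal (\<mu> (A i))) \<longlonglongrightarrow> 0"
      using tendsto_ennrealI by fastforce
  qed simp
  define N where "N = measure_of (space M) (sets M) (\<lambda>A. ennreal (\<mu> A))"
  have sN: "sets N = sets M" by (simp add: N_def sets.sets_measure_of_eq)
  have eN: "emeasure N A = ennreal (\<mu> A)" if "A \<in> sets M" for A
    using that unfolding N_def
    by (intro emeasure_measure_of_sigma sets.sigma_algebra_axioms pos ca)
  have "finite_measure N"
    using sets_eq_imp_space_eq[OF sN] by (intro finite_measureI) (simp add: eN)
  moreover have "absolutely_continuous M N"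
  proof -
    have "N A = 0" if "A \<in> null_sets M" for A
    proof -
      have "A \<in> sets M" "measure M A = 0" using that by (auto simp: measure_def)
      then show ?thesis using \<mu>0[of A] \<mu>2[of A] by (simp add: eN)
    qed
    then show ?thesis by (auto simp: absolutely_continuous_def null_sets_def sN)
  qed
  ultimately obtain f where f [measurable]: "f \<in> borel_measurable M" and N: "density M f = N"
    using Radon_Nikodym_finite_measure[OF _ sN] by blast
  have ef: "ennreal (\<mu> A) = (\<integral>\<^sup>+x. f x * indicator A x \<partial>M)" if "A \<in> sets M" for A
    using eN[OF that] that by (simp add: N[symmetric] emeasure_density)
  have "(\<integral>\<^sup>+x. f x \<partial>M) = (\<integral>\<^sup>+x. f x * indicator (space M) x \<partial>M)"
    by (rule nn_integral_cong) simp
  also have "\<dots> = ennreal (\<mu> (space M))" by (simp add: ef)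
  finally have fin: "(\<integral>\<^sup>+x. f x \<partial>M) = ennreal (\<mu> (space M))" .
  \<comment> \<open>The density may a priori take the value infinity; its total integral is finite,
    so passing to reals alters it on a null set only.\<close>
  have fe: "AE x in M. f x = ennreal (enn2real (f x))"
    using nn_integral_PInf_AE[OF f] fin by (auto simp: less_top)
  then have "(\<integral>\<^sup>+x. ennreal (enn2real (f x)) \<partial>M) = (\<integral>\<^sup>+x. f x \<partial>M)"
    by (intro nn_integral_cong_AE) auto
  then have int: "integrable M (\<lambda>x. enn2real (f x))"
    by (intro integrableI_nonneg) (auto simp: fin)
  have "\<nu> A = (\<integral>x. (enn2real (f x) - C) * indicator A x \<partial>M)" if A [measurable]: "A \<in> sets M" for A
  proof -
    have int': "integrable M (\<lambda>x. enn2real (f x) * indicator A x)"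
      using integrable_mult_indicator[OF A int] by (simp add: mult.commute)
    have "ennreal (\<mu> A) = (\<integral>\<^sup>+x. ennreal (enn2real (f x) * indicator A x) \<partial>M)"
      unfolding ef[OF A] by (rule nn_integral_cong_AE, use fe in eventually_elim) (auto simp: indicator_def)
    also have "\<dots> = ennreal (\<integral>x. enn2real (f x) * indicator A x \<partial>M)"
      using int' by (rule nn_integral_eq_integral) simp
    finally have "\<mu> A = (\<integral>x. enn2real (f x) * indicator A x \<partial>M)"
      using \<mu>0[OF A] by (subst (asm) ennreal_inj) (auto intro!: integral_nonneg_AE)
    moreover have "(\<integral>x. (enn2real (f x) - C) * indicator A x \<partial>M)
        = (\<integral>x. enn2real (f x) * indicator A x \<partial>M) - (\<integral>x. C * indicator A x \<partial>M)"
      unfolding left_diff_distrib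
      by (intro Bochner_Integration.integral_diff int') (simp add: emeasure_eq_measure)
    ultimately show ?thesis by (simp add: \<mu>_def)
  qed
  moreover have "integrable M (\<lambda>x. enn2real (f x) - C)" using int by simp
  ultimately show ?thesis by blast
qed

section \<open>Bounded measurable complex functions and linear functionals on them\<close>

definition bdd_meas :: "'b measure \<Rightarrow> ('b \<Rightarrow> complex) set" where
  "bdd_meas M = {f. f \<in> borel_measurable M \<and> bounded (range f)}"

lemma bdd_measI: "f \<in> borel_measurable M \<Longrightarrow> (\<And>x. norm (f x) \<le> B) \<Longrightarrow> f \<in> bdd_meas M"
  by (auto simp: bdd_meas_def bounded_iff)

lemma bdd_measE:
  assumes "f \<in> bdd_meas M"
  obtains B where "f \<in> borel_measurable M" "0 \<le> B" "\<forall>x. norm (f x) \<le> B"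
  using assms by (auto simp: bdd_meas_def bounded_iff) (meson norm_ge_zero order_trans)

lemma bdd_meas_const [intro, simp]: "(\<lambda>x. c) \<in> bdd_meas M"
  by (rule bdd_measI) auto

lemma bdd_meas_indicator [intro, simp]: "A \<in> sets M \<Longrightarrow> (\<lambda>x. complex_of_real (indicator A x)) \<in> bdd_meas M"
  by (rule bdd_measI[where B=1]) (auto simp: indicator_def)

lemma bdd_meas_add [intro, simp]:
  assumes "f \<in> bdd_meas M" "g \<in> bdd_meas M"
  shows "(\<lambda>x. f x + g x) \<in> bdd_meas M"
proof -
  obtain B where B: "f \<in> borel_measurable M" "0 \<le> B" "\<forall>x. norm (f x) \<le> B"
    using assms(1) by (rule bdd_measE)
  obtain C where C: "g \<in> borel_measurable M" "0 \<le> C" "\<forall>x. norm (g x) \<le> C"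
    using assms(2) by (rule bdd_measE)
  show ?thesis
    using B C by (intro bdd_measI[where B="B + C"]) (auto intro: norm_triangle_mono)
qed

lemma bdd_meas_mult [intro, simp]:
  assumes "f \<in> bdd_meas M" "g \<in> bdd_meas M"
  shows "(\<lambda>x. f x * g x) \<in> bdd_meas M"
proof -
  obtain B where B: "f \<in> borel_measurable M" "0 \<le> B" "\<forall>x. norm (f x) \<le> B"
    using assms(1) by (rule bdd_measE)
  obtain C where C: "g \<in> borel_measurable M" "0 \<le> C" "\<forall>x. norm (g x) \<le> C"
    using assms(2) by (rule bdd_measE)
  show ?thesis
    using B C by (intro bdd_measI[where B="B * C"]) (auto simp: norm_mult intro: mult_mono)
qed

lemma bdd_meas_cnj [intro, simp]:
  assumes "f \<in> bdd_meas M"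
  shows "(\<lambda>x. cnj (f x)) \<in> bdd_meas M"
proof -
  obtain B where B: "f \<in> borel_measurable M" "0 \<le> B" "\<forall>x. norm (f x) \<le> B"
    using assms(1) by (rule bdd_measE)
  have "(\<lambda>x. cnj (f x)) \<in> borel_measurable M"
    by (rule borel_measurable_continuous_on[OF _ B(1)]) (intro continuous_intros)
  then show ?thesis using B(3) by (intro bdd_measI[where B=B]) auto
qed

lemma bdd_meas_sum [intro, simp]:
  assumes "\<And>i. i \<in> I \<Longrightarrow> f i \<in> bdd_meas M"
  shows "(\<lambda>x. \<Sum>i\<in>I. f i x) \<in> bdd_meas M"
  using assms by (induction I rule: infinite_finite_induct) auto

lemma bdd_meas_of_real:
  assumes "f \<in> borel_measurable M" "\<And>x. \<bar>f x\<bar> \<le> B"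
  shows "(\<lambda>x. complex_of_real (f x)) \<in> bdd_meas M"
  using assms by (intro bdd_measI[where B=B]) auto

lemma integrable_bdd_meas_mult:
  assumes "f \<in> bdd_meas M" "integrable M g"
  shows "integrable M (\<lambda>x. f x * g x)"
proof -
  obtain B where B: "f \<in> borel_measurable M" "0 \<le> B" "\<forall>x. norm (f x) \<le> B"
    using assms(1) by (rule bdd_measE)
  note [measurable] = B(1) borel_measurable_integrable[OF assms(2)]
  show ?thesis
    by (rule Bochner_Integration.integrable_bound[where f="\<lambda>x. B * norm (g x)"])
      (use B assms(2) in \<open>auto simp: norm_mult intro!: mult_right_mono AE_I2\<close>)
qed

lemma (in finite_measure) integrable_bdd_meas: "f \<in> bdd_meas M \<Longrightarrow> integrable M f"
  using integrable_bdd_meas_mult[of f M "\<lambda>_. 1"] by simp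

definition linear_bm :: "'b measure \<Rightarrow> (('b \<Rightarrow> complex) \<Rightarrow> complex) \<Rightarrow> bool" where
  "linear_bm M \<Lambda> \<longleftrightarrow> (\<forall>f\<in>bdd_meas M. \<forall>g\<in>bdd_meas M. \<forall>c. \<Lambda> (\<lambda>x. f x + c * g x) = \<Lambda> f + c * \<Lambda> g)"

lemma linear_bmD:
  assumes "linear_bm M \<Lambda>" "f \<in> bdd_meas M" "g \<in> bdd_meas M"
  shows "\<Lambda> (\<lambda>x. f x + c * g x) = \<Lambda> f + c * \<Lambda> g"
  using assms by (simp add: linear_bm_def)

lemma linear_bm_0:
  assumes "linear_bm M \<Lambda>"
  shows "\<Lambda> (\<lambda>x. 0) = 0"
  using linear_bmD[OF assms, of "\<lambda>_. 0" "\<lambda>_. 0" 1] by simp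

lemma linear_bm_sum:
  assumes "linear_bm M \<Lambda>" "finite I" "\<And>i. i \<in> I \<Longrightarrow> f i \<in> bdd_meas M"
  shows "\<Lambda> (\<lambda>x. \<Sum>i\<in>I. c i * f i x) = (\<Sum>i\<in>I. c i * \<Lambda> (f i))"
  using assms(2,3)
proof (induction I)
  case empty
  show ?case using linear_bm_0[OF assms(1)] by simp
next
  case (insert i I)
  have "\<Lambda> (\<lambda>x. (\<Sum>i\<in>I. c i * f i x) + c i * f i x) = \<Lambda> (\<lambda>x. \<Sum>i\<in>I. c i * f i x) + c i * \<Lambda> (f i)"
    using insert.prems by (intro linear_bmD[OF assms(1)] bdd_meas_sum bdd_meas_mult) auto
  then show ?case using insert by (simp add: add.commute)
qed

text \<open>Densities for the real and imaginary parts on indicators combine to g. The difference D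
  between the functional and integration against g vanishes on indicators and, by the bound, is
  small on uniformly small nonnegative functions, so approximation by step functions makes it vanish
  everywhere.\<close>

theorem (in finite_measure) functional_density:
  assumes space: "space M = UNIV" and lin: "linear_bm M \<Lambda>"
    and bound: "\<And>f B. f \<in> borel_measurable M \<Longrightarrow> (\<And>x. 0 \<le> f x) \<Longrightarrow> (\<And>x. f x \<le> B) \<Longrightarrow>
        norm (\<Lambda> (\<lambda>x. complex_of_real (f x))) \<le> C * (\<integral>x. f x \<partial>M)"
  shows "\<exists>g. integrable M g \<and> (\<forall>f\<in>bdd_meas M. \<Lambda> f = (\<integral>x. f x * g x \<partial>M))"
proof -
  let ?ind = "\<lambda>A x. complex_of_real (indicator A x)"
  have b: "norm (\<Lambda> (?ind A)) \<le> C * measure M A" if "A \<in> sets M" for A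
    using bound[of "indicator A" 1] that by (simp add: space)
  have a: "\<Lambda> (?ind (A \<union> B)) = \<Lambda> (?ind A) + \<Lambda> (?ind B)"
    if "A \<in> sets M" "B \<in> sets M" "A \<inter> B = {}" for A B
    using linear_bmD[OF lin bdd_meas_indicator[OF that(1)] bdd_meas_indicator[OF that(2)], of 1] that(3)
    by (simp add: indicator_add[symmetric] of_real_add[symmetric] del: of_real_add)
  have "\<exists>h. integrable M h \<and> (\<forall>A\<in>sets M. Re (\<Lambda> (?ind A)) = (\<integral>x. h x * indicator A x \<partial>M))"
  proof (rule additive_density[where C=C])
    show "\<bar>Re (\<Lambda> (?ind A))\<bar> \<le> C * measure M A" if "A \<in> sets M" for A
      using abs_Re_le_cmod b[OF that] by (rule order_trans)
  qed (simp only: a plus_complex.sel)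
  then obtain h1 where h1: "integrable M h1"
    "\<And>A. A \<in> sets M \<Longrightarrow> Re (\<Lambda> (?ind A)) = (\<integral>x. h1 x * indicator A x \<partial>M)" by blast
  have "\<exists>h. integrable M h \<and> (\<forall>A\<in>sets M. Im (\<Lambda> (?ind A)) = (\<integral>x. h x * indicator A x \<partial>M))"
  proof (rule additive_density[where C=C])
    show "\<bar>Im (\<Lambda> (?ind A))\<bar> \<le> C * measure M A" if "A \<in> sets M" for A
      using abs_Im_le_cmod b[OF that] by (rule order_trans)
  qed (simp only: a plus_complex.sel)
  then obtain h2 where h2: "integrable M h2"
    "\<And>A. A \<in> sets M \<Longrightarrow> Im (\<Lambda> (?ind A)) = (\<integral>x. h2 x * indicator A x \<partial>M)" by blast
  define g where "g x = complex_of_real (h1 x) + \<i> * complex_of_real (h2 x)" for x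
  have g: "integrable M g" unfolding g_def using h1(1) h2(1) by auto
  have ind: "\<Lambda> (?ind A) = (\<integral>x. ?ind A x * g x \<partial>M)" if A: "A \<in> sets M" for A
  proof (rule complex_eqI)
    have int: "integrable M (\<lambda>x. ?ind A x * g x)"
      by (rule integrable_bdd_meas_mult[OF bdd_meas_indicator[OF A] g])
    show "Re (\<Lambda> (?ind A)) = Re (\<integral>x. ?ind A x * g x \<partial>M)"
      unfolding integral_Re[OF int, symmetric] by (simp add: A h1(2) g_def mult.commute)
    show "Im (\<Lambda> (?ind A)) = Im (\<integral>x. ?ind A x * g x \<partial>M)"
      unfolding integral_Im[OF int, symmetric] by (simp add: A h2(2) g_def mult.commute)
  qed
  define D where "D f = \<Lambda> f - (\<integral>x. f x * g x \<partial>M)" for f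
  have linD: "linear_bm M D"
    unfolding linear_bm_def
  proof (intro ballI allI)
    fix f k c assume f: "f \<in> bdd_meas M" "k \<in> bdd_meas M"
    have "(\<integral>x. (f x + c * k x) * g x \<partial>M) = (\<integral>x. f x * g x + c * (k x * g x) \<partial>M)"
      by (simp add: algebra_simps)
    also have "\<dots> = (\<integral>x. f x * g x \<partial>M) + c * (\<integral>x. k x * g x \<partial>M)"
      using f g by (simp add: integrable_bdd_meas_mult)
    finally show "D (\<lambda>x. f x + c * k x) = D f + c * D k"
      using linear_bmD[OF lin f, of c] by (simp add: D_def algebra_simps)
  qed
  \<comment> \<open>The integral bound on \<Lambda> and the integrability of g combine into an
    estimate in the uniform norm, which takes the place of continuity.\<close>
  have Dbound: "norm (D (\<lambda>x. complex_of_real (f x))) \<le> e * (C * measure M (space M) + (\<integral>x. norm (g x) \<partial>M))"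
    if f [measurable]: "f \<in> borel_measurable M" and f0: "\<And>x. 0 \<le> f x" and fe: "\<And>x. f x \<le> e" for f e
  proof -
    have C: "0 \<le> C * measure M (space M)"
      using order_trans[OF norm_ge_zero b[OF sets.top]] .
    have intf: "integrable M f"
      using f0 fe by (intro integrable_const_bound[where B=e]) auto
    have "norm (\<Lambda> (\<lambda>x. complex_of_real (f x))) \<le> C * (\<integral>x. f x \<partial>M)"
      using f f0 fe by (rule bound)
    also have "\<dots> \<le> e * (C * measure M (space M))"
    proof (cases "measure M (space M) = 0")
      \<comment> \<open>The sign of C is only known once the space has positive measure, so the null
        measure is treated apart.\<close>
      case True
      then have "AE x in M. False" by (simp add: AE_iff_measurable[OF _ refl] emeasure_eq_measure)
      then have "(\<integral>x. f x \<partial>M) = 0" by (intro integral_eq_zero_AE) auto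
      then show ?thesis using True by simp
    next
      case False
      then have "0 \<le> C" using C measure_nonneg[of M "space M"]
        by (simp add: zero_le_mult_iff)
      moreover have "(\<integral>x. f x \<partial>M) \<le> (\<integral>x. e \<partial>M)"
        using intf fe by (intro integral_mono) auto
      ultimately have "C * (\<integral>x. f x \<partial>M) \<le> C * (\<integral>x. e \<partial>M)" by (rule mult_left_mono[rotated])
      then show ?thesis by (simp add: mult_ac)
    qed
    finally have 1: "norm (\<Lambda> (\<lambda>x. complex_of_real (f x))) \<le> e * (C * measure M (space M))" .
    have "norm (\<integral>x. complex_of_real (f x) * g x \<partial>M) \<le> (\<integral>x. norm (complex_of_real (f x) * g x) \<partial>M)"
      by (rule integral_norm_bound)
    also have "\<dots> \<le> (\<integral>x. e * norm (g x) \<partial>M)"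
    proof (rule integral_mono)
      show "integrable M (\<lambda>x. norm (complex_of_real (f x) * g x))"
        using f0 fe by (intro integrable_norm integrable_bdd_meas_mult[OF bdd_meas_of_real[where B=e]] g) auto
    qed (use g f0 fe in \<open>auto simp: norm_mult intro: mult_right_mono\<close>)
    finally show ?thesis
      using 1 norm_triangle_ineq4[of "\<Lambda> (\<lambda>x. complex_of_real (f x))" "\<integral>x. complex_of_real (f x) * g x \<partial>M"]
      by (simp add: D_def algebra_simps)
  qed
  have Dreal: "D (\<lambda>x. complex_of_real (f x)) = 0"
    if f [measurable]: "f \<in> borel_measurable M" and fB: "\<And>x. \<bar>f x\<bar> \<le> B" for f B
  proof -
    let ?K = "C * measure M (space M) + (\<integral>x. norm (g x) \<partial>M)"
    have est: "norm (D (\<lambda>x. complex_of_real (f x))) \<le> inverse (real (Suc n)) * ?K" for n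
    proof -
      define N where "N = real (Suc n)"
      have N: "0 < N" by (simp add: N_def)
      \<comment> \<open>Rounding f down to multiples of 1/N gives a function with finitely many
        values that lies below f by at most 1/N; being a combination of indicators, it is
        annihilated by D.\<close>
      define s where "s x = \<lfloor>N * f x\<rfloor>" for x
      let ?I = "{\<lfloor>- (N * B)\<rfloor>..\<lfloor>N * B\<rfloor>}"
      have "s x \<in> ?I" for x
      proof -
        have "\<bar>N * f x\<bar> \<le> N * B" using fB[of x] N by (simp add: abs_mult)
        then show ?thesis unfolding s_def by (simp only: atLeastAtMost_iff abs_le_iff minus_le_iff floor_mono)
      qed
      then have s_eq: "complex_of_real (s x / N) = (\<Sum>y\<in>?I. complex_of_real (y / N) * ?ind {x. s x = y} x)" for x
        by (subst sum.remove[of _ "s x"]) (auto simp: sum.neutral)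
      have [measurable]: "s \<in> measurable M (count_space UNIV)" unfolding s_def by measurable
      have A: "{x. s x = y} \<in> sets M" for y
      proof -
        have "{x\<in>space M. s x = y} \<in> sets M" by measurable
        then show ?thesis by (simp add: space)
      qed
      have "D (\<lambda>x. complex_of_real (s x / N)) = (\<Sum>y\<in>?I. complex_of_real (y / N) * D (?ind {x. s x = y}))"
        unfolding s_eq by (rule linear_bm_sum[OF linD]) (use A in auto)
      also have "\<dots> = 0" using A by (simp add: D_def ind)
      finally have Ds: "D (\<lambda>x. complex_of_real (s x / N)) = 0" .
      have s1: "0 \<le> f x - s x / N" "f x - s x / N \<le> inverse N" for x
      proof -
        have eq: "f x - s x / N = (N * f x - s x) / N"
          using N by (simp add: diff_divide_distrib)
        have fl: "0 \<le> N * f x - s x" "N * f x - s x \<le> 1"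
          using of_int_floor_le[of "N * f x"] real_of_int_floor_add_one_ge[of "N * f x"]
          unfolding s_def by linarith+
        show "0 \<le> f x - s x / N" "f x - s x / N \<le> inverse N"
          using fl N divide_right_mono[OF fl(2), of N] by (auto simp: eq inverse_eq_divide)
      qed
      have "(\<lambda>x. complex_of_real (s x / N)) \<in> bdd_meas M"
        unfolding s_eq using A by (intro bdd_meas_sum bdd_meas_mult) auto
      moreover have "(\<lambda>x. complex_of_real (f x - s x / N)) \<in> bdd_meas M"
        using s1 by (intro bdd_meas_of_real[where B="inverse N"]) simp_all
      ultimately have "D (\<lambda>x. complex_of_real (s x / N) + 1 * complex_of_real (f x - s x / N))
          = D (\<lambda>x. complex_of_real (s x / N)) + 1 * D (\<lambda>x. complex_of_real (f x - s x / N))"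
        by (rule linear_bmD[OF linD])
      then have "D (\<lambda>x. complex_of_real (f x)) = D (\<lambda>x. complex_of_real (f x - s x / N))"
        using Ds by simp
      then show ?thesis
        using Dbound[of "\<lambda>x. f x - s x / N" "inverse N"] s1 by (simp add: N_def)
    qed
    have "(\<lambda>n. inverse (real (Suc n)) * ?K) \<longlonglongrightarrow> 0"
      by (rule tendsto_mult_left_zero[OF LIMSEQ_inverse_real_of_nat])
    then have "norm (D (\<lambda>x. complex_of_real (f x))) \<le> 0"
      by (rule LIMSEQ_le_const) (use est in auto)
    then show ?thesis by simp
  qed
  have "D f = 0" if f: "f \<in> bdd_meas M" for f
  proof -
    obtain B where B: "f \<in> borel_measurable M" "0 \<le> B" "\<forall>x. norm (f x) \<le> B"
      using f by (rule bdd_measE)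
    note [measurable] = B(1)
    have R: "\<And>x. \<bar>Re (f x)\<bar> \<le> B" and I: "\<And>x. \<bar>Im (f x)\<bar> \<le> B"
      using B(3) abs_Re_le_cmod abs_Im_le_cmod order_trans by blast+
    have "D (\<lambda>x. complex_of_real (Re (f x))) = 0" "D (\<lambda>x. complex_of_real (Im (f x))) = 0"
      by (rule Dreal[OF _ R], measurable) (rule Dreal[OF _ I], measurable)
    then have "D (\<lambda>x. complex_of_real (Re (f x)) + \<i> * complex_of_real (Im (f x))) = 0"
      using R I by (subst linear_bmD[OF linD]) (auto intro!: bdd_meas_of_real[where B=B])
    then show ?thesis by (simp add: complex_eq[symmetric])
  qed
  then show ?thesis using g by (auto simp: D_def)
qed

subsection \<open>Local kernels\<close>

text \<open>These are the matrix units, a basis of the local algebra when s and t range over the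
  configurations of the window.\<close>

definition eu :: "(int \<Rightarrow> 'h) \<Rightarrow> (int \<Rightarrow> 'h) \<Rightarrow> 'h kern" where
  "eu s t = (\<lambda>u v. if u = s \<and> v = t then 1 else 0)"

lemma finite_qconf [simp, intro]: "finite L \<Longrightarrow> finite (qconf L :: (int \<Rightarrow> 'h::finite) set)"
  by (simp add: qconf_def finite_PiE_UNIV)

lemma qconf_nonempty: "qconf L \<noteq> {}"
  by (simp add: qconf_def PiE_eq_empty_iff)

lemma restrict_qconf [simp]: "restrict f L \<in> qconf L"
  by (simp add: qconf_def)

lemma restrict_qconf_eq [simp]: "s \<in> qconf L \<Longrightarrow> restrict s L = s"
  by (simp add: qconf_def PiE_restrict)

lemma sum_units:
  fixes u v :: "int \<Rightarrow> 'h::finite" and c :: "(int \<Rightarrow> 'h) \<Rightarrow> (int \<Rightarrow> 'h) \<Rightarrow> complex"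
  assumes "finite L" "u \<in> qconf L" "v \<in> qconf L"
  shows "(\<Sum>s\<in>qconf L. \<Sum>t\<in>qconf L. c s t * eu s t u v) = c u v"
proof -
  have "(\<Sum>t\<in>qconf L. c s t * eu s t u v) = (\<Sum>t\<in>qconf L. if t = v then (if s = u then c u v else 0) else 0)" for s
    by (rule sum.cong) (auto simp: eu_def)
  then show ?thesis using assms by simp
qed

text \<open>Kernels are total functions, but a local observable is only their restriction to
  configurations of the window; this relation is equality of observables.\<close>

definition kcong :: "int set \<Rightarrow> 'h kern \<Rightarrow> 'h kern \<Rightarrow> bool" where
  "kcong L M N \<longleftrightarrow> (\<forall>s\<in>qconf L. \<forall>t\<in>qconf L. M s t = N s t)"

definition klinear :: "int set \<Rightarrow> ('h kern \<Rightarrow> complex) \<Rightarrow> bool" where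
  "klinear L \<Lambda> \<longleftrightarrow> (\<forall>M N. kcong L M N \<longrightarrow> \<Lambda> M = \<Lambda> N) \<and>
     (\<forall>M N c. \<Lambda> (\<lambda>s t. M s t + c * N s t) = \<Lambda> M + c * \<Lambda> N)"

definition kpositive :: "int set \<Rightarrow> ('h kern \<Rightarrow> complex) \<Rightarrow> bool" where
  "kpositive L \<Lambda> \<longleftrightarrow> (\<forall>M. cnonneg (\<Lambda> (kmult L (kadj M) M)))"

lemma klinear_cong: "klinear L \<Lambda> \<Longrightarrow> kcong L M N \<Longrightarrow> \<Lambda> M = \<Lambda> N"
  by (simp add: klinear_def)

lemma klinear_add: "klinear L \<Lambda> \<Longrightarrow> \<Lambda> (\<lambda>s t. M s t + c * N s t) = \<Lambda> M + c * \<Lambda> N"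
  by (simp add: klinear_def)

lemma klinear_0: "klinear L \<Lambda> \<Longrightarrow> \<Lambda> (\<lambda>s t. 0) = 0"
  using klinear_add[of L \<Lambda> "\<lambda>s t. 0" 1 "\<lambda>s t. 0"] by simp

lemma klinear_sum:
  assumes "klinear L \<Lambda>" "finite I"
  shows "\<Lambda> (\<lambda>s t. \<Sum>i\<in>I. c i * M i s t) = (\<Sum>i\<in>I. c i * \<Lambda> (M i))"
  using assms(2)
proof (induction I)
  case empty
  show ?case using klinear_0[OF assms(1)] by simp
next
  case (insert i I)
  then show ?case
    using klinear_add[OF assms(1), of "\<lambda>s t. \<Sum>i\<in>I. c i * M i s t" "c i" "M i"]
    by (simp add: add.commute)
qed

lemma klinear_expand:
  fixes \<Lambda> :: "'h::finite kern \<Rightarrow> complex"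
  assumes lin: "klinear L \<Lambda>" and L: "finite L"
  shows "\<Lambda> M = (\<Sum>s\<in>qconf L. \<Sum>t\<in>qconf L. M s t * \<Lambda> (eu s t))"
proof -
  have "\<Lambda> M = \<Lambda> (\<lambda>u v. \<Sum>(s, t)\<in>qconf L \<times> qconf L. M s t * eu s t u v)"
    using L by (intro klinear_cong[OF lin])
      (simp add: kcong_def sum.cartesian_product[symmetric] sum_units)
  also have "\<dots> = (\<Sum>(s, t)\<in>qconf L \<times> qconf L. M s t * \<Lambda> (eu s t))"
    using klinear_sum[OF lin, of "qconf L \<times> qconf L" "\<lambda>(s, t). M s t" "\<lambda>(s, t). eu s t"] L
    by (simp add: case_prod_unfold)
  finally show ?thesis by (simp add: sum.cartesian_product)
qed

lemma klinear_eqI: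
  fixes \<Lambda> \<Lambda>' :: "'h::finite kern \<Rightarrow> complex"
  assumes "klinear L \<Lambda>" "klinear L \<Lambda>'" "finite L"
    and "\<And>s t. s \<in> qconf L \<Longrightarrow> t \<in> qconf L \<Longrightarrow> \<Lambda> (eu s t) = \<Lambda>' (eu s t)"
  shows "\<Lambda> M = \<Lambda>' M"
  unfolding klinear_expand[OF assms(1,3), of M] klinear_expand[OF assms(2,3), of M]
  by (simp add: assms(4))

lemma klinear_weighted_sum:
  "klinear L (\<lambda>M. \<Sum>s\<in>qconf L. \<Sum>t\<in>qconf L. M s t * G s t)"
proof -
  have "(\<Sum>s\<in>qconf L. \<Sum>t\<in>qconf L. M s t * G s t) = (\<Sum>s\<in>qconf L. \<Sum>t\<in>qconf L. N s t * G s t)"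
    if "kcong L M N" for M N
    using that by (intro sum.cong refl) (auto simp: kcong_def)
  then show ?thesis
    by (auto simp: klinear_def algebra_simps sum.distrib sum_distrib_left)
qed

text \<open>The kernel is K* K, where K carries k in the row of one arbitrarily chosen configuration
  and zeros in all other rows.\<close>

lemma kpositive_rank_one:
  fixes \<Lambda> :: "'h::finite kern \<Rightarrow> complex"
  assumes lin: "klinear L \<Lambda>" and pos: "kpositive L \<Lambda>" and L: "finite L"
  shows "cnonneg (\<Lambda> (\<lambda>u v. cnj (k u) * k v))"
proof -
  obtain r0 :: "int \<Rightarrow> 'h" where r0: "r0 \<in> qconf L" using qconf_nonempty[of L] by blast
  let ?K = "\<lambda>r u. if r = r0 then k u else 0"
  have "kmult L (kadj ?K) ?K u v = (\<Sum>r\<in>qconf L. if r = r0 then cnj (k u) * k v else 0)" for u v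
    unfolding kmult_def kadj_def by (rule sum.cong) auto
  then have "kmult L (kadj ?K) ?K u v = cnj (k u) * k v" for u v
    using r0 L by simp
  then have "\<Lambda> (kmult L (kadj ?K) ?K) = \<Lambda> (\<lambda>u v. cnj (k u) * k v)"
    by (intro klinear_cong[OF lin]) (simp add: kcong_def)
  then show ?thesis using pos by (metis kpositive_def)
qed

text \<open>The quadratic form of \<Lambda> is nonnegative on vectors with entry 1 at s and \<alpha>
  at t. The values 1, -1, i, -i of \<alpha> bound the real and imaginary parts of the off-diagonal
  entry by the two diagonal ones, and the diagonal sums to the value at the identity. This turns
  control of the input marginal into control of every matrix entry.\<close>

lemma kpositive_unit_bound:
  fixes \<Lambda> :: "'h::finite kern \<Rightarrow> complex"
  assumes lin: "klinear L \<Lambda>" and pos: "kpositive L \<Lambda>" and L: "finite L"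
    and s: "s \<in> qconf L" and t: "t \<in> qconf L"
  shows "norm (\<Lambda> (eu s t)) \<le> Re (\<Lambda> (kid L))"
proof -
  have d: "cnonneg (\<Lambda> (eu u u))" for u
  proof -
    have "(\<lambda>x y. cnj (if x = u then 1 else 0) * (if y = u then 1 else 0)) = eu u u"
      by (intro ext) (simp add: eu_def)
    then show ?thesis
      using kpositive_rank_one[OF lin pos L, of "\<lambda>x. if x = u then 1 else 0"] by simp
  qed
  have "\<Lambda> (kid L) = (\<Sum>u\<in>qconf L. \<Sum>v\<in>qconf L. kid L u v * \<Lambda> (eu u v))"
    by (rule klinear_expand[OF lin L])
  also have "\<dots> = (\<Sum>u\<in>qconf L. \<Lambda> (eu u u))"
    using L by (intro sum.cong refl) (simp add: kid_def if_distrib[of "\<lambda>x. x * _"] sum.delta cong: if_cong)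
  finally have tr: "Re (\<Lambda> (kid L)) = (\<Sum>u\<in>qconf L. Re (\<Lambda> (eu u u)))" by simp
  have d0: "0 \<le> Re (\<Lambda> (eu u u))" for u using d[of u] by (simp add: cnonneg_def)
  show ?thesis
  proof (cases "s = t")
    case True
    have "norm (\<Lambda> (eu s t)) = Re (\<Lambda> (eu t t))"
      using d[of t] True by (simp add: cnonneg_def cmod_eq_Re)
    also have "\<dots> \<le> Re (\<Lambda> (kid L))"
      unfolding tr using t L d0 by (intro member_le_sum) auto
    finally show ?thesis .
  next
    case False
    have q: "cnonneg (\<Lambda> (eu s s) + (cnj \<alpha> * \<alpha>) * \<Lambda> (eu t t) + \<alpha> * \<Lambda> (eu s t) + cnj \<alpha> * \<Lambda> (eu t s))" for \<alpha>
    proof -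
      let ?k = "\<lambda>x. if x = s then 1 else if x = t then \<alpha> else 0"
      have "(\<lambda>x y. cnj (?k x) * ?k y) =
        (\<lambda>x y. (\<lambda>x y. (\<lambda>x y. eu s s x y + (cnj \<alpha> * \<alpha>) * eu t t x y) x y + \<alpha> * eu s t x y) x y + cnj \<alpha> * eu t s x y)"
        by (intro ext) (use False in \<open>auto simp: eu_def\<close>)
      then have "\<Lambda> (\<lambda>x y. cnj (?k x) * ?k y)
        = \<Lambda> (eu s s) + (cnj \<alpha> * \<alpha>) * \<Lambda> (eu t t) + \<alpha> * \<Lambda> (eu s t) + cnj \<alpha> * \<Lambda> (eu t s)"
        by (simp only: klinear_add[OF lin])
      then show ?thesis using kpositive_rank_one[OF lin pos L, of ?k] by simp
    qed
    let ?a = "\<Lambda> (eu s t)" and ?d = "Re (\<Lambda> (eu s s)) + Re (\<Lambda> (eu t t))"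
    let ?b = "\<Lambda> (eu t s)"
    have im: "Im (\<Lambda> (eu s s)) = 0" "Im (\<Lambda> (eu t t)) = 0"
      using d[of s] d[of t] by (simp_all add: cnonneg_def)
    have "Im ?a + Im ?b = 0" "0 \<le> ?d + Re ?a + Re ?b"
      using q[of 1] im by (simp_all add: cnonneg_def)
    moreover have "0 \<le> ?d - Re ?a - Re ?b"
      using q[of "-1"] by (simp add: cnonneg_def)
    moreover have "Re ?a - Re ?b = 0" "0 \<le> ?d - Im ?a + Im ?b"
      using q[of "\<i>"] im by (simp_all add: cnonneg_def)
    moreover have "0 \<le> ?d + Im ?a - Im ?b"
      using q[of "-\<i>"] by (simp add: cnonneg_def)
    ultimately have "\<bar>Re ?a\<bar> + \<bar>Im ?a\<bar> \<le> ?d" by linarith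
    then have "norm ?a \<le> ?d" using cmod_le[of ?a] by linarith
    also have "?d = (\<Sum>u\<in>{s, t}. Re (\<Lambda> (eu u u)))" using False by simp
    also have "\<dots> \<le> Re (\<Lambda> (kid L))"
      unfolding tr using s t L d0 by (intro sum_mono2) auto
    finally show ?thesis .
  qed
qed

section \<open>States on local algebras\<close>

lemma qstate_klinear:
  assumes "qstate w" "finite L"
  shows "klinear L (w L)"
  unfolding klinear_def kcong_def
proof (intro conjI allI impI)
  note w = assms(1)[unfolded qstate_def]
  show "w L M = w L N" if "\<forall>s\<in>qconf L. \<forall>t\<in>qconf L. M s t = N s t" for M N
    using w[THEN conjunct1] assms(2) that by simp
  show "w L (\<lambda>s t. M s t + c * N s t) = w L M + c * w L N" for M N c
    using w[THEN conjunct2, THEN conjunct1] assms(2) by simp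
qed

lemma qstate_kpositive: "qstate w \<Longrightarrow> finite L \<Longrightarrow> kpositive L (w L)"
  by (simp only: qstate_def kpositive_def simp_thms)

lemma qstate_kid: "qstate w \<Longrightarrow> finite L \<Longrightarrow> w L (kid L) = 1"
  by (simp only: qstate_def simp_thms)

lemma qstate_kembed: "qstate w \<Longrightarrow> finite L' \<Longrightarrow> L \<subseteq> L' \<Longrightarrow> w L' (kembed L L' M) = w L M"
  by (simp only: qstate_def simp_thms)

lemma qstate_unit_bound:
  fixes w :: "int set \<Rightarrow> 'h::finite kern \<Rightarrow> complex"
  assumes "qstate w" "finite L" "s \<in> qconf L" "t \<in> qconf L"
  shows "norm (w L (eu s t)) \<le> 1"
  using kpositive_unit_bound[OF qstate_klinear[OF assms(1,2)] qstate_kpositive[OF assms(1,2)] assms(2-4)]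
  by (simp add: qstate_kid[OF assms(1,2)])

lemma qstateI:
  assumes "\<And>L. finite L \<Longrightarrow> klinear L (w L)" "\<And>L. finite L \<Longrightarrow> kpositive L (w L)"
    and "\<And>L. finite L \<Longrightarrow> w L (kid L) = 1"
    and "\<And>L L' M. finite L' \<Longrightarrow> L \<subseteq> L' \<Longrightarrow> w L' (kembed L L' M) = w L M"
  shows "qstate w"
proof -
  have 1: "w L M = w L N" if "finite L" "\<forall>s\<in>qconf L. \<forall>t\<in>qconf L. M s t = N s t" for L M N
    using klinear_cong[OF assms(1)[OF that(1)]] that(2) by (simp add: kcong_def)
  have 2: "cnonneg (w L (kmult L (kadj M) M))" if "finite L" for L M
    using assms(2)[OF that] by (simp add: kpositive_def)
  have 3: "w L (\<lambda>s t. M s t + c * N s t) = w L M + c * w L N" if "finite L" for L M N c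
    using assms(1)[OF that] by (rule klinear_add)
  show ?thesis
    unfolding qstate_def
    by (intro conjI allI impI 2 3 assms(3,4); (rule 1)?; assumption)
qed

text \<open>Since linearity survives embedding, compatibility between windows can be checked on
  matrix units.\<close>

lemma klinear_kembed:
  assumes "klinear L' \<Lambda>"
  shows "klinear L (\<lambda>M. \<Lambda> (kembed L L' M))"
proof -
  have 1: "kembed L L' (\<lambda>s t. M s t + c * N s t) = (\<lambda>s t. kembed L L' M s t + c * kembed L L' N s t)" for M N c
    by (simp add: kembed_def algebra_simps)
  have 2: "kcong L' (kembed L L' M) (kembed L L' N)" if "kcong L M N" for M N
    using that by (simp add: kcong_def kembed_def)
  show ?thesis
    unfolding klinear_def 1 klinear_add[OF assms]
    by (intro conjI allI impI klinear_cong[OF assms] 2 refl)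
qed

lemma klinear_kshift:
  assumes "klinear (shiftset L) \<Lambda>"
  shows "klinear L (\<lambda>M. \<Lambda> (kshift L M))"
proof -
  have 1: "kshift L (\<lambda>s t. M s t + c * N s t) = (\<lambda>s t. kshift L M s t + c * kshift L N s t)" for M N c
    by (simp add: kshift_def)
  have 2: "kcong (shiftset L) (kshift L M) (kshift L N)" if "kcong L M N" for M N
    using that by (simp add: kcong_def kshift_def)
  show ?thesis
    unfolding klinear_def 1 klinear_add[OF assms]
    by (intro conjI allI impI klinear_cong[OF assms] 2 refl)
qed

lemma finite_shiftset [simp]: "finite L \<Longrightarrow> finite (shiftset L)"
  by (simp add: shiftset_def)

section \<open>Positivity tested on rational kernels\<close>

lemma cnonneg_lim:
  assumes "f \<longlonglongrightarrow> z" "\<And>n. cnonneg (f n)"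
  shows "cnonneg z"
proof -
  have "(\<lambda>n. Im (f n)) \<longlonglongrightarrow> Im z" "(\<lambda>n. Re (f n)) \<longlonglongrightarrow> Re z"
    using assms(1) by (auto intro: tendsto_intros)
  then show ?thesis
    using assms(2) by (auto simp: cnonneg_def LIMSEQ_const_iff intro: LIMSEQ_le_const)
qed

definition rat_complex :: "complex set" where
  "rat_complex = (\<lambda>(a, b). Complex a b) ` (\<rat> \<times> \<rat>)"

lemma countable_rat_complex: "countable rat_complex"
  unfolding rat_complex_def by (intro countable_image countable_SIGMA countable_rat)

lemma rat_complex_dense: "\<exists>f. (\<forall>n. f n \<in> rat_complex) \<and> f \<longlonglongrightarrow> z"
proof -
  have r: "\<exists>q\<in>\<rat>. x < q \<and> q < x + inverse (real (Suc n))" for x n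
    using Rats_dense_in_real[of x "x + inverse (real (Suc n))"] by auto
  have ex: "\<exists>q. (\<forall>n. q n \<in> \<rat>) \<and> q \<longlonglongrightarrow> x" for x :: real
  proof -
    obtain q where q: "\<And>n. q n \<in> \<rat>" "\<And>n. x < q n" "\<And>n. q n < x + inverse (real (Suc n))"
      using r[of x] by metis
    have "q \<longlonglongrightarrow> x"
    proof (rule tendsto_sandwich[where f="\<lambda>_. x" and h="\<lambda>n. x + inverse (real (Suc n))"])
      show "(\<lambda>n. x + inverse (real (Suc n))) \<longlonglongrightarrow> x"
        by (rule LIMSEQ_inverse_real_of_nat_add)
    qed (simp_all add: less_imp_le[OF q(2)] less_imp_le[OF q(3)] del: of_nat_Suc)
    then show ?thesis using q(1) by blast
  qed
  obtain a b where "\<forall>n. a n \<in> \<rat>" "a \<longlonglongrightarrow> Re z" "\<forall>n. b n \<in> \<rat>" "b \<longlonglongrightarrow> Im z"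
    using ex by metis
  then have "(\<forall>n. Complex (a n) (b n) \<in> rat_complex) \<and> (\<lambda>n. Complex (a n) (b n)) \<longlonglongrightarrow> z"
    using tendsto_Complex[of a "Re z" sequentially b "Im z"] by (auto simp: rat_complex_def)
  then show ?thesis by (intro exI[of _ "\<lambda>n. Complex (a n) (b n)"])
qed

text \<open>Extensional function spaces fix all values outside the configurations of the window,
  which is what makes the set countable.\<close>

definition rat_kernels :: "int set \<Rightarrow> 'h kern set" where
  "rat_kernels L = qconf L \<rightarrow>\<^sub>E (qconf L \<rightarrow>\<^sub>E rat_complex)"

lemma countable_rat_kernels: "finite L \<Longrightarrow> countable (rat_kernels L :: 'h::finite kern set)"
  unfolding rat_kernels_def by (intro countable_PiE countable_rat_complex finite_qconf)

text \<open>Positivity is not a linear condition, so it cannot be read off from matrix units. The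
  value at \<open>kmult L (kadj K) K\<close> is a polynomial in the finitely many entries of K and
  their conjugates, hence continuous, and nonnegativity survives the limit from rational
  entries.\<close>

lemma kpositive_rat:
  fixes \<Lambda> :: "'h::finite kern \<Rightarrow> complex"
  assumes lin: "klinear L \<Lambda>" and L: "finite L"
    and rat: "\<And>K. K \<in> rat_kernels L \<Longrightarrow> cnonneg (\<Lambda> (kmult L (kadj K) K))"
  shows "kpositive L \<Lambda>"
  unfolding kpositive_def
proof
  fix K :: "'h kern"
  obtain f where f: "\<And>z. (\<forall>n. f z n \<in> rat_complex) \<and> f z \<longlonglongrightarrow> z"
    using rat_complex_dense by metis
  define k where "k s t = f (K s t)" for s t
  have k: "k s t n \<in> rat_complex" "k s t \<longlonglongrightarrow> K s t" for s t n
    using f by (auto simp: k_def)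
  let ?K = "\<lambda>n. restrict (\<lambda>s. restrict (\<lambda>t. k s t n) (qconf L)) (qconf L)"
  have "(\<lambda>n. \<Sum>s\<in>qconf L. \<Sum>t\<in>qconf L. kmult L (kadj (?K n)) (?K n) s t * \<Lambda> (eu s t))
      \<longlonglongrightarrow> (\<Sum>s\<in>qconf L. \<Sum>t\<in>qconf L. kmult L (kadj K) K s t * \<Lambda> (eu s t))"
    unfolding kmult_def kadj_def
  proof (intro tendsto_sum tendsto_mult tendsto_const tendsto_cnj)
    fix r s t :: "int \<Rightarrow> 'h" assume "r \<in> qconf L" "s \<in> qconf L" "t \<in> qconf L"
    then show "(\<lambda>n. ?K n r s) \<longlonglongrightarrow> K r s" "(\<lambda>n. ?K n r t) \<longlonglongrightarrow> K r t"
      using k(2) by simp_all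
  qed
  then have "(\<lambda>n. \<Lambda> (kmult L (kadj (?K n)) (?K n))) \<longlonglongrightarrow> \<Lambda> (kmult L (kadj K) K)"
    by (simp only: klinear_expand[OF lin L, symmetric])
  then show "cnonneg (\<Lambda> (kmult L (kadj K) K))"
  proof (rule cnonneg_lim)
    show "cnonneg (\<Lambda> (kmult L (kadj (?K n)) (?K n)))" for n
      by (rule rat) (auto simp: rat_kernels_def k(1))
  qed
qed

subsection \<open>Joint states of channels\<close>

lemma bdd_meas_cong:
  assumes "sets M = sets N"
  shows "bdd_meas M = bdd_meas N"
  unfolding bdd_meas_def measurable_cong_sets[OF assms refl] ..

lemma jadm_iff: "jadm L F \<longleftrightarrow> finite L \<and> (\<forall>s\<in>qconf L. \<forall>t\<in>qconf L. (\<lambda>x. F x s t) \<in> bdd_meas Min)"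
  by (simp add: jadm_def bdd_meas_def)

lemma jadm_finite: "jadm L F \<Longrightarrow> finite L"
  by (simp add: jadm_def)

lemma jadm_scale: "finite L \<Longrightarrow> f \<in> bdd_meas Min \<Longrightarrow> jadm L (\<lambda>x s t. f x * M s t)"
  by (simp add: jadm_iff)

text \<open>Positivity and normalisation are dropped to obtain a class closed under complex linear
  combinations, so that it holds candidate decompositions as well as channels. Bounded measurable
  matrix entries are what the integration of joint observables requires.\<close>

definition kchannel :: "((int \<Rightarrow> 'a) \<Rightarrow> int set \<Rightarrow> 'h kern \<Rightarrow> complex) \<Rightarrow> bool" where
  "kchannel V \<longleftrightarrow> (\<forall>L. finite L \<longrightarrow> (\<forall>x. klinear L (V x L)) \<and>
     (\<forall>s\<in>qconf L. \<forall>t\<in>qconf L. (\<lambda>x. V x L (eu s t)) \<in> bdd_meas Min))"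

lemma kchannelD:
  assumes "kchannel V" "finite L"
  shows "klinear L (V x L)" "s \<in> qconf L \<Longrightarrow> t \<in> qconf L \<Longrightarrow> (\<lambda>x. V x L (eu s t)) \<in> bdd_meas Min"
  using assms by (simp_all add: kchannel_def)

lemma cqchannel_qstate: "cqchannel W \<Longrightarrow> qstate (W x)"
  by (simp add: cqchannel_def)

lemma cqchannel_kchannel:
  fixes W :: "(int \<Rightarrow> 'a) \<Rightarrow> int set \<Rightarrow> 'h::finite kern \<Rightarrow> complex"
  assumes W: "cqchannel W"
  shows "kchannel W"
  unfolding kchannel_def
proof (intro allI impI conjI ballI)
  fix L :: "int set" and x assume L: "finite L"
  show "klinear L (W x L)" by (rule qstate_klinear[OF cqchannel_qstate[OF W] L])
  fix s t :: "int \<Rightarrow> 'h" assume st: "s \<in> qconf L" "t \<in> qconf L"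
  show "(\<lambda>x. W x L (eu s t)) \<in> bdd_meas Min"
  proof (rule bdd_measI[where B=1])
    show "(\<lambda>x. W x L (eu s t)) \<in> borel_measurable Min" using W L by (simp add: cqchannel_def)
    show "norm (W x L (eu s t)) \<le> 1" for x
      by (rule qstate_unit_bound[OF cqchannel_qstate[OF W] L st])
  qed
qed

lemma kchannel_combination:
  assumes "kchannel V" "kchannel W"
  shows "kchannel (\<lambda>x L M. a * V x L M + b * W x L M)"
  unfolding kchannel_def
proof (intro allI impI conjI ballI)
  fix L :: "int set" and x assume L: "finite L"
  note V = kchannelD(1)[OF assms(1) L, of x] and W = kchannelD(1)[OF assms(2) L, of x]
  show "klinear L (\<lambda>M. a * V x L M + b * W x L M)"
    unfolding klinear_def
  proof (intro conjI allI impI)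
    fix M N :: "'b kern" and c
    show "a * V x L (\<lambda>s t. M s t + c * N s t) + b * W x L (\<lambda>s t. M s t + c * N s t) =
       a * V x L M + b * W x L M + c * (a * V x L N + b * W x L N)"
      by (simp add: klinear_add[OF V] klinear_add[OF W] algebra_simps)
    assume "kcong L M N"
    then show "a * V x L M + b * W x L M = a * V x L N + b * W x L N"
      using klinear_cong[OF V] klinear_cong[OF W] by metis
  qed
  fix s t :: "int \<Rightarrow> 'b" assume "s \<in> qconf L" "t \<in> qconf L"
  then show "(\<lambda>x. a * V x L (eu s t) + b * W x L (eu s t)) \<in> bdd_meas Min"
    by (intro bdd_meas_add bdd_meas_mult bdd_meas_const kchannelD(2)[OF assms(1) L] kchannelD(2)[OF assms(2) L])
qed

text \<open>A channel is measurable in x for a fixed observable, whereas here the observable moves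
  with x too. Expansion in matrix units separates the two dependences.\<close>

lemma kchannel_bdd_meas:
  fixes V :: "(int \<Rightarrow> 'a) \<Rightarrow> int set \<Rightarrow> 'h::finite kern \<Rightarrow> complex"
  assumes V: "kchannel V" and F: "jadm L F"
  shows "(\<lambda>x. V x L (F x)) \<in> bdd_meas Min"
proof -
  have L: "finite L" using F by (rule jadm_finite)
  have "(\<lambda>x. \<Sum>s\<in>qconf L. \<Sum>t\<in>qconf L. F x s t * V x L (eu s t)) \<in> bdd_meas Min"
    using F by (intro bdd_meas_sum bdd_meas_mult kchannelD(2)[OF V L]) (auto simp: jadm_iff)
  also have "(\<lambda>x. \<Sum>s\<in>qconf L. \<Sum>t\<in>qconf L. F x s t * V x L (eu s t)) = (\<lambda>x. V x L (F x))"
    by (rule ext) (rule klinear_expand[OF kchannelD(1)[OF V L] L, symmetric])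
  finally show ?thesis .
qed

text \<open>The finite windows are countably many and each has finitely many matrix units, so the
  exceptional null sets can be united.\<close>

lemma AE_units:
  fixes P :: "(int \<Rightarrow> 'a) \<Rightarrow> int set \<Rightarrow> (int \<Rightarrow> 'h::finite) \<Rightarrow> (int \<Rightarrow> 'h) \<Rightarrow> bool"
  assumes "\<And>L s t. finite L \<Longrightarrow> s \<in> qconf L \<Longrightarrow> t \<in> qconf L \<Longrightarrow> AE x in p. P x L s t"
  shows "AE x in p. \<forall>L. finite L \<longrightarrow> (\<forall>s\<in>qconf L. \<forall>t\<in>qconf L. P x L s t)"
proof -
  have "AE x in p. \<forall>L\<in>Collect finite. \<forall>s\<in>qconf L. \<forall>t\<in>qconf L. P x L s t"
  proof (rule AE_ball_countable[THEN iffD2, OF countable_Collect_finite], rule ballI)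
    fix L :: "int set" assume "L \<in> Collect finite"
    then have L: "finite L" by simp
    show "AE x in p. \<forall>s\<in>qconf L. \<forall>t\<in>qconf L. P x L s t"
      by (intro AE_ball_countable[THEN iffD2] ballI countable_finite finite_qconf L assms)
  qed
  then show ?thesis by eventually_elim simp
qed

text \<open>Test with the set where h is negative: the integral of h over it is both nonnegative and
  nonpositive.\<close>

lemma (in finite_measure) AE_nonneg:
  fixes h :: "'a \<Rightarrow> real"
  assumes h: "integrable M h"
    and pos: "\<And>A. A \<in> sets M \<Longrightarrow> 0 \<le> (\<integral>x. indicator A x * h x \<partial>M)"
  shows "AE x in M. 0 \<le> h x"
proof -
  note [measurable] = borel_measurable_integrable[OF h]
  let ?A = "{x\<in>space M. h x < 0}"
  have A: "?A \<in> sets M" by measurable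
  have int: "integrable M (\<lambda>x. indicator ?A x * h x)"
    using integrable_mult_indicator[OF A h] by simp
  have neg: "indicator ?A x * h x \<le> 0" for x by (simp add: indicator_def)
  have "0 \<le> (\<integral>x. - (indicator ?A x * h x) \<partial>M)"
    using neg by (intro integral_nonneg_AE) simp
  then have "(\<integral>x. - (indicator ?A x * h x) \<partial>M) = 0"
    using pos[OF A] int by simp
  moreover have "integrable M (\<lambda>x. - (indicator ?A x * h x))" using int by simp
  moreover have "AE x in M. 0 \<le> - (indicator ?A x * h x)" using neg by simp
  ultimately have "AE x in M. - (indicator ?A x * h x) = 0"
    using integral_nonneg_eq_0_iff_AE by blast
  then show ?thesis
    by (rule AE_mp) (auto simp: indicator_def intro!: AE_I2)
qed

lemma (in finite_measure) AE_cnonneg: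
  assumes h: "integrable M h"
    and pos: "\<And>A. A \<in> sets M \<Longrightarrow> cnonneg (\<integral>x. complex_of_real (indicator A x) * h x \<partial>M)"
  shows "AE x in M. cnonneg (h x)"
proof -
  have int: "integrable M (\<lambda>x. complex_of_real (indicator A x) * h x)" if "A \<in> sets M" for A
    by (rule integrable_bdd_meas_mult[OF bdd_meas_indicator[OF that] h])
  have Re: "Re (\<integral>x. complex_of_real (indicator A x) * h x \<partial>M) = (\<integral>x. indicator A x * Re (h x) \<partial>M)"
    and Im: "Im (\<integral>x. complex_of_real (indicator A x) * h x \<partial>M) = (\<integral>x. indicator A x * Im (h x) \<partial>M)"
    if "A \<in> sets M" for A
    unfolding integral_Re[OF int[OF that], symmetric] integral_Im[OF int[OF that], symmetric] by simp_all
  have "AE x in M. 0 \<le> Re (h x)"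
    using pos h by (intro AE_nonneg) (auto simp: Re[symmetric] cnonneg_def)
  moreover have "AE x in M. 0 \<le> Im (h x)"
    using pos h by (intro AE_nonneg) (auto simp: Im[symmetric] cnonneg_def)
  moreover have "AE x in M. 0 \<le> - Im (h x)"
    using pos h by (intro AE_nonneg) (auto simp: Im[symmetric] cnonneg_def)
  ultimately show ?thesis by eventually_elim (simp add: cnonneg_def)
qed

lemma (in finite_measure) AE_zero:
  assumes h: "integrable M h"
    and zero: "\<And>A. A \<in> sets M \<Longrightarrow> (\<integral>x. complex_of_real (indicator A x) * h x \<partial>M) = 0"
  shows "AE x in M. h x = 0"
proof -
  have "AE x in M. cnonneg (h x)"
    using h zero by (intro AE_cnonneg) (auto simp: cnonneg_def)
  moreover have "AE x in M. cnonneg (- h x)"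
    using h zero by (intro AE_cnonneg) (auto simp: cnonneg_def)
  ultimately show ?thesis by eventually_elim (simp add: cnonneg_def complex_eq_iff)
qed

context stationary_measure
begin

lemma bdd_meas_p: "bdd_meas p = bdd_meas Min"
  by (rule bdd_meas_cong[OF sets_p])

lemma integrable_kchannel:
  fixes V :: "(int \<Rightarrow> 'a) \<Rightarrow> int set \<Rightarrow> 'h::finite kern \<Rightarrow> complex"
  assumes "kchannel V" "jadm L F"
  shows "integrable p (\<lambda>x. V x L (F x))"
  using kchannel_bdd_meas[OF assms, folded bdd_meas_p] by (rule integrable_bdd_meas)

text \<open>An indicator times a matrix unit isolates one matrix entry over an arbitrary set of
  inputs, so the entries agree almost surely, and countably many entries determine both
  maps.\<close>

lemma psi_eq_AE:
  fixes V W :: "(int \<Rightarrow> 'a) \<Rightarrow> int set \<Rightarrow> 'h::finite kern \<Rightarrow> complex"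
  assumes V: "kchannel V" and W: "kchannel W"
    and eq: "\<And>L F. jadm L F \<Longrightarrow> psi p V L F = psi p W L F"
  shows "AE x in p. \<forall>L M. finite L \<longrightarrow> V x L M = W x L M"
proof -
  have "AE x in p. \<forall>L. finite L \<longrightarrow> (\<forall>s\<in>qconf L. \<forall>t\<in>qconf L. V x L (eu s t) = W x L (eu s t))"
  proof (rule AE_units)
    fix L :: "int set" and s t :: "int \<Rightarrow> 'h"
    assume L: "finite L" and st: "s \<in> qconf L" "t \<in> qconf L"
    have int: "integrable p (\<lambda>x. V x L (eu s t))" "integrable p (\<lambda>x. W x L (eu s t))"
      using kchannelD(2)[OF V L st] kchannelD(2)[OF W L st]
      by (auto intro!: integrable_bdd_meas simp: bdd_meas_p)
    have "AE x in p. V x L (eu s t) - W x L (eu s t) = 0"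
    proof (rule AE_zero)
      fix A assume A: "A \<in> sets p"
      let ?i = "\<lambda>x. complex_of_real (indicator A x)"
      have i: "?i \<in> bdd_meas p" using A by simp
      have J: "jadm L (\<lambda>x s' t'. ?i x * eu s t s' t')"
        using i L by (intro jadm_scale) (simp_all add: bdd_meas_p)
      have lin: "U (\<lambda>s' t'. c * eu s t s' t') = c * U (eu s t)" if "klinear L U" for U c
        using klinear_add[OF that, of "\<lambda>_ _. 0" c "eu s t"] klinear_0[OF that] by simp
      have "(\<integral>x. ?i x * V x L (eu s t) \<partial>p) = (\<integral>x. ?i x * W x L (eu s t) \<partial>p)"
        using eq[OF J] by (simp add: psi_def lin[OF kchannelD(1)[OF V L]] lin[OF kchannelD(1)[OF W L]])
      then show "(\<integral>x. ?i x * (V x L (eu s t) - W x L (eu s t)) \<partial>p) = 0"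
        using int by (simp add: right_diff_distrib integrable_bdd_meas_mult[OF i])
    qed (use int in simp)
    then show "AE x in p. V x L (eu s t) = W x L (eu s t)" by simp
  qed
  then show ?thesis
    by eventually_elim (auto intro: klinear_eqI kchannelD(1)[OF V] kchannelD(1)[OF W])
qed

lemma psi_cong_AE:
  assumes "AE x in p. \<forall>L M. finite L \<longrightarrow> V x L M = W x L M"
    and V: "kchannel V" and W: "kchannel W" and F: "jadm L F"
  shows "psi p V L F = psi p (W :: (int \<Rightarrow> 'a) \<Rightarrow> int set \<Rightarrow> 'h::finite kern \<Rightarrow> complex) L F"
  unfolding psi_def
proof (rule integral_cong_AE)
  show "AE x in p. V x L (F x) = W x L (F x)"
    using assms(1) by eventually_elim (simp add: jadm_finite[OF F])
qed (rule borel_measurable_integrable[OF integrable_kchannel[OF V F]]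
    borel_measurable_integrable[OF integrable_kchannel[OF W F]])+

lemma psi_combination:
  fixes V W :: "(int \<Rightarrow> 'a) \<Rightarrow> int set \<Rightarrow> 'h::finite kern \<Rightarrow> complex"
  assumes V: "kchannel V" and W: "kchannel W" and F: "jadm L F"
  shows "psi p (\<lambda>x L M. a * V x L M + b * W x L M) L F = a * psi p V L F + b * psi p W L F"
proof -
  note int = integrable_mult_right[OF integrable_kchannel[OF V F]] integrable_mult_right[OF integrable_kchannel[OF W F]]
  show ?thesis
    unfolding psi_def by (simp only: Bochner_Integration.integral_add[OF int] integral_mult_right_zero)
qed

lemma jstate_psi:
  fixes W :: "(int \<Rightarrow> 'a) \<Rightarrow> int set \<Rightarrow> 'h::finite kern \<Rightarrow> complex"
  assumes W: "cqchannel W"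
  shows "jstate (psi p W)"
proof -
  note q = cqchannel_qstate[OF W] and k = cqchannel_kchannel[OF W]
  have 1: "psi p W L F = psi p W L G"
    if "jadm L F" "\<forall>x. \<forall>s\<in>qconf L. \<forall>t\<in>qconf L. F x s t = G x s t" for L F G
  proof -
    have "W x L (F x) = W x L (G x)" for x
      using that(2) by (intro klinear_cong[OF kchannelD(1)[OF k jadm_finite[OF that(1)]]]) (simp add: kcong_def)
    then show ?thesis by (simp add: psi_def)
  qed
  have 2: "psi p W L (\<lambda>x s t. F x s t + c * G x s t) = psi p W L F + c * psi p W L G"
    if "jadm L F" "jadm L G" for L F G c
    using integrable_kchannel[OF k that(1)] integrable_kchannel[OF k that(2)]
    by (simp add: psi_def klinear_add[OF kchannelD(1)[OF k jadm_finite[OF that(1)]]])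
  have 3: "cnonneg (psi p W L (\<lambda>x. kmult L (kadj (F x)) (F x)))" if F: "jadm L F" for L F
  proof -
    have "jadm L (\<lambda>x. kmult L (kadj (F x)) (F x))"
      using F by (auto simp: jadm_iff kmult_def kadj_def intro!: bdd_meas_sum bdd_meas_mult bdd_meas_cnj)
    from integrable_kchannel[OF k this]
    have int: "integrable p (\<lambda>x. W x L (kmult L (kadj (F x)) (F x)))" .
    have "cnonneg (W x L (kmult L (kadj (F x)) (F x)))" for x
      using qstate_kpositive[OF q jadm_finite[OF F]] by (simp add: kpositive_def)
    then show ?thesis
      by (simp add: psi_def cnonneg_def integral_Re[OF int, symmetric] integral_Im[OF int, symmetric] del: integral_Re integral_Im)
  qed
  have 4: "psi p W L (\<lambda>x. kid L) = 1" if "finite L" for L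
    by (simp add: psi_def qstate_kid[OF q that] prob_space)
  have 5: "psi p W L' (\<lambda>x. kembed L L' (F x)) = psi p W L F" if "finite L'" "L \<subseteq> L'" for L L' F
    by (simp add: psi_def qstate_kembed[OF q that])
  show ?thesis
    unfolding jstate_def
    by (rule conjI, (intro allI impI, rule 1; assumption), rule conjI, (intro allI impI, rule 2; assumption),
        rule conjI, (intro allI impI, rule 3; assumption), rule conjI, (intro allI impI, rule 4; assumption),
        intro allI impI, rule 5; assumption)
qed

text \<open>Stationarity of the channel moves the shift from the output to the input, where
  invariance of p absorbs it.\<close>

lemma jstationary_psi:
  fixes W :: "(int \<Rightarrow> 'a) \<Rightarrow> int set \<Rightarrow> 'h::finite kern \<Rightarrow> complex"
  assumes W: "stationary_channel W"
  shows "jstationary (psi p W)"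
  unfolding jstationary_def
proof (intro allI impI)
  fix L F assume F: "jadm L (F :: (int \<Rightarrow> 'a) \<Rightarrow> 'h kern)"
  have k: "kchannel W" using W by (simp add: stationary_channel_def cqchannel_kchannel)
  have "psi p W (shiftset L) (\<lambda>x. kshift L (F (Tin x))) = (\<integral>x. W (Tin x) L (F (Tin x)) \<partial>p)"
    using W jadm_finite[OF F] by (simp add: psi_def stationary_channel_def)
  also have "\<dots> = psi p W L F"
    unfolding psi_def using integrable_kchannel[OF k F] by (intro integral_T) simp
  finally show "psi p W (shiftset L) (\<lambda>x. kshift L (F (Tin x))) = psi p W L F" .
qed

text \<open>The exceptional null set is removed together with all its translates, forward and
  backward. These are countably many, and each is null because p is invariant under powers of the
  shift in both directions. Exact invariance is the point: stationarity of a channel is an equation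
  at every input.\<close>

lemma invariant_core:
  assumes "AE x in p. P x"
  shows "\<exists>X\<in>sets Min. Tin -` X = X \<and> (AE x in p. x \<in> X) \<and> (\<forall>x\<in>X. P x)"
proof -
  obtain N where N0: "{x \<in> space p. \<not> P x} \<subseteq> N" "emeasure p N = 0" "N \<in> sets p"
    using assms by (rule AE_E)
  then have N: "N \<in> null_sets p" "{x. \<not> P x} \<subseteq> N"
    by (simp_all only: null_sets_def space_UNIV UNIV_I simp_thms mem_Collect_eq)
  define sh where "sh n x = (\<lambda>k. x (k + n))" for n :: int and x :: "int \<Rightarrow> 'a"
  have shT: "sh n (Tin x) = sh (n + 1) x" for n x
    by (simp add: sh_def Tin_def ac_simps)
  have sh_meas: "sh n \<in> measurable Min Min" for n
    unfolding sh_def[abs_def] by (rule measurable_shift)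
  have sets: "sh n -` A \<in> sets p" if "A \<in> sets p" for n A
    using measurable_sets[OF sh_meas, of A n] that by (simp add: space_Min sets_p)
  have step: "emeasure p (sh (n + 1) -` A) = emeasure p (sh n -` A)" if "A \<in> sets p" for n A
  proof -
    have "sh (n + 1) -` A = Tin -` (sh n -` A)" by (simp add: vimage_def shT)
    then show ?thesis using stat sets[OF that] by (simp add: stat_prob_def)
  qed
  \<comment> \<open>The induction runs over the integers in both directions; the backward case reads
    the one-step identity at \<open>i - 1\<close>.\<close>
  have em: "emeasure p (sh n -` A) = emeasure p A" if A: "A \<in> sets p" for n A
  proof (induction n rule: int_induct[where k=0])
    case base
    show ?case by (simp add: sh_def)
  next
    case (step1 i)
    then show ?case using step[OF A, of i] by simp
  next
    case (step2 i)
    then show ?case using step[OF A, of "i - 1"] by simp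
  qed
  define X where "X = (\<Inter>n. sh n -` (- N))"
  have N': "- N \<in> sets p" using N(1) sets.compl_sets[of N p] by (auto simp: space_UNIV Compl_eq_Diff_UNIV)
  have X: "X \<in> sets p" unfolding X_def using sets[OF N'] by (intro sets.countable_INT) auto
  have inv: "Tin -` X = X"
  proof -
    have "Tin -` X = (\<Inter>n. sh (n + 1) -` (- N))" by (auto simp: X_def shT)
    also have "\<dots> = X" unfolding X_def
    proof (intro equalityI subsetI INT_I)
      fix x n assume "x \<in> (\<Inter>n. sh (n + 1) -` (- N))"
      then have "x \<in> sh (n - 1 + 1) -` (- N)" by blast
      then show "x \<in> sh n -` (- N)" by simp
    qed blast
    finally show ?thesis .
  qed
  have "AE x in p. \<forall>n. x \<notin> sh n -` N"
  proof (intro AE_all_countable[THEN iffD2] allI)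
    fix n
    have "sh n -` N \<in> null_sets p"
      using em[of N n] sets[of N n] N(1) by (auto simp: null_sets_def)
    then show "AE x in p. x \<notin> sh n -` N" by (rule AE_not_in)
  qed
  then have "AE x in p. x \<in> X" by eventually_elim (simp add: X_def)
  moreover have "P x" if "x \<in> X" for x
  proof -
    have "x \<in> sh 0 -` (- N)" using that unfolding X_def by blast
    then show ?thesis using N(2) by (auto simp: sh_def)
  qed
  ultimately show ?thesis using X inv by (auto simp: sets_p)
qed

end

text \<open>Invariance of X puts x and \<open>Tin x\<close> in the same branch, so stationarity can
  be checked branch by branch. The values of V off X are discarded, hence V has to be a state only
  on X.\<close>

lemma glue_channel:
  assumes W: "stationary_channel W" and X: "X \<in> sets Min" "Tin -` X = X"
    and meas: "\<And>L M. finite L \<Longrightarrow> (\<lambda>x. V x L M) \<in> borel_measurable Min"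
    and q: "\<And>x. x \<in> X \<Longrightarrow> qstate (V x)"
    and inv: "\<And>x L M. x \<in> X \<Longrightarrow> finite L \<Longrightarrow> V (Tin x) L M = V x (shiftset L) (kshift L M)"
  shows "stationary_channel (\<lambda>x. if x \<in> X then V x else W x)"
proof -
  have T: "Tin x \<in> X \<longleftrightarrow> x \<in> X" for x using X(2) by blast
  have "(\<lambda>x. (if x \<in> X then V x else W x) L M) \<in> borel_measurable Min" if L: "finite L" for L M
  proof -
    have "(\<lambda>x. W x L M) \<in> borel_measurable Min"
      using W L by (simp add: stationary_channel_def cqchannel_def)
    then have "(\<lambda>x. if x \<in> X then V x L M else W x L M) \<in> borel_measurable Min"
      using X(1) by (intro measurable_If_set meas[OF L]) (auto simp: space_Min)
    then show ?thesis by (simp add: if_distrib[of "\<lambda>f. f L M"])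
  qed
  then show ?thesis
    using W q inv by (simp add: stationary_channel_def cqchannel_def T)
qed

subsection \<open>Disintegration of joint states\<close>

lemma jstate_cong:
  assumes "jstate \<phi>" "jadm L F" "jadm L G" "\<And>x s t. s \<in> qconf L \<Longrightarrow> t \<in> qconf L \<Longrightarrow> F x s t = G x s t"
  shows "\<phi> L F = \<phi> L G"
  by (rule assms(1)[unfolded jstate_def, THEN conjunct1, rule_format, OF assms(2,3)]) (rule assms(4))

lemma jstate_add:
  assumes "jstate \<phi>" "jadm L F" "jadm L G"
  shows "\<phi> L (\<lambda>x s t. F x s t + c * G x s t) = \<phi> L F + c * \<phi> L G"
  by (rule assms(1)[unfolded jstate_def, THEN conjunct2, THEN conjunct1, rule_format, OF assms(2,3)])

lemma jstate_pos:
  assumes "jstate \<phi>" "jadm L F"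
  shows "cnonneg (\<phi> L (\<lambda>x. kmult L (kadj (F x)) (F x)))"
  by (rule assms(1)[unfolded jstate_def, THEN conjunct2, THEN conjunct2, THEN conjunct1, rule_format, OF assms(2)])

lemma jstate_one:
  assumes "jstate \<phi>" "finite L"
  shows "\<phi> L (\<lambda>x. kid L) = 1"
  by (rule assms(1)[unfolded jstate_def, THEN conjunct2, THEN conjunct2, THEN conjunct2, THEN conjunct1,
        rule_format, OF assms(2)])

lemma jstate_kembed:
  assumes "jstate \<phi>" "jadm L F" "finite L'" "L \<subseteq> L'"
  shows "\<phi> L' (\<lambda>x. kembed L L' (F x)) = \<phi> L F"
  by (rule assms(1)[unfolded jstate_def, THEN conjunct2, THEN conjunct2, THEN conjunct2, THEN conjunct2,
        rule_format, OF assms(2-4)])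

lemma jstate_zero:
  assumes "jstate \<phi>" "finite L"
  shows "\<phi> L (\<lambda>x s t. 0) = 0"
proof -
  have "jadm L (\<lambda>x s t. 0)" using assms(2) by (simp add: jadm_iff)
  from jstate_add[OF assms(1) this this, of 1] show ?thesis by simp
qed

lemma jadm_sum: "finite L \<Longrightarrow> (\<And>i. i \<in> I \<Longrightarrow> jadm L (G i)) \<Longrightarrow> jadm L (\<lambda>x s t. \<Sum>i\<in>I. G i x s t)"
  by (simp add: jadm_iff)

lemma jstate_sum:
  assumes \<phi>: "jstate \<phi>" and L: "finite L" and I: "finite I" and G: "\<And>i. i \<in> I \<Longrightarrow> jadm L (G i)"
  shows "\<phi> L (\<lambda>x s t. \<Sum>i\<in>I. G i x s t) = (\<Sum>i\<in>I. \<phi> L (G i))"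
  using I G
proof (induction I)
  case empty
  show ?case using jstate_zero[OF \<phi> L] by simp
next
  case (insert i I)
  have "\<phi> L (\<lambda>x s t. (\<Sum>i\<in>I. G i x s t) + 1 * G i x s t) = \<phi> L (\<lambda>x s t. \<Sum>i\<in>I. G i x s t) + 1 * \<phi> L (G i)"
    by (rule jstate_add[OF \<phi> jadm_sum[OF L]]) (use insert.prems in auto)
  then show ?case using insert by (simp add: add.commute)
qed

lemma jstate_expand:
  fixes \<phi> :: "int set \<Rightarrow> ((int \<Rightarrow> 'a) \<Rightarrow> 'h::finite kern) \<Rightarrow> complex"
  assumes \<phi>: "jstate \<phi>" and F: "jadm L F"
  shows "\<phi> L F = (\<Sum>s\<in>qconf L. \<Sum>t\<in>qconf L. \<phi> L (\<lambda>x u v. F x s t * eu s t u v))"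
proof -
  have L: "finite L" using F by (rule jadm_finite)
  let ?I = "qconf L \<times> qconf L :: ((int \<Rightarrow> 'h) \<times> (int \<Rightarrow> 'h)) set"
  let ?G = "\<lambda>i x u v. F x (fst i) (snd i) * eu (fst i) (snd i) u v"
  have G: "jadm L (?G i)" if "i \<in> ?I" for i
    using that F L by (intro jadm_scale) (auto simp: jadm_iff)
  have "\<phi> L F = \<phi> L (\<lambda>x u v. \<Sum>i\<in>?I. ?G i x u v)"
    by (rule jstate_cong[OF \<phi> F jadm_sum[OF L G]])
      (use L in \<open>simp_all add: sum.cartesian_product' sum_units\<close>)
  also have "\<dots> = (\<Sum>i\<in>?I. \<phi> L (?G i))"
    by (rule jstate_sum[OF \<phi> L _ G]) (use L in auto)
  finally show ?thesis by (simp add: sum.cartesian_product')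
qed

lemma jstate_klinear:
  fixes \<phi> :: "int set \<Rightarrow> ((int \<Rightarrow> 'a) \<Rightarrow> 'h kern) \<Rightarrow> complex"
  assumes \<phi>: "jstate \<phi>" and L: "finite L" and f: "f \<in> bdd_meas Min"
  shows "klinear L (\<lambda>M. \<phi> L (\<lambda>x s t. f x * M s t))"
  unfolding klinear_def
proof (intro conjI allI impI)
  note J = jadm_scale[OF L f]
  show "\<phi> L (\<lambda>x s t. f x * M s t) = \<phi> L (\<lambda>x s t. f x * N s t)" if "kcong L M N" for M N
    using that by (intro jstate_cong[OF \<phi> J J]) (simp add: kcong_def)
  show "\<phi> L (\<lambda>x s t. f x * (M s t + c * N s t)) = \<phi> L (\<lambda>x s t. f x * M s t) + c * \<phi> L (\<lambda>x s t. f x * N s t)"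
    for M N c
    using jstate_add[OF \<phi> J J, of M c N] by (simp add: algebra_simps)
qed

text \<open>The weight is absorbed into the observable: f M* M arises as F* F from F = sqrt f M,
  which is admissible because f is bounded.\<close>

lemma jstate_kpositive:
  fixes \<phi> :: "int set \<Rightarrow> ((int \<Rightarrow> 'a) \<Rightarrow> 'h kern) \<Rightarrow> complex"
  assumes \<phi>: "jstate \<phi>" and L: "finite L" and f: "f \<in> borel_measurable Min" "\<And>x. 0 \<le> f x" "\<And>x. f x \<le> B"
  shows "kpositive L (\<lambda>M. \<phi> L (\<lambda>x s t. complex_of_real (f x) * M s t))"
  unfolding kpositive_def
proof
  fix M :: "'h kern"
  let ?F = "\<lambda>x s t. complex_of_real (sqrt (f x)) * M s t"
  have "(\<lambda>x. complex_of_real (sqrt (f x))) \<in> bdd_meas Min"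
    using f by (intro bdd_meas_of_real[where B="sqrt B"]) auto
  then have "cnonneg (\<phi> L (\<lambda>x. kmult L (kadj (?F x)) (?F x)))"
    by (intro jstate_pos[OF \<phi>] jadm_scale[OF L])
  moreover have "kmult L (kadj (?F x)) (?F x) = (\<lambda>s t. complex_of_real (f x) * kmult L (kadj M) M s t)" for x
  proof (intro ext)
    fix s t
    have "cnj (?F x r s) * ?F x r t = complex_of_real (f x) * (cnj (M r s) * M r t)" for r
    proof -
      have "complex_of_real (sqrt (f x)) * complex_of_real (sqrt (f x)) = complex_of_real (f x)"
        using f(2)[of x] by (simp flip: of_real_mult)
      then show ?thesis by (simp add: ac_simps)
    qed
    then show "kmult L (kadj (?F x)) (?F x) s t = complex_of_real (f x) * kmult L (kadj M) M s t"
      unfolding kmult_def kadj_def sum_distrib_left by (rule sum.cong[OF refl])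
  qed
  ultimately show "cnonneg (\<phi> L (\<lambda>x s t. complex_of_real (f x) * kmult L (kadj M) M s t))" by simp
qed

lemma jstate_linear_bm:
  fixes \<phi> :: "int set \<Rightarrow> ((int \<Rightarrow> 'a) \<Rightarrow> 'h kern) \<Rightarrow> complex"
  assumes \<phi>: "jstate \<phi>" and L: "finite L"
  shows "linear_bm Min (\<lambda>f. \<phi> L (\<lambda>x s t. f x * M s t))"
  unfolding linear_bm_def
proof (intro ballI allI)
  fix f g :: "(int \<Rightarrow> 'a) \<Rightarrow> complex" and c
  assume "f \<in> bdd_meas Min" "g \<in> bdd_meas Min"
  then have "\<phi> L (\<lambda>x s t. f x * M s t + c * (g x * M s t)) = \<phi> L (\<lambda>x s t. f x * M s t) + c * \<phi> L (\<lambda>x s t. g x * M s t)"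
    by (intro jstate_add[OF \<phi>] jadm_scale[OF L])
  then show "\<phi> L (\<lambda>x s t. (f x + c * g x) * M s t) = \<phi> L (\<lambda>x s t. f x * M s t) + c * \<phi> L (\<lambda>x s t. g x * M s t)"
    by (simp add: algebra_simps)
qed

text \<open>The observable f times the identity on L is the embedding of f times the identity on the
  empty window, so the restriction of \<phi> to functions of the input can be read off at any
  window.\<close>

lemma jstate_kid:
  fixes \<phi> :: "int set \<Rightarrow> ((int \<Rightarrow> 'a) \<Rightarrow> 'h kern) \<Rightarrow> complex"
  assumes \<phi>: "jstate \<phi>" and L: "finite L" and f: "f \<in> bdd_meas Min"
  shows "\<phi> L (\<lambda>x s t. f x * kid L s t) = \<phi> {} (\<lambda>x s t. f x * kid {} s t)"
proof -
  let ?F = "\<lambda>x s t. f x * kid {} s t"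
  have eq: "kembed {} L (?F x) s t = f x * kid L s t" if "s \<in> qconf L" "t \<in> qconf L" for x s t
    using that by (simp add: kembed_def kid_def)
  have J: "jadm {} ?F" by (rule jadm_scale) (use f in auto)
  have "jadm L (\<lambda>x. kembed {} L (?F x))"
    using L f by (simp add: jadm_iff eq)
  then have "\<phi> L (\<lambda>x s t. f x * kid L s t) = \<phi> L (\<lambda>x. kembed {} L (?F x))"
    by (intro jstate_cong[OF \<phi> jadm_scale[OF L f]]) (simp_all add: eq)
  also have "\<dots> = \<phi> {} ?F"
    by (rule jstate_kembed[OF \<phi> J L]) simp
  finally show ?thesis .
qed

context stationary_measure
begin

text \<open>The empty window carries a one-dimensional algebra, so its joint observables are just
  functions of the input; the condition fixes the input marginal of \<phi> to be p.\<close>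

definition marginal :: "(int set \<Rightarrow> ((int \<Rightarrow> 'a) \<Rightarrow> 'h kern) \<Rightarrow> complex) \<Rightarrow> bool" where
  "marginal \<phi> \<longleftrightarrow> (\<forall>f B. f \<in> borel_measurable Min \<longrightarrow> (\<forall>x. 0 \<le> f x) \<longrightarrow> (\<forall>x. f x \<le> B) \<longrightarrow>
     \<phi> {} (\<lambda>x s t. complex_of_real (f x) * kid {} s t) = complex_of_real (\<integral>x. f x \<partial>p))"

lemma marginal_kid:
  assumes \<phi>: "jstate \<phi>" and marg: "marginal \<phi>" and L: "finite L"
    and f: "f \<in> borel_measurable Min" "\<And>x. 0 \<le> f x" "\<And>x. f x \<le> B"
  shows "\<phi> L (\<lambda>x s t. complex_of_real (f x) * kid L s t) = complex_of_real (\<integral>x. f x \<partial>p)"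
proof -
  have "(\<lambda>x. complex_of_real (f x)) \<in> bdd_meas Min"
    using f by (intro bdd_meas_of_real[where B=B]) auto
  from jstate_kid[OF \<phi> L this] show ?thesis using marg f by (auto simp: marginal_def)
qed

text \<open>For a fixed nonnegative f the functional sending M to the value of \<phi> at f times M
  is positive, so its matrix entries are bounded by its value at the identity, which is the integral
  of f. This is the domination behind the density, with constant 1.\<close>

lemma unit_density:
  fixes \<phi> :: "int set \<Rightarrow> ((int \<Rightarrow> 'a) \<Rightarrow> 'h::finite kern) \<Rightarrow> complex"
  assumes \<phi>: "jstate \<phi>" and marg: "marginal \<phi>" and L: "finite L"
    and st: "s \<in> qconf L" "t \<in> qconf L"
  shows "\<exists>g. integrable p g \<and> (\<forall>f\<in>bdd_meas p. \<phi> L (\<lambda>x u v. f x * eu s t u v) = (\<integral>x. f x * g x \<partial>p))"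
proof (rule functional_density[OF space_UNIV])
  show "linear_bm p (\<lambda>f. \<phi> L (\<lambda>x u v. f x * eu s t u v))"
    using jstate_linear_bm[OF \<phi> L] by (simp add: linear_bm_def bdd_meas_p)
  fix f :: "(int \<Rightarrow> 'a) \<Rightarrow> real" and B assume f: "f \<in> borel_measurable p" "\<And>x. 0 \<le> f x" "\<And>x. f x \<le> B"
  have f': "f \<in> borel_measurable Min" using f(1) by (simp add: measurable_cong_sets[OF sets_p refl])
  have b: "(\<lambda>x. complex_of_real (f x)) \<in> bdd_meas Min"
    using f f' by (intro bdd_meas_of_real[where B=B]) auto
  show "norm (\<phi> L (\<lambda>x u v. complex_of_real (f x) * eu s t u v)) \<le> 1 * (\<integral>x. f x \<partial>p)"
    using kpositive_unit_bound[OF jstate_klinear[OF \<phi> L b] jstate_kpositive[OF \<phi> L f' f(2,3)] L st]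
    by (simp add: marginal_kid[OF \<phi> marg L f' f(2,3)])
qed

text \<open>The densities of all matrix units are assembled, for each x, into functionals on all
  windows. Integrated over an arbitrary set A, each requirement on a channel turns into the
  corresponding property of \<phi>, and so it holds almost surely; countability then leaves one null
  set for all requirements.\<close>

theorem disintegration:
  fixes \<phi> :: "int set \<Rightarrow> ((int \<Rightarrow> 'a) \<Rightarrow> 'h::finite kern) \<Rightarrow> complex"
    and W :: "(int \<Rightarrow> 'a) \<Rightarrow> int set \<Rightarrow> 'h kern \<Rightarrow> complex"
  assumes \<phi>: "jstate \<phi>" and stat\<phi>: "jstationary \<phi>" and marg: "marginal \<phi>"
    and W: "stationary_channel W"
  shows "\<exists>V. stationary_channel V \<and> (\<forall>L F. jadm L F \<longrightarrow> \<phi> L F = psi p V L F)"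
proof -
  define G where "G L s t = (SOME g. integrable p g \<and>
     (\<forall>f\<in>bdd_meas p. \<phi> L (\<lambda>x u v. f x * eu s t u v) = (\<integral>x. f x * g x \<partial>p)))" for L s t
  have G: "integrable p (G L s t)"
    "f \<in> bdd_meas p \<Longrightarrow> \<phi> L (\<lambda>x u v. f x * eu s t u v) = (\<integral>x. f x * G L s t x \<partial>p)"
    if "finite L" "s \<in> qconf L" "t \<in> qconf L" for L s t f
    using someI_ex[OF unit_density[OF \<phi> marg that]] unfolding G_def by auto
  define \<omega> where "\<omega> x L M = (\<Sum>s\<in>qconf L. \<Sum>t\<in>qconf L. M s t * G L s t x)" for x L M
  have lin: "klinear L (\<omega> x L)" for x L
    unfolding \<omega>_def by (rule klinear_weighted_sum)
  have int: "integrable p (\<lambda>x. \<omega> x L (F x))" if F: "jadm L F" for L F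
    unfolding \<omega>_def using F
    by (intro Bochner_Integration.integrable_sum integrable_bdd_meas_mult G(1) jadm_finite[OF F])
      (auto simp: jadm_iff bdd_meas_p)
  have repr: "\<phi> L F = (\<integral>x. \<omega> x L (F x) \<partial>p)" if F: "jadm L F" for L F
  proof -
    have L: "finite L" using F by (rule jadm_finite)
    have b: "(\<lambda>x. F x s t) \<in> bdd_meas p" if "s \<in> qconf L" "t \<in> qconf L" for s t
      using F that by (simp add: jadm_iff bdd_meas_p)
    have i: "integrable p (\<lambda>x. F x s t * G L s t x)" if "s \<in> qconf L" "t \<in> qconf L" for s t
      using that by (intro integrable_bdd_meas_mult b G(1) L)
    have "\<phi> L F = (\<Sum>s\<in>qconf L. \<Sum>t\<in>qconf L. \<integral>x. F x s t * G L s t x \<partial>p)"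
      unfolding jstate_expand[OF \<phi> F] using b by (intro sum.cong refl G(2)[OF L]) auto
    also have "\<dots> = (\<Sum>s\<in>qconf L. \<integral>x. (\<Sum>t\<in>qconf L. F x s t * G L s t x) \<partial>p)"
      using i by (intro sum.cong refl Bochner_Integration.integral_sum[symmetric])
    also have "\<dots> = (\<integral>x. \<omega> x L (F x) \<partial>p)"
      unfolding \<omega>_def using i by (intro Bochner_Integration.integral_sum[symmetric] Bochner_Integration.integrable_sum)
    finally show ?thesis .
  qed
  have int_const: "integrable p (\<lambda>x. \<omega> x L M)" if "finite L" for L M
  proof -
    have "jadm L (\<lambda>x. M)" using that by (simp add: jadm_iff)
    then show ?thesis by (rule int)
  qed
  have scale: "\<omega> x L (\<lambda>s t. c * M s t) = c * \<omega> x L M" for x L c M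
    by (simp add: \<omega>_def sum_distrib_left mult.assoc)
  have repr_ind: "(\<integral>x. f x * \<omega> x L M \<partial>p) = \<phi> L (\<lambda>x s t. f x * M s t)"
    if "finite L" "f \<in> bdd_meas p" for L M f
    using that repr[OF jadm_scale, of L f M] by (simp add: scale bdd_meas_p)
  have pos: "AE x in p. \<forall>L\<in>Collect finite. \<forall>K\<in>rat_kernels L. cnonneg (\<omega> x L (kmult L (kadj K) K))"
  proof (rule AE_ball_countable[THEN iffD2, OF countable_Collect_finite], rule ballI)
    fix L :: "int set" assume "L \<in> Collect finite"
    then have L: "finite L" by simp
    show "AE x in p. \<forall>K\<in>rat_kernels L. cnonneg (\<omega> x L (kmult L (kadj K) K))"
    proof (rule AE_ball_countable[THEN iffD2, OF countable_rat_kernels[OF L]], rule ballI)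
      fix K :: "'h kern"
      show "AE x in p. cnonneg (\<omega> x L (kmult L (kadj K) K))"
      proof (rule AE_cnonneg[OF int_const[OF L]])
        fix A assume A: "A \<in> sets p"
        have "kpositive L (\<lambda>M. \<phi> L (\<lambda>x s t. complex_of_real (indicator A x) * M s t))"
          using A by (intro jstate_kpositive[OF \<phi> L, where B=1]) (auto simp: sets_p)
        then show "cnonneg (\<integral>x. complex_of_real (indicator A x) * \<omega> x L (kmult L (kadj K) K) \<partial>p)"
          by (simp add: repr_ind[OF L bdd_meas_indicator[OF A]] kpositive_def)
      qed
    qed
  qed
  have one: "AE x in p. \<forall>L\<in>Collect finite. \<omega> x L (kid L) = 1"
  proof (rule AE_ball_countable[THEN iffD2, OF countable_Collect_finite], rule ballI)
    fix L :: "int set" assume "L \<in> Collect finite"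
    then have L: "finite L" by simp
    have "AE x in p. \<omega> x L (kid L) - 1 = 0"
    proof (rule AE_zero)
      show "integrable p (\<lambda>x. \<omega> x L (kid L) - 1)" using int_const[OF L] by simp
      fix A assume A: "A \<in> sets p"
      note bi = bdd_meas_indicator[OF A]
      have "(\<integral>x. complex_of_real (indicator A x) * \<omega> x L (kid L) \<partial>p)
          = complex_of_real (\<integral>x. indicator A x \<partial>p)"
        unfolding repr_ind[OF L bi] using A
        by (intro marginal_kid[OF \<phi> marg L, where B=1]) (auto simp: sets_p)
      then show "(\<integral>x. complex_of_real (indicator A x) * (\<omega> x L (kid L) - 1) \<partial>p) = 0"
        using integrable_bdd_meas_mult[OF bi int_const[OF L]] integrable_bdd_meas[OF bi]
        by (simp add: right_diff_distrib)
    qed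
    then show "AE x in p. \<omega> x L (kid L) = 1" by simp
  qed
  have embed: "AE x in p. \<forall>L. finite L \<longrightarrow> (\<forall>s\<in>qconf L. \<forall>t\<in>qconf L. \<forall>L'\<in>{L'. finite L' \<and> L \<subseteq> L'}.
      \<omega> x L' (kembed L L' (eu s t)) = \<omega> x L (eu s t))"
  proof (rule AE_units, rule AE_ball_countable[THEN iffD2], rule countable_subset[OF _ countable_Collect_finite], blast, rule ballI)
    fix L L' :: "int set" and s t :: "int \<Rightarrow> 'h" assume L: "finite L" and "L' \<in> {L'. finite L' \<and> L \<subseteq> L'}"
    then have L': "finite L'" "L \<subseteq> L'" by auto
    have "AE x in p. \<omega> x L' (kembed L L' (eu s t)) - \<omega> x L (eu s t) = 0"
    proof (rule AE_zero)
      show "integrable p (\<lambda>x. \<omega> x L' (kembed L L' (eu s t)) - \<omega> x L (eu s t))"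
        using int_const[OF L] int_const[OF L'(1)] by simp
      fix A assume A: "A \<in> sets p"
      let ?i = "\<lambda>x. complex_of_real (indicator A x)"
      note bi = bdd_meas_indicator[OF A]
      have "(\<lambda>x s' t'. ?i x * kembed L L' (eu s t) s' t')
        = (\<lambda>x. kembed L L' (\<lambda>s' t'. ?i x * eu s t s' t'))"
        by (simp add: kembed_def mult.assoc)
      then have "\<phi> L' (\<lambda>x s' t'. ?i x * kembed L L' (eu s t) s' t') = \<phi> L (\<lambda>x s' t'. ?i x * eu s t s' t')"
        using jstate_kembed[OF \<phi> jadm_scale[OF L bi[unfolded bdd_meas_p]] L'] by simp
      then have "(\<integral>x. ?i x * \<omega> x L' (kembed L L' (eu s t)) \<partial>p) = (\<integral>x. ?i x * \<omega> x L (eu s t) \<partial>p)"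
        by (simp only: repr_ind[OF L bi] repr_ind[OF L'(1) bi])
      then show "(\<integral>x. ?i x * (\<omega> x L' (kembed L L' (eu s t)) - \<omega> x L (eu s t)) \<partial>p) = 0"
        using integrable_bdd_meas_mult[OF bi int_const[OF L]] integrable_bdd_meas_mult[OF bi int_const[OF L'(1)]]
        by (simp add: right_diff_distrib)
    qed
    then show "AE x in p. \<omega> x L' (kembed L L' (eu s t)) = \<omega> x L (eu s t)" by simp
  qed
  have shift: "AE x in p. \<forall>L. finite L \<longrightarrow> (\<forall>s\<in>qconf L. \<forall>t\<in>qconf L.
      \<omega> (Tin x) L (eu s t) = \<omega> x (shiftset L) (kshift L (eu s t)))"
  proof (rule AE_units)
    fix L :: "int set" and s t :: "int \<Rightarrow> 'h" assume L: "finite L"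
    note L' = finite_shiftset[OF L]
    have intT: "integrable p (\<lambda>x. \<omega> (Tin x) L (eu s t))"
      using integrable_distr[OF T_meas, of "\<lambda>x. \<omega> x L (eu s t)"] int_const[OF L] by (simp add: T_inv)
    have "AE x in p. \<omega> (Tin x) L (eu s t) - \<omega> x (shiftset L) (kshift L (eu s t)) = 0"
    proof (rule AE_zero)
      show "integrable p (\<lambda>x. \<omega> (Tin x) L (eu s t) - \<omega> x (shiftset L) (kshift L (eu s t)))"
        using intT int_const[OF L'] by simp
      fix A assume A: "A \<in> sets p"
      \<comment> \<open>R is the inverse shift: the indicator of A is that of its preimage under R,
        composed with \<open>Tin\<close>. The whole integrand is then a function of
        \<open>Tin x\<close>, so invariance of p removes the shift before stationarity of \<phi>
        brings it back on the output side.\<close>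
      define R where "R x = (\<lambda>n. x (n - 1))" for x :: "int \<Rightarrow> 'a"
      have R: "R (Tin x) = x" for x by (simp add: R_def Tin_def)
      have Rm: "R \<in> measurable Min Min"
        unfolding R_def[abs_def] using measurable_shift[of "-1"] by simp
      have A': "R -` A \<in> sets p"
        using measurable_sets[OF Rm, of A] A by (simp add: sets_p space_Min)
      let ?i = "\<lambda>x. complex_of_real (indicator A x)" and ?j = "\<lambda>x. complex_of_real (indicator (R -` A) x)"
      note bi = bdd_meas_indicator[OF A] and bj = bdd_meas_indicator[OF A']
      have ji: "?j (Tin x) = ?i x" for x by (simp add: indicator_def R)
      have "(\<integral>x. ?i x * \<omega> (Tin x) L (eu s t) \<partial>p) = (\<integral>x. ?j (Tin x) * \<omega> (Tin x) L (eu s t) \<partial>p)"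
        by (simp only: ji)
      also have "\<dots> = (\<integral>x. ?j x * \<omega> x L (eu s t) \<partial>p)"
        by (rule integral_T[OF borel_measurable_integrable[OF integrable_bdd_meas_mult[OF bj int_const[OF L]]]])
      also have "\<dots> = \<phi> L (\<lambda>x u v. ?j x * eu s t u v)"
        by (rule repr_ind[OF L bj])
      also have "\<dots> = \<phi> (shiftset L) (\<lambda>x. kshift L (\<lambda>u v. ?j (Tin x) * eu s t u v))"
        by (rule stat\<phi>[unfolded jstationary_def, rule_format, OF jadm_scale[OF L bj[unfolded bdd_meas_p]], symmetric])
      also have "(\<lambda>x. kshift L (\<lambda>u v. ?j (Tin x) * eu s t u v)) = (\<lambda>x u v. ?i x * kshift L (eu s t) u v)"
        by (simp only: ji kshift_def)
      also have "\<phi> (shiftset L) \<dots> = (\<integral>x. ?i x * \<omega> x (shiftset L) (kshift L (eu s t)) \<partial>p)"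
        by (rule repr_ind[OF L' bi, symmetric])
      finally show "(\<integral>x. ?i x * (\<omega> (Tin x) L (eu s t) - \<omega> x (shiftset L) (kshift L (eu s t))) \<partial>p) = 0"
        using integrable_bdd_meas_mult[OF bi intT] integrable_bdd_meas_mult[OF bi int_const[OF L']]
        by (simp add: right_diff_distrib)
    qed
    then show "AE x in p. \<omega> (Tin x) L (eu s t) = \<omega> x (shiftset L) (kshift L (eu s t))" by simp
  qed
  have "AE x in p. qstate (\<omega> x) \<and> (\<forall>L M. finite L \<longrightarrow> \<omega> (Tin x) L M = \<omega> x (shiftset L) (kshift L M))"
    using pos one embed shift
  proof eventually_elim
    case (elim x)
    have "qstate (\<omega> x)"
    proof (rule qstateI)
      fix L :: "int set" assume L: "finite L"
      show "kpositive L (\<omega> x L)" by (rule kpositive_rat[OF lin L]) (rule elim(1)[rule_format], simp_all add: L)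
      show "\<omega> x L (kid L) = 1" using elim(2) L by simp
    next
      fix L L' :: "int set" and M assume L': "finite L'" "L \<subseteq> L'"
      then have L: "finite L" by (rule finite_subset[rotated])
      show "\<omega> x L' (kembed L L' M) = \<omega> x L M"
        by (rule klinear_eqI[OF klinear_kembed[OF lin] lin L]) (rule elim(3)[rule_format], simp_all add: L L')
    qed (rule lin)
    moreover have "\<omega> (Tin x) L M = \<omega> x (shiftset L) (kshift L M)" if L: "finite L" for L M
      by (rule klinear_eqI[OF lin klinear_kshift[OF lin] L]) (rule elim(4)[rule_format], simp_all add: L)
    ultimately show ?case by blast
  qed
  from invariant_core[OF this] obtain X where X: "X \<in> sets Min" "Tin -` X = X" "AE x in p. x \<in> X"
    and q: "\<And>x. x \<in> X \<Longrightarrow> qstate (\<omega> x)"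
    and inv: "\<And>x L M. x \<in> X \<Longrightarrow> finite L \<Longrightarrow> \<omega> (Tin x) L M = \<omega> x (shiftset L) (kshift L M)"
    by blast
  \<comment> \<open>Off X the densities need not form a state, and W supplies a stationary channel
    there; as X has full measure, the joint state does not notice.\<close>
  let ?V = "\<lambda>x. if x \<in> X then \<omega> x else W x"
  have V: "stationary_channel ?V"
  proof (rule glue_channel[where V=\<omega>, OF W X(1,2)])
    show "(\<lambda>x. \<omega> x L M) \<in> borel_measurable Min" if "finite L" for L M
      using borel_measurable_integrable[OF int_const[OF that]] by (simp add: measurable_cong_sets[OF sets_p refl])
  qed (rule q inv; assumption)+
  have "\<phi> L F = psi p ?V L F" if F: "jadm L F" for L F
    unfolding repr[OF F] psi_def
  proof (rule integral_cong_AE)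
    show "AE x in p. \<omega> x L (F x) = ?V x L (F x)" using X(3) by eventually_elim simp
    have "kchannel ?V" using V by (simp add: stationary_channel_def cqchannel_kchannel)
    then show "(\<lambda>x. ?V x L (F x)) \<in> borel_measurable p"
      by (rule borel_measurable_integrable[OF integrable_kchannel[OF _ F]])
  qed (rule borel_measurable_integrable[OF int[OF F]])
  with V show ?thesis by blast
qed

end

subsection \<open>Extreme and ergodic channels\<close>

context stationary_measure
begin

text \<open>The sets where the limit lies strictly below or strictly above the mean are invariant,
  so by ergodicity each has measure 0 or 1. Measure 1 would push the integral of the limit away from
  the mean, which it equals.\<close>

lemma ergodic_average:
  assumes erg: "ergodic_prob p"
    and f [measurable]: "f \<in> borel_measurable p" and B: "\<And>x. \<bar>f x\<bar> \<le> B"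
  shows "AE x in p. (\<lambda>n. birk f n x / real n) \<longlonglongrightarrow> (\<integral>x. f x \<partial>p)"
proof -
  define u where "u x = lim (\<lambda>n. birk f n x / real n)" for x
  let ?c = "\<integral>x. f x \<partial>p"
  have conv: "AE x in p. (\<lambda>n. birk f n x / real n) \<longlonglongrightarrow> u x"
    using birkhoff[OF f B] by eventually_elim (simp add: u_def convergent_LIMSEQ_iff)
  have um [measurable]: "u \<in> borel_measurable p" unfolding u_def by measurable
  \<comment> \<open>This includes points where the averages diverge, since \<open>lim\<close>
    depends only on which numbers are limits. \<open>ergodic_prob\<close> speaks of exactly
    invariant sets, so an almost sure identity would not do here.\<close>
  have uT: "u (Tin x) = u x" for x
    unfolding u_def lim_def avg_lim_shift_iff[where f=f and B=B, OF B] ..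
  have B0: "0 \<le> B" using B[of undefined] by linarith
  have bd: "\<bar>birk f n x / real n\<bar> \<le> B" for n x
    using birk_bound[where f=f and B=B and n=n and x=x, OF B] B0 by (cases "n = 0") (auto simp: field_simps)
  have "AE x in p. norm (u x) \<le> B"
    using conv
  proof eventually_elim
    case (elim x)
    from tendsto_norm[OF elim] show ?case
      by (rule LIMSEQ_le_const2) (use bd in \<open>auto simp del: abs_divide\<close>)
  qed
  then have uint: "integrable p u" by (rule integrable_const_bound) measurable
  have uc: "(\<integral>x. u x \<partial>p) = ?c"
    using integral_lim_avg[where f=f and B=B and g=u and J=UNIV, OF f B _ _ um conv] sets.top[of p]
    by (simp add: space_UNIV)
  \<comment> \<open>The choice s = 1 gives the set below the mean and s = -1 the set above
    it.\<close>
  have zero: "prob J = 0"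
    if J: "J = {x. s * u x < s * ?c}" and s: "s \<noteq> 0" for s :: real and J
  proof -
    have "{x\<in>space p. s * u x < s * ?c} \<in> sets p" by measurable
    then have Jm: "J \<in> sets p" by (simp add: J space_UNIV)
    have "Tin -` J = J" by (auto simp: J uT)
    then have "prob J = 0 \<or> prob J = 1"
      using erg Jm by (auto simp: ergodic_prob_def sets_p emeasure_eq_measure)
    moreover have False if "prob J = 1"
    proof -
      have AE: "AE x in p. x \<in> J" using that by (rule AE_prob_1)
      let ?h = "\<lambda>x. s * ?c - s * u x"
      have "integrable p ?h" using uint by simp
      moreover have "AE x in p. 0 \<le> ?h x" using AE by eventually_elim (simp add: J)
      moreover have "(\<integral>x. ?h x \<partial>p) = 0"
        using uint prob_space by (simp add: uc)
      ultimately have "AE x in p. ?h x = 0"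
        using integral_nonneg_eq_0_iff_AE by blast
      with AE have "AE x in p. False" by eventually_elim (simp add: J)
      then show False by simp
    qed
    ultimately show ?thesis by blast
  qed
  have ne: "AE x in p. x \<notin> {x. s * u x < s * ?c}" if s: "s \<noteq> 0" for s
  proof -
    have "{x\<in>space p. s * u x < s * ?c} \<in> sets p" by measurable
    then have "{x. s * u x < s * ?c} \<in> null_sets p"
      using zero[OF refl s] by (simp add: null_sets_def space_UNIV emeasure_eq_measure)
    then show ?thesis by (rule AE_not_in)
  qed
  have neg_one_neq: "(- 1 :: real) \<noteq> 0" by simp
  show ?thesis
    using conv ne[of 1, OF one_neq_zero] ne[of "-1", OF neg_one_neq]
  proof eventually_elim
    case (elim x)
    then have "u x = ?c" by simp
    with elim(1) show ?case by simp
  qed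
qed

text \<open>Domination gives the marginal a density g of integral 1. By stationarity f may be
  replaced by its orbit averages, which converge to the constant integral of f by ergodicity, and
  integrating a constant against g returns it.\<close>

lemma dominated_marginal:
  fixes \<phi> :: "int set \<Rightarrow> ((int \<Rightarrow> 'a) \<Rightarrow> 'h::finite kern) \<Rightarrow> complex"
  assumes erg: "ergodic_prob p" and \<phi>: "jstate \<phi>" and stat\<phi>: "jstationary \<phi>"
    and dom: "\<And>f B. f \<in> borel_measurable Min \<Longrightarrow> (\<And>x. 0 \<le> f x) \<Longrightarrow> (\<And>x. f x \<le> B) \<Longrightarrow>
      Re (\<phi> {} (\<lambda>x s t. complex_of_real (f x) * kid {} s t)) \<le> C * (\<integral>x. f x \<partial>p)"
  shows "marginal \<phi>"
proof -
  let ?\<Lambda> = "\<lambda>f. \<phi> {} (\<lambda>x s t. f x * kid {} s t)"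
  have kid1: "kid {} s t = 1" if "s \<in> qconf {}" "t \<in> qconf {}" for s t :: "int \<Rightarrow> 'h"
    using that by (simp add: qconf_def kid_def)
  have meas: "f \<in> borel_measurable Min \<longleftrightarrow> f \<in> borel_measurable p" for f :: "(int \<Rightarrow> 'a) \<Rightarrow> real"
    by (simp add: measurable_cong_sets[OF sets_p refl])
  have pos: "cnonneg (?\<Lambda> (\<lambda>x. complex_of_real (f x)))"
    if f: "f \<in> borel_measurable Min" "\<And>x. 0 \<le> f x" "\<And>x. f x \<le> B" for f B
  proof -
    have b: "(\<lambda>x. complex_of_real (f x)) \<in> bdd_meas Min"
      using f by (intro bdd_meas_of_real[where B=B]) auto
    note lin = jstate_klinear[OF \<phi> finite.emptyI b]
    \<comment> \<open>On a window with a single configuration the rank-one kernel built from k = 1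
      is the identity, so positivity on squares becomes positivity on functions of the
      input.\<close>
    have "cnonneg (\<phi> {} (\<lambda>x s t. complex_of_real (f x) * (cnj 1 * 1)))"
      by (rule kpositive_rank_one[OF lin jstate_kpositive[OF \<phi> finite.emptyI f] finite.emptyI])
    moreover have "\<phi> {} (\<lambda>x s t. complex_of_real (f x) * (cnj 1 * 1)) = ?\<Lambda> (\<lambda>x. complex_of_real (f x))"
      by (rule klinear_cong[OF lin]) (simp add: kcong_def kid1)
    ultimately show ?thesis by simp
  qed
  have "\<exists>g. integrable p g \<and> (\<forall>f\<in>bdd_meas p. ?\<Lambda> f = (\<integral>x. f x * g x \<partial>p))"
  proof (rule functional_density[OF space_UNIV, where C=C])
    show "linear_bm p ?\<Lambda>"
      using jstate_linear_bm[OF \<phi> finite.emptyI] by (simp add: linear_bm_def bdd_meas_p)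
    fix f :: "(int \<Rightarrow> 'a) \<Rightarrow> real" and B assume f: "f \<in> borel_measurable p" "\<And>x. 0 \<le> f x" "\<And>x. f x \<le> B"
    have f': "f \<in> borel_measurable Min" using f(1) by (simp add: meas)
    have "norm (?\<Lambda> (\<lambda>x. complex_of_real (f x))) = Re (?\<Lambda> (\<lambda>x. complex_of_real (f x)))"
      using pos[OF f' f(2,3)] by (simp add: cnonneg_def cmod_eq_Re)
    then show "norm (?\<Lambda> (\<lambda>x. complex_of_real (f x))) \<le> C * (\<integral>x. f x \<partial>p)"
      using dom[OF f' f(2,3)] by simp
  qed
  then obtain g where g: "integrable p g" and dens: "\<And>f. f \<in> bdd_meas p \<Longrightarrow> ?\<Lambda> f = (\<integral>x. f x * g x \<partial>p)"
    by blast
  have inv: "?\<Lambda> (\<lambda>x. f (Tin x)) = ?\<Lambda> f" if f: "f \<in> bdd_meas Min" "(\<lambda>x. f (Tin x)) \<in> bdd_meas Min" for f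
  proof -
    note J = jadm_scale[OF finite.emptyI f(1), of "kid {}"]
    have se: "shiftset {} = {}" by (simp add: shiftset_def)
    have eq: "kshift {} (\<lambda>s t. f (Tin x) * kid {} s t) s t = f (Tin x)" for x s t
      by (simp add: kshift_def kid_def restrict_def)
    have "?\<Lambda> (\<lambda>x. f (Tin x)) = \<phi> {} (\<lambda>x. kshift {} (\<lambda>s t. f (Tin x) * kid {} s t))"
    proof (rule jstate_cong[OF \<phi> jadm_scale[OF finite.emptyI f(2)]])
      show "jadm {} (\<lambda>x. kshift {} (\<lambda>s t. f (Tin x) * kid {} s t))"
        using f(2) by (simp add: jadm_iff eq)
    qed (simp add: eq kid1)
    also have "\<dots> = ?\<Lambda> f"
      using stat\<phi>[unfolded jstationary_def, rule_format, OF J] by (simp only: se)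
    finally show ?thesis .
  qed
  have one: "(\<integral>x. g x \<partial>p) = 1"
    using dens[of "\<lambda>_. 1"] jstate_one[OF \<phi> finite.emptyI] by simp
  have "?\<Lambda> (\<lambda>x. complex_of_real (f x)) = complex_of_real (\<integral>x. f x \<partial>p)"
    if f: "f \<in> borel_measurable Min" "\<And>x. 0 \<le> f x" "\<And>x. f x \<le> B" for f B
  proof -
    have fp [measurable]: "f \<in> borel_measurable p" using f(1) by (simp add: meas)
    have fB: "\<bar>f x\<bar> \<le> B" for x using f(2,3) by simp
    let ?f = "\<lambda>k x. complex_of_real (f ((Tin ^^ k) x))"
    have bk: "?f k \<in> bdd_meas p" for k
      by (rule bdd_meas_of_real[where B=B]) (measurable, rule fB)
    have k: "?\<Lambda> (?f k) = ?\<Lambda> (?f 0)" for k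
    proof (induction k)
      case (Suc k)
      have "?\<Lambda> (?f (Suc k)) = ?\<Lambda> (\<lambda>x. ?f k (Tin x))" by (simp add: funpow_swap1)
      also have "\<dots> = ?\<Lambda> (?f k)"
        using bk[of k] bk[of "Suc k"] by (intro inv) (simp_all add: bdd_meas_p funpow_swap1)
      finally show ?case using Suc by simp
    qed simp
    have avg: "(\<integral>x. complex_of_real (birk f n x / real n) * g x \<partial>p) = ?\<Lambda> (?f 0)" if n: "0 < n" for n
    proof -
      have "(\<integral>x. complex_of_real (birk f n x / real n) * g x \<partial>p)
          = (\<integral>x. (\<Sum>k<n. ?f k x * g x) / complex_of_nat n \<partial>p)"
        by (simp add: birk_def sum_distrib_right)
      also have "\<dots> = (\<integral>x. (\<Sum>k<n. ?f k x * g x) \<partial>p) / complex_of_nat n"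
        by (rule integral_divide_zero)
      also have "(\<integral>x. (\<Sum>k<n. ?f k x * g x) \<partial>p) = (\<Sum>k<n. \<integral>x. ?f k x * g x \<partial>p)"
        by (rule Bochner_Integration.integral_sum) (rule integrable_bdd_meas_mult[OF bk g])
      also have "\<dots> = (\<Sum>k<n. ?\<Lambda> (?f 0))"
        by (rule sum.cong[OF refl]) (rule trans[OF dens[OF bk, symmetric] k])
      finally show ?thesis using n by simp
    qed
    have B0: "0 \<le> B" using fB[of undefined] by linarith
    have bd: "\<bar>birk f n x / real n\<bar> \<le> B" for n x
      using birk_bound[where f=f and B=B and n=n and x=x, OF fB] B0 by (cases "n = 0") (auto simp: field_simps)
    note [measurable] = borel_measurable_integrable[OF g]
    have "(\<lambda>n. \<integral>x. complex_of_real (birk f n x / real n) * g x \<partial>p)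
        \<longlonglongrightarrow> (\<integral>x. complex_of_real (\<integral>x. f x \<partial>p) * g x \<partial>p)"
    proof (rule integral_dominated_convergence[where w="\<lambda>x. B * norm (g x)"])
      show "integrable p (\<lambda>x. B * norm (g x))" using g by simp
      show "AE x in p. (\<lambda>n. complex_of_real (birk f n x / real n) * g x)
          \<longlonglongrightarrow> complex_of_real (\<integral>x. f x \<partial>p) * g x"
        using ergodic_average[OF erg fp fB]
        by eventually_elim (intro tendsto_mult tendsto_of_real tendsto_const)
      show "AE x in p. norm (complex_of_real (birk f n x / real n) * g x) \<le> B * norm (g x)" for n
        unfolding norm_mult norm_of_real by (intro AE_I2 mult_right_mono bd norm_ge_zero)
    qed measurable
    moreover have "(\<lambda>n. \<integral>x. complex_of_real (birk f n x / real n) * g x \<partial>p) \<longlonglongrightarrow> ?\<Lambda> (?f 0)"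
      by (rule tendsto_eventually, rule eventually_mono[OF eventually_gt_at_top[of 0]]) (rule avg)
    ultimately have "?\<Lambda> (?f 0) = (\<integral>x. complex_of_real (\<integral>x. f x \<partial>p) * g x \<partial>p)"
      by (rule LIMSEQ_unique[rotated])
    then show ?thesis by (simp add: one)
  qed
  then show ?thesis unfolding marginal_def by blast
qed

lemma psi_kid:
  fixes W :: "(int \<Rightarrow> 'a) \<Rightarrow> int set \<Rightarrow> 'h::finite kern \<Rightarrow> complex"
  assumes W: "cqchannel W"
  shows "psi p W {} (\<lambda>x s t. complex_of_real (f x) * kid {} s t) = complex_of_real (\<integral>x. f x \<partial>p)"
proof -
  have "W x {} (\<lambda>s t. c * kid {} s t) = c" for x c
  proof -
    note lin = qstate_klinear[OF cqchannel_qstate[OF W] finite.emptyI, of x]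
    show ?thesis
      using klinear_add[OF lin, of "\<lambda>_ _. 0" c "kid {}"] klinear_0[OF lin]
        qstate_kid[OF cqchannel_qstate[OF W] finite.emptyI, of x] by simp
  qed
  then show ?thesis by (simp add: psi_def)
qed

text \<open>Positivity of the other summand leaves t times \<phi> below the joint state on
  nonnegative functions of the input, which is domination of the marginal by 1/t times p.\<close>

lemma summand_marginal:
  fixes W :: "(int \<Rightarrow> 'a) \<Rightarrow> int set \<Rightarrow> 'h::finite kern \<Rightarrow> complex"
  assumes erg: "ergodic_prob p" and W: "cqchannel W"
    and \<phi>: "jstate \<phi>" "jstationary \<phi>" and \<phi>': "jstate \<phi>'" and t: "0 < t" "t < 1"
    and eq: "\<And>L F. jadm L F \<Longrightarrow> psi p W L F = complex_of_real t * \<phi> L F + complex_of_real (1 - t) * \<phi>' L F"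
  shows "marginal \<phi>"
proof (rule dominated_marginal[OF erg \<phi>])
  fix f :: "(int \<Rightarrow> 'a) \<Rightarrow> real" and B assume f: "f \<in> borel_measurable Min" "\<And>x. 0 \<le> f x" "\<And>x. f x \<le> B"
  have b: "(\<lambda>x. complex_of_real (f x)) \<in> bdd_meas Min"
    using f by (intro bdd_meas_of_real[where B=B]) auto
  let ?F = "\<lambda>x s t. complex_of_real (f x) * kid {} s t"
  \<comment> \<open>The unit bound at the single configuration of the empty window puts a norm below
    this real part.\<close>
  have "Re (\<phi>' {} ?F) \<ge> 0"
    using kpositive_unit_bound[OF jstate_klinear[OF \<phi>' finite.emptyI b] jstate_kpositive[OF \<phi>' finite.emptyI f]
        finite.emptyI restrict_qconf restrict_qconf] norm_ge_zero order_trans by blast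
  then have "0 \<le> (1 - t) * Re (\<phi>' {} ?F)" using t by simp
  moreover have "(\<integral>x. f x \<partial>p) = t * Re (\<phi> {} ?F) + (1 - t) * Re (\<phi>' {} ?F)"
    using eq[OF jadm_scale[OF finite.emptyI b, of "kid {}"]]
    by (simp add: psi_kid[OF W] complex_eq_iff)
  ultimately have "t * Re (\<phi> {} ?F) \<le> (\<integral>x. f x \<partial>p)" by simp
  then show "Re (\<phi> {} ?F) \<le> inverse t * (\<integral>x. f x \<partial>p)"
    using t by (simp add: field_simps)
qed

text \<open>Each summand of the joint state is the joint state of a channel, but these channels
  decompose W only p-almost surely, while extremality refers to all stationary inputs. Pasting W
  back off an invariant core makes the decomposition valid at every point, and extremality becomes
  applicable.\<close>

lemma ergodic_psi_of_extreme:
  fixes W :: "(int \<Rightarrow> 'a) \<Rightarrow> int set \<Rightarrow> 'h::finite kern \<Rightarrow> complex"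
  assumes ext: "extreme_channel W" and erg: "ergodic_prob p"
  shows "jergodic (psi p W)"
proof -
  have W: "stationary_channel W" using ext by (simp add: extreme_channel_def)
  have cq: "cqchannel W" using W by (simp add: stationary_channel_def)
  have kch: "kchannel V" if "stationary_channel V" for V :: "(int \<Rightarrow> 'a) \<Rightarrow> int set \<Rightarrow> 'h kern \<Rightarrow> complex"
    using that by (simp add: stationary_channel_def cqchannel_kchannel)
  have "\<phi>1 L F = psi p W L F"
    if \<phi>1: "jstate \<phi>1" "jstationary \<phi>1" and \<phi>2: "jstate \<phi>2" "jstationary \<phi>2" and t: "0 < t" "t < 1"
      and eq: "\<And>L F. jadm L F \<Longrightarrow> psi p W L F = complex_of_real t * \<phi>1 L F + complex_of_real (1 - t) * \<phi>2 L F"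
      and F: "jadm L F" for \<phi>1 \<phi>2 and t :: real and L F
  proof -
    have "marginal \<phi>1"
      by (rule summand_marginal[OF erg cq \<phi>1 \<phi>2(1) t eq])
    from disintegration[OF \<phi>1 this W] obtain V1 where V1: "stationary_channel V1"
      and \<phi>V1: "\<And>L F. jadm L F \<Longrightarrow> \<phi>1 L F = psi p V1 L F" by blast
    have "marginal \<phi>2"
      \<comment> \<open>The second summand has weight 1 - t, so the two roles are exchanged.\<close>
      by (rule summand_marginal[OF erg cq \<phi>2 \<phi>1(1), of "1 - t"]) (use t eq in \<open>simp_all add: add.commute\<close>)
    from disintegration[OF \<phi>2 this W] obtain V2 where V2: "stationary_channel V2"
      and \<phi>V2: "\<And>L F. jadm L F \<Longrightarrow> \<phi>2 L F = psi p V2 L F" by blast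
    let ?V = "\<lambda>x L M. complex_of_real t * V1 x L M + complex_of_real (1 - t) * V2 x L M"
    have "AE x in p. \<forall>L M. finite L \<longrightarrow> W x L M = ?V x L M"
    proof (rule psi_eq_AE[OF kch[OF W] kchannel_combination[OF kch[OF V1] kch[OF V2]]])
      fix L F assume F: "jadm L (F :: (int \<Rightarrow> 'a) \<Rightarrow> 'h kern)"
      show "psi p W L F = psi p ?V L F"
        using psi_combination[OF kch[OF V1] kch[OF V2] F] eq[OF F] \<phi>V1[OF F] \<phi>V2[OF F] by simp
    qed
    from invariant_core[OF this] obtain X where X: "X \<in> sets Min" "Tin -` X = X" "AE x in p. x \<in> X"
      and WV: "\<And>x L M. x \<in> X \<Longrightarrow> finite L \<Longrightarrow> W x L M = ?V x L M" by blast
    have glue: "stationary_channel (\<lambda>x. if x \<in> X then V x else W x)" if "stationary_channel V" for V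
      using that by (intro glue_channel[OF W X(1,2)]) (auto simp: stationary_channel_def cqchannel_def)
    let ?W1 = "\<lambda>x. if x \<in> X then V1 x else W x" and ?W2 = "\<lambda>x. if x \<in> X then V2 x else W x"
    have "W x L M = complex_of_real t * ?W1 x L M + complex_of_real (1 - t) * ?W2 x L M"
      if "finite L" for x L M
    proof (cases "x \<in> X")
      case True
      then show ?thesis using WV[OF True that] by simp
    qed (simp add: algebra_simps)
    then have "chan_eq W (\<lambda>x L M. complex_of_real t * ?W1 x L M + complex_of_real (1 - t) * ?W2 x L M)"
      unfolding chan_eq_def by (intro allI impI AE_I2)
    then have "chan_eq ?W1 W"
      using ext glue[OF V1] glue[OF V2] t unfolding extreme_channel_def by blast
    \<comment> \<open>The conclusion is specialised to p, for which \<open>?W1\<close> coincides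
      almost surely with \<open>V1\<close>.\<close>
    then have ae: "AE x in p. ?W1 x L M = W x L M" if "finite L" for L M
      using stat that by (simp only: chan_eq_def)
    have "AE x in p. \<forall>L. finite L \<longrightarrow> (\<forall>s\<in>qconf L. \<forall>t\<in>qconf L. ?W1 x L (eu s t) = W x L (eu s t))"
      by (rule AE_units) (rule ae)
    then have "AE x in p. \<forall>L M. finite L \<longrightarrow> V1 x L M = W x L M"
      using X(3)
    proof eventually_elim
      case (elim x)
      show ?case
      proof (intro allI impI)
        fix L :: "int set" and M :: "'h kern" assume L: "finite L"
        show "V1 x L M = W x L M"
          by (rule klinear_eqI[OF kchannelD(1)[OF kch[OF V1] L] kchannelD(1)[OF kch[OF W] L] L])
            (use elim L in simp)
      qed
    qed
    from psi_cong_AE[OF this kch[OF V1] kch[OF W] F] show ?thesis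
      by (simp add: \<phi>V1[OF F])
  qed
  then show ?thesis
    unfolding jergodic_def using jstate_psi[OF cq] jstationary_psi[OF W] by blast
qed

end

lemma stationary_measureI: "stat_prob p \<Longrightarrow> stationary_measure p"
  by (rule stationary_measure.intro)

text \<open>For an ergodic input the decomposition of W becomes one of joint states, whose
  extremality forces \<open>W1\<close> and W to agree almost surely. For a general stationary input
  the set of disagreement at a fixed observable is Borel, and if it were charged, some ergodic
  measure would charge it as well.\<close>

lemma extreme_of_ergodic:
  fixes W :: "(int \<Rightarrow> 'a::finite) \<Rightarrow> int set \<Rightarrow> 'h::finite kern \<Rightarrow> complex"
  assumes erg: "ergodic_channel W"
  shows "extreme_channel W"
proof -
  have W: "stationary_channel W" using erg by (simp add: ergodic_channel_def)
  have kch: "kchannel V" if "stationary_channel V" for V :: "(int \<Rightarrow> 'a) \<Rightarrow> int set \<Rightarrow> 'h kern \<Rightarrow> complex"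
    using that by (simp add: stationary_channel_def cqchannel_kchannel)
  have "chan_eq W1 W"
    if W1: "stationary_channel W1" and W2: "stationary_channel W2" and t: "0 < t" "t < 1"
      and eq: "chan_eq W (\<lambda>x L M. complex_of_real t * W1 x L M + complex_of_real (1 - t) * W2 x L M)"
    for W1 W2 and t :: real
  proof -
    let ?V = "\<lambda>x L M. complex_of_real t * W1 x L M + complex_of_real (1 - t) * W2 x L M"
    note kV = kchannel_combination[OF kch[OF W1] kch[OF W2]]
    have ergodic_case: "AE x in q. \<forall>L M. finite L \<longrightarrow> W1 x L M = W x L M" if q: "ergodic_prob q" for q
    proof -
      have sq: "stat_prob q" using q by (simp add: ergodic_prob_def)
      interpret q: stationary_measure q by (rule stationary_measureI[OF sq])
      have ae: "AE x in q. W x L M = ?V x L M" if "finite L" for L M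
        using eq sq that by (simp only: chan_eq_def)
      have "AE x in q. \<forall>L. finite L \<longrightarrow> (\<forall>s\<in>qconf L. \<forall>t\<in>qconf L. W x L (eu s t) = ?V x L (eu s t))"
        by (rule AE_units) (rule ae)
      then have WV: "AE x in q. \<forall>L M. finite L \<longrightarrow> W x L M = ?V x L M"
      proof eventually_elim
        case (elim x)
        show ?case
        proof (intro allI impI)
          fix L :: "int set" and M :: "'h kern" assume L: "finite L"
          show "W x L M = ?V x L M"
            by (rule klinear_eqI[OF kchannelD(1)[OF kch[OF W] L] kchannelD(1)[OF kV L] L])
              (rule elim[rule_format, OF L])
        qed
      qed
      have psi_eq: "psi q W L F = complex_of_real t * psi q W1 L F + complex_of_real (1 - t) * psi q W2 L F"
        if F: "jadm L F" for L F
        using q.psi_cong_AE[OF WV kch[OF W] kV F] q.psi_combination[OF kch[OF W1] kch[OF W2] F] by simp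
      have cq: "cqchannel W1" "cqchannel W2" using W1 W2 by (simp_all add: stationary_channel_def)
      have "jergodic (psi q W)" using erg q by (simp add: ergodic_channel_def)
      then have "\<forall>L F. jadm L F \<longrightarrow> psi q W1 L F = psi q W L F"
        using q.jstate_psi[OF cq(1)] q.jstationary_psi[OF W1] q.jstate_psi[OF cq(2)] q.jstationary_psi[OF W2] t psi_eq
        unfolding jergodic_def by blast
      then show ?thesis by (intro q.psi_eq_AE[OF kch[OF W1] kch[OF W]]) blast
    qed
    show ?thesis
      unfolding chan_eq_def
    proof (intro allI impI)
      fix p :: "(int \<Rightarrow> 'a) measure" and L :: "int set" and M :: "'h kern"
      assume p: "stat_prob p" and L: "finite L"
      interpret stationary_measure p by (rule stationary_measureI[OF p])
      let ?S = "{x. W1 x L M \<noteq> W x L M}"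
      have "(\<lambda>x. W1 x L M) \<in> borel_measurable Min" "(\<lambda>x. W x L M) \<in> borel_measurable Min"
        using W1 W L by (simp_all add: stationary_channel_def cqchannel_def)
      then have "(\<lambda>x. W1 x L M - W x L M) -` (- {0}) \<inter> space Min \<in> sets Min"
        by (intro measurable_sets[OF borel_measurable_diff]) auto
      moreover have "(\<lambda>x. W1 x L M - W x L M) -` (- {0}) \<inter> space Min = ?S"
        by (auto simp: space_Min)
      ultimately have S: "?S \<in> sets Min" by simp
      have "emeasure p ?S = 0"
      proof (rule ccontr)
        assume "emeasure p ?S \<noteq> 0"
        from ex_ergodic[OF S this] obtain q where q: "ergodic_prob q" "emeasure q ?S \<noteq> 0" by blast
        have sq: "stat_prob q" using q by (simp add: ergodic_prob_def)
        interpret q: stationary_measure q by (rule stationary_measureI[OF sq])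
        have "AE x in q. W1 x L M = W x L M"
          using ergodic_case[OF q(1)] by eventually_elim (use L in simp)
        moreover have "(AE x in q. W1 x L M = W x L M) \<longleftrightarrow> emeasure q ?S = 0"
          by (rule AE_iff_measurable) (simp_all add: S q.sets_p q.space_UNIV)
        ultimately have "emeasure q ?S = 0" by simp
        with q(2) show False by simp
      qed
      moreover have "(AE x in p. W1 x L M = W x L M) \<longleftrightarrow> emeasure p ?S = 0"
        by (rule AE_iff_measurable) (simp_all add: S sets_p space_UNIV)
      ultimately show "AE x in p. W1 x L M = W x L M" by simp
    qed
  qed
  then show ?thesis unfolding extreme_channel_def using W by blast
qed

theorem theorem3:
  fixes W :: "(int \<Rightarrow> 'a::finite) \<Rightarrow> int set \<Rightarrow> 'h::finite kern \<Rightarrow> complex"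
  assumes "stationary_channel W"
  shows "extreme_channel W \<longleftrightarrow> ergodic_channel W"
proof
  assume ext: "extreme_channel W"
  have "jergodic (psi p W)" if "ergodic_prob p" for p
  proof -
    have "stat_prob p" using that by (simp add: ergodic_prob_def)
    then interpret stationary_measure p by (rule stationary_measureI)
    show ?thesis by (rule ergodic_psi_of_extreme[OF ext that])
  qed
  then show "ergodic_channel W" using assms by (simp add: ergodic_channel_def)
qed (rule extreme_of_ergodic)

end
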